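(* For $\lambda\in[0,2)$, $\mu_\lambda$ is the Lévy noise measure whose Lévy–Khintchine representation of the Fourier transform reads as follows: $$\int_{\mathcal D'}e^{i\langle\omega,\varphi\rangle}\,\mu_\lambda(d\omega)=\exp\left[\int_{X\times\mathbb R}\big(e^{is\varphi(x)}-1-is\varphi(x)\big)\,\sigma(dx)\,\nu_\lambda(ds)+ic_\lambda\langle\varphi\rangle\right],\qquad\varphi\in\mathcal D,$$ where $$\nu_\lambda(ds)=\frac{\sqrt{4-\lambda^2}}{2\pi}\,\Big|\Gamma\big(1+i(4-\lambda^2)^{-1/2}s\big)\Big|^2\exp\Big[2s(4-\lambda^2)^{-1/2}\arctan\big(\lambda(4-\lambda^2)^{-1/2}\big)\Big]\,\frac1{s^2}\,ds .$$
   Context: Setting. $X$ is a complete, connected, oriented, non-compact $C^\infty$ Riemannian manifold; $\sigma$ is a Radon measure on $(X,\mathcal B(X))$ that is non-atomic and non-degenerate ($\sigma(O)>0$ for every non-empty open $O$). $\mathcal D=C_0^\infty(X)$ (real-valued, usual nuclear topology), $\mathcal H=L^2(X;\sigma)$, $\mathcal D'$ is the dual of $\mathcal D$ with respect to the zero space $\mathcal H$, with dual pairing $\langle\cdot,\cdot\rangle$ and cylinder $\sigma$-algebra $\mathcal C_\sigma(\mathcal D')$. The subscript $\mathbb C$ denotes complexification, $\hat\otimes$ the symmetric tensor power/product, $(\cdot)^\sim$ symmetrization, $\langle\xi\rangle:=\int_X\xi\,d\sigma$. "Lévy noise measure" means a probability measure on $\mathcal D'$ whose Fourier transform is given by a Lévy–Khintchine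 formula of the displayed kind, with Lévy measure $\nu_\lambda$ on $\mathbb R$. Extended Fock space. Let $A_n$ be the set of collections $\alpha_n=\{\kappa_1,\dots,\kappa_{|\alpha_n|}\}$ of loops over $\{1,\dots,n\}$: the underlying sets of the loops partition $\{1,\dots,n\}$, and a loop is an ordering of its points up to cyclic permutation (so $A_n$ has $n!$ elements); $|\kappa_j|$ is the number of points of $\kappa_j$. For $f^{(n)}\in\mathcal D_{\mathbb C}^{\hat\otimes n}$ let $f^{(n)}_{\alpha_n}(x_1,\dots,x_{|\alpha_n|})=f^{(n)}(x_1,\dots,x_1,\dots,x_{|\alpha_n|},\dots,x_{|\alpha_n|})$, with $x_j$ repeated $|\kappa_j|$ times. $\mathcal F^{(n)}_{\mathrm{ext}}(\mathcal H)$ is the closure of $\mathcal D_{\mathbb C}^{\hat\otimes n}$ with respect to $(f^{(n)},g^{(n)})=\sum_{\alpha_n\in A_n}\int_{X^{|\alpha_n|}}(\overline{f^{(n)}}g^{(n)})_{\alpha_n}\,d\sigma^{\otimes|\alpha_n|}$, $\mathcal F^{(0)}_{\mathrm{ext}}=\mathbb C$, and $\mathcal F_{\mathrm{ext}}(\mathcal H)=\bigoplus_{n\ge0}\mathcal F^{(n)}_{\mathrm{ext}}(\mathcal H)\,n!$ (norm squared $\sum_n\|f^{(n)}\|^2n!$). $\mathcal F_{\mathrm{fin}}(\mathcal D)$ is the dense set of finite sequences with $f^{(n)}\in\mathcal D_{\mathbb C}^{\hat\otimes n}$; $\Omega=(1,0,0,\dots)$. Operators. For $\xi\in\mathcal D$,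 on $\mathcal F_{\mathrm{fin}}(\mathcal D)$: $a^+(\xi)f^{(n)}=\xi\hat\otimes f^{(n)}$; $(a^0(\xi)f^{(n)})(x_1,\dots,x_n)=n(\xi(x_1)f^{(n)}(x_1,\dots,x_n))^\sim$; $a^-(\xi)=a_1^-(\xi)+a_2^-(\xi)$ with $(a_1^-(\xi)f^{(n)})(x_1,\dots,x_{n-1})=n\int_X\xi(x)f^{(n)}(x,x_1,\dots,x_{n-1})\,\sigma(dx)$, $(a_2^-(\xi)f^{(n)})(x_1,\dots,x_{n-1})=n(n-1)(\xi(x_1)f^{(n)}(x_1,x_1,x_2,\dots,x_{n-1}))^\sim$. For $\lambda\ge0$, $a_\lambda(\xi)=a^+(\xi)+\lambda a^0(\xi)+a^-(\xi)+c_\lambda\langle\xi\rangle\mathrm{id}$, with $c_\lambda=\lambda/2$ for $\lambda\in[0,2]$ and $c_\lambda=2/(\lambda+\sqrt{\lambda^2-4})$ for $\lambda>2$. These operators are essentially selfadjoint in $\mathcal F_{\mathrm{ext}}(\mathcal H)$ with commuting closures $a_\lambda^\sim(\xi)$. $\mu_\lambda$ and $I_\lambda$ are the unique probability measure on $(\mathcal D',\mathcal C_\sigma(\mathcal D'))$ and the unique unitary $I_\lambda:\mathcal F_{\mathrm{ext}}(\mathcal H)\to L^2(\mathcal D';\mu_\lambda)$ such that $I_\lambda\Omega=1$ and, for every $\xi\in\mathcal D$, $I_\lambda$ carries $a_\lambda^\sim(\xi)$ to multiplication by $\langle\cdot,\xi\rangle$. *)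

theory Defs
  imports "HOL-Probability.Probability" "HOL-Combinatorics.Permutations"
begin

section \<open>Smoothness\<close>

text \<open>
  All partial derivatives are taken along a set \<open>T\<close> of one-parameter coordinate translations
  \<open>\<tau> t x\<close>, so that one definition serves both open subsets of \<open>real ^ 'n\<close> and open subsets of the
  \<open>m\<close>-fold power of \<open>real ^ 'n\<close>, where \<open>m\<close> is a variable and points are functions on \<open>{..<m}\<close>.
  A function on an open set is \<open>C\<^sup>\<infinity>\<close> iff all its iterated partial derivatives exist and are
  continuous.
\<close>

definition partial :: "(real \<Rightarrow> 'v \<Rightarrow> 'v) \<Rightarrow> ('v \<Rightarrow> 'b::real_normed_vector) \<Rightarrow> 'v \<Rightarrow> 'b" where
  "partial \<tau> f x = vector_derivative (\<lambda>t. f (\<tau> t x)) (at 0)"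

primrec partials :: "(real \<Rightarrow> 'v \<Rightarrow> 'v) list \<Rightarrow> ('v \<Rightarrow> 'b::real_normed_vector) \<Rightarrow> 'v \<Rightarrow> 'b" where
  "partials [] f = f"
| "partials (\<tau> # \<tau>s) f = partial \<tau> (partials \<tau>s f)"

definition smooth_on ::
  "(real \<Rightarrow> 'v \<Rightarrow> 'v) set \<Rightarrow> 'v::topological_space set \<Rightarrow> ('v \<Rightarrow> 'b::real_normed_vector) \<Rightarrow> bool" where
  "smooth_on T W f \<longleftrightarrow>
     (\<forall>\<tau>s \<in> lists T. continuous_on W (partials \<tau>s f) \<and>
        (\<forall>\<tau>\<in>T. \<forall>x\<in>W. (\<lambda>t. partials \<tau>s f (\<tau> t x)) differentiable (at 0)))"

definition vec_shift :: "'n \<Rightarrow> real \<Rightarrow> real ^ 'n \<Rightarrow> real ^ 'n::finite" where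
  "vec_shift j t x = x + t *\<^sub>R axis j 1"

definition tuple_shift :: "nat \<Rightarrow> 'n \<Rightarrow> real \<Rightarrow> (nat \<Rightarrow> real ^ 'n) \<Rightarrow> (nat \<Rightarrow> real ^ 'n::finite)" where
  "tuple_shift i j t x = x(i := x i + t *\<^sub>R axis j 1)"

definition vec_shifts :: "(real \<Rightarrow> real ^ 'n \<Rightarrow> real ^ 'n::finite) set" where
  "vec_shifts = range vec_shift"

definition tuple_shifts :: "nat \<Rightarrow> (real \<Rightarrow> (nat \<Rightarrow> real ^ 'n) \<Rightarrow> (nat \<Rightarrow> real ^ 'n::finite)) set" where
  "tuple_shifts m = {tuple_shift i j |i j. i < m}"


section \<open>Oriented Riemannian manifolds\<close>

text \<open>
  The manifold \<open>X\<close> is the whole type \<open>'a\<close> and its dimension is \<open>CARD('n)\<close>. A chart is a pair of its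
  domain and its coordinate map. The atlas need not be maximal; the orientation is the one for which
  the charts of the atlas are positively oriented. A Riemannian metric is given by its
  Gram matrices \<open>g k p\<close> in the charts \<open>k\<close>, with \<open>p\<close> ranging over the coordinate image of \<open>k\<close>.
\<close>

type_synonym ('a, 'n) chart = "'a set \<times> ('a \<Rightarrow> real ^ 'n)"

definition chart_image :: "('a, 'n::finite) chart \<Rightarrow> (real ^ 'n) set" where
  "chart_image k = snd k ` fst k"

definition chart_inv :: "('a, 'n::finite) chart \<Rightarrow> real ^ 'n \<Rightarrow> 'a" where
  "chart_inv k = inv_into (fst k) (snd k)"

definition transition :: "('a, 'n::finite) chart \<Rightarrow> ('a, 'n) chart \<Rightarrow> real ^ 'n \<Rightarrow> real ^ 'n" where
  "transition k l = snd l \<circ> chart_inv k"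

text \<open>
  \<open>arc_length atlas g x y L\<close>: some piecewise \<open>C\<^sup>1\<close> curve from \<open>x\<close> to \<open>y\<close> has length \<open>L\<close>; the curve is
  a concatenation of finitely many arcs, each parametrised on \<open>[0, 1]\<close> and contained in the domain
  of one chart.
\<close>

inductive arc_length ::
  "('a, 'n::finite) chart set \<Rightarrow> (('a, 'n) chart \<Rightarrow> real ^ 'n \<Rightarrow> real ^ 'n ^ 'n) \<Rightarrow> 'a \<Rightarrow> 'a \<Rightarrow> real \<Rightarrow> bool"
  for atlas g x where
  trivial: "arc_length atlas g x x 0"
| extend: "arc_length atlas g x (chart_inv k (\<gamma> 0)) L \<Longrightarrow> k \<in> atlas \<Longrightarrow>
     \<gamma> C1_differentiable_on {0..1} \<Longrightarrow> \<gamma> ` {0..1} \<subseteq> chart_image k \<Longrightarrow>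
     arc_length atlas g x (chart_inv k (\<gamma> 1))
       (L + integral {0..1} (\<lambda>t. sqrt (vector_derivative \<gamma> (at t) \<bullet>
                                    (g k (\<gamma> t) *v vector_derivative \<gamma> (at t)))))"

definition riemannian_dist ::
  "('a, 'n::finite) chart set \<Rightarrow> (('a, 'n) chart \<Rightarrow> real ^ 'n \<Rightarrow> real ^ 'n ^ 'n) \<Rightarrow> 'a \<Rightarrow> 'a \<Rightarrow> real" where
  "riemannian_dist atlas g x y = Inf {L. arc_length atlas g x y L}"

locale oriented_manifold =
  fixes atlas :: "('a::{t2_space, second_countable_topology}, 'n::finite) chart set"
  assumes chart_open: "k \<in> atlas \<Longrightarrow> open (fst k) \<and> open (chart_image k)"
    and chart_homeomorphism:
      "k \<in> atlas \<Longrightarrow> inj_on (snd k) (fst k) \<and> homeomorphism (fst k) (chart_image k) (snd k) (chart_inv k)"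
    and charts_cover: "(\<Union>k\<in>atlas. fst k) = UNIV"
    and transition_smooth:
      "k \<in> atlas \<Longrightarrow> l \<in> atlas \<Longrightarrow> smooth_on vec_shifts (snd k ` (fst k \<inter> fst l)) (transition k l)"
    and orientation:
      "k \<in> atlas \<Longrightarrow> l \<in> atlas \<Longrightarrow> p \<in> snd k ` (fst k \<inter> fst l) \<Longrightarrow>
         det (jacobian (transition k l) (at p)) > 0"

locale riemannian_manifold = oriented_manifold atlas
  for atlas :: "('a::{t2_space, second_countable_topology}, 'n::finite) chart set" +
  fixes g :: "('a, 'n) chart \<Rightarrow> real ^ 'n \<Rightarrow> real ^ 'n ^ 'n"
  assumes metric_smooth: "k \<in> atlas \<Longrightarrow> smooth_on vec_shifts (chart_image k) (g k)"
    and metric_symmetric: "k \<in> atlas \<Longrightarrow> p \<in> chart_image k \<Longrightarrow> transpose (g k p) = g k p"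
    and metric_positive:
      "k \<in> atlas \<Longrightarrow> p \<in> chart_image k \<Longrightarrow> v \<noteq> 0 \<Longrightarrow> v \<bullet> (g k p *v v) > 0"
    and metric_transition:
      "k \<in> atlas \<Longrightarrow> l \<in> atlas \<Longrightarrow> p \<in> snd k ` (fst k \<inter> fst l) \<Longrightarrow>
         g k p = transpose (jacobian (transition k l) (at p)) ** g l (transition k l p)
                   ** jacobian (transition k l) (at p)"

definition radon_measure :: "'a::t2_space measure \<Rightarrow> bool" where
  "radon_measure \<sigma> \<longleftrightarrow> sets \<sigma> = sets borel \<and> (\<forall>K. compact K \<longrightarrow> emeasure \<sigma> K < \<infinity>) \<and>
     (\<forall>A\<in>sets borel. emeasure \<sigma> A = (SUP K\<in>{K. compact K \<and> K \<subseteq> A}. emeasure \<sigma> K))"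

definition non_atomic :: "'a measure \<Rightarrow> bool" where
  "non_atomic \<sigma> \<longleftrightarrow> \<not> (\<exists>A\<in>sets \<sigma>. emeasure \<sigma> A > 0 \<and>
     (\<forall>B\<in>sets \<sigma>. B \<subseteq> A \<longrightarrow> emeasure \<sigma> B = 0 \<or> emeasure \<sigma> B = emeasure \<sigma> A))"

locale noise_setting = riemannian_manifold atlas g
  for atlas :: "('a::{t2_space, second_countable_topology}, 'n::finite) chart set" and g +
  fixes \<sigma> :: "'a measure"
  assumes complete: "Metric_space.mcomplete UNIV (riemannian_dist atlas g)"
    and connected: "connected (UNIV :: 'a set)"
    and non_compact: "\<not> compact (UNIV :: 'a set)"
    and radon: "radon_measure \<sigma>"
    and non_atomic: "non_atomic \<sigma>"
    and non_degenerate: "open U \<Longrightarrow> U \<noteq> {} \<Longrightarrow> emeasure \<sigma> U > 0"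


section \<open>Test functions and generalized functions\<close>

definition test_functions ::
  "('a::topological_space, 'n::finite) chart set \<Rightarrow> ('a \<Rightarrow> real) set" where
  "test_functions atlas =
     {\<xi>. (\<forall>k\<in>atlas. smooth_on vec_shifts (chart_image k) (\<xi> \<circ> chart_inv k)) \<and>
         compact (closure {x. \<xi> x \<noteq> 0})}"

definition chart_seminorm :: "('a, 'n::finite) chart \<Rightarrow> 'a set \<Rightarrow> 'n list \<Rightarrow> ('a \<Rightarrow> real) \<Rightarrow> real" where
  "chart_seminorm k L js f =
     (SUP x\<in>L. \<bar>partials (map vec_shift js) (f \<circ> chart_inv k) (snd k x)\<bar>)"

text \<open>
  The usual topology of \<open>C\<^sub>0\<^sup>\<infinity>\<close> is the strict inductive limit of the Frechet spaces of test functions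
  supported in a fixed compact set: a seminorm is continuous iff its restriction to each of these
  spaces is, i.e. is dominated there by finitely many of the chart seminorms.
\<close>

definition continuous_seminorm ::
  "('a::topological_space, 'n::finite) chart set \<Rightarrow> (('a \<Rightarrow> real) \<Rightarrow> real) \<Rightarrow> bool" where
  "continuous_seminorm atlas p \<longleftrightarrow>
     (\<forall>f\<in>test_functions atlas. \<forall>c. p (\<lambda>x. c * f x) = \<bar>c\<bar> * p f) \<and>
     (\<forall>f\<in>test_functions atlas. \<forall>h\<in>test_functions atlas. p (\<lambda>x. f x + h x) \<le> p f + p h) \<and>
     (\<forall>K. compact K \<longrightarrow>
       (\<exists>S C. finite S \<and> (\<forall>(k, L, js)\<in>S. k \<in> atlas \<and> compact L \<and> L \<noteq> {} \<and> L \<subseteq> fst k) \<and>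
         (\<forall>f\<in>test_functions atlas. (\<forall>x. x \<notin> K \<longrightarrow> f x = 0) \<longrightarrow>
            p f \<le> C * (\<Sum>(k, L, js)\<in>S. chart_seminorm k L js f))))"

definition test_topology ::
  "('a::topological_space, 'n::finite) chart set \<Rightarrow> ('a \<Rightarrow> real) topology" where
  "test_topology atlas = topology_generated_by
     {{h \<in> test_functions atlas. p (\<lambda>x. h x - f x) < \<epsilon>} |p f \<epsilon>.
        continuous_seminorm atlas p \<and> f \<in> test_functions atlas \<and> \<epsilon> > 0}"

text \<open>
  A generalized function is a continuous linear functional on the space of test functions, and the
  pairing of \<open>\<omega>\<close> and \<open>\<xi>\<close> is \<open>\<omega> \<xi>\<close>. Functionals are extensional, so that each is represented once.
\<close>

definition dual_space ::
  "('a::topological_space, 'n::finite) chart set \<Rightarrow> (('a \<Rightarrow> real) \<Rightarrow> real) set" where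
  "dual_space atlas =
     {\<omega> \<in> extensional (test_functions atlas).
        (\<forall>f\<in>test_functions atlas. \<forall>h\<in>test_functions atlas. \<forall>a b.
           \<omega> (\<lambda>x. a * f x + b * h x) = a * \<omega> f + b * \<omega> h) \<and>
        continuous_map (test_topology atlas) euclideanreal \<omega>}"

definition cylinder_algebra ::
  "('a::topological_space, 'n::finite) chart set \<Rightarrow> (('a \<Rightarrow> real) \<Rightarrow> real) measure" where
  "cylinder_algebra atlas = sigma (dual_space atlas)
     {{\<omega> \<in> dual_space atlas. (\<lambda>i\<in>{..<m::nat}. \<omega> (\<phi> i)) \<in> B} |m \<phi> B.
        (\<forall>i<m. \<phi> i \<in> test_functions atlas) \<and> B \<in> sets (PiM {..<m} (\<lambda>_. borel :: real measure))}"


section \<open>The extended Fock space\<close>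

text \<open>
  Points of the \<open>n\<close>-th power of \<open>X\<close> are extensional functions on \<open>{..<n}\<close>, i.e. elements of
  \<open>{..<n} \<rightarrow>\<^sub>E UNIV\<close>; values of \<open>f\<close> elsewhere are irrelevant. The power for \<open>n = 0\<close> is a single point,
  so that functions on it are scalars.
\<close>

definition symmetric_fun :: "nat \<Rightarrow> ((nat \<Rightarrow> 'a) \<Rightarrow> complex) \<Rightarrow> bool" where
  "symmetric_fun n f \<longleftrightarrow> (\<forall>x \<in> {..<n} \<rightarrow>\<^sub>E UNIV. \<forall>\<pi>. \<pi> permutes {..<n} \<longrightarrow> f (x \<circ> \<pi>) = f x)"

definition symmetrize :: "nat \<Rightarrow> ((nat \<Rightarrow> 'a) \<Rightarrow> complex) \<Rightarrow> (nat \<Rightarrow> 'a) \<Rightarrow> complex" where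
  "symmetrize n f x = (\<Sum>\<pi> | \<pi> permutes {..<n}. f (x \<circ> \<pi>)) / fact n"

text \<open>
  The \<open>n\<close>-th symmetric tensor power of the complexified nuclear space of test functions is the space
  of symmetric, compactly supported complex \<open>C\<^sup>\<infinity>\<close> functions on the \<open>n\<close>-th power of \<open>X\<close>.
\<close>

definition sym_test_functions ::
  "('a::topological_space, 'n::finite) chart set \<Rightarrow> nat \<Rightarrow> ((nat \<Rightarrow> 'a) \<Rightarrow> complex) set" where
  "sym_test_functions atlas n =
     {f. (\<forall>ks. (\<forall>i<n. ks i \<in> atlas) \<longrightarrow>
            smooth_on (tuple_shifts n) (PiE {..<n} (\<lambda>i. chart_image (ks i)))
              (\<lambda>y. f (\<lambda>i\<in>{..<n}. chart_inv (ks i) (y i)))) \<and>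
         compact (closure {x \<in> {..<n} \<rightarrow>\<^sub>E UNIV. f x \<noteq> 0}) \<and>
         symmetric_fun n f}"

text \<open>A loop is the set of all rotations of a nonempty list of distinct points.\<close>

definition is_loop :: "nat list set \<Rightarrow> bool" where
  "is_loop \<kappa> \<longleftrightarrow> (\<exists>xs. xs \<noteq> [] \<and> distinct xs \<and> \<kappa> = range (\<lambda>r. rotate r xs))"

definition loop_points :: "nat list set \<Rightarrow> nat set" where
  "loop_points \<kappa> = (\<Union>xs\<in>\<kappa>. set xs)"

definition loop_collections :: "nat \<Rightarrow> nat list set set set" where
  "loop_collections n = {\<alpha>. (\<forall>\<kappa>\<in>\<alpha>. is_loop \<kappa>) \<and> inj_on loop_points \<alpha> \<and>
     partition_on {1..n} (loop_points ` \<alpha>)}"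

text \<open>
  The sizes of the loops in some enumeration of \<open>\<alpha>\<close>. Only symmetric functions are evaluated on the
  diagonals below, and for these the order of enumeration does not affect any integral.
\<close>

definition loop_sizes :: "nat list set set \<Rightarrow> nat list" where
  "loop_sizes \<alpha> = map (card \<circ> loop_points) (SOME \<kappa>s. distinct \<kappa>s \<and> set \<kappa>s = \<alpha>)"

definition repeat_entries :: "nat list \<Rightarrow> (nat \<Rightarrow> 'a) \<Rightarrow> nat \<Rightarrow> 'a" where
  "repeat_entries ms x =
     (\<lambda>i\<in>{..<sum_list ms}. concat (map (\<lambda>j. replicate (ms ! j) (x j)) [0..<length ms]) ! i)"

definition on_diagonal :: "nat list set set \<Rightarrow> ((nat \<Rightarrow> 'a) \<Rightarrow> complex) \<Rightarrow> (nat \<Rightarrow> 'a) \<Rightarrow> complex" where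
  "on_diagonal \<alpha> f x = f (repeat_entries (loop_sizes \<alpha>) x)"

definition power_measure :: "'a measure \<Rightarrow> nat \<Rightarrow> (nat \<Rightarrow> 'a) measure" where
  "power_measure \<sigma> m = PiM {..<m} (\<lambda>_. \<sigma>)"

definition ext_inner ::
  "'a measure \<Rightarrow> nat \<Rightarrow> ((nat \<Rightarrow> 'a) \<Rightarrow> complex) \<Rightarrow> ((nat \<Rightarrow> 'a) \<Rightarrow> complex) \<Rightarrow> complex" where
  "ext_inner \<sigma> n f h =
     (\<Sum>\<alpha>\<in>loop_collections n. LINT x|power_measure \<sigma> (card \<alpha>). on_diagonal \<alpha> (\<lambda>y. cnj (f y) * h y) x)"

definition ext_norm :: "'a measure \<Rightarrow> nat \<Rightarrow> ((nat \<Rightarrow> 'a) \<Rightarrow> complex) \<Rightarrow> real" where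
  "ext_norm \<sigma> n f = sqrt (Re (ext_inner \<sigma> n f f))"

definition square_integrable :: "'b measure \<Rightarrow> ('b \<Rightarrow> complex) set" where
  "square_integrable M = {f \<in> borel_measurable M. integrable M (\<lambda>x. (cmod (f x))\<^sup>2)}"

text \<open>
  As usual for \<open>L\<^sup>2\<close> spaces, elements of Hilbert spaces are represented by functions, which are
  identified if their difference has norm \<open>0\<close>. The closure of the symmetric test functions is taken
  in the Hilbert space of measurable functions on the \<open>n\<close>-th power of \<open>X\<close> of finite \<open>ext_norm\<close>; this
  is the \<open>L\<^sup>2\<close> space of the sum, over \<open>\<alpha>\<close>, of the images of the product measures on the diagonals,
  hence complete.
\<close>

definition ext_space_n ::
  "('a::topological_space, 'n::finite) chart set \<Rightarrow> 'a measure \<Rightarrow> nat \<Rightarrow> ((nat \<Rightarrow> 'a) \<Rightarrow> complex) set" where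
  "ext_space_n atlas \<sigma> n =
     {f \<in> borel_measurable (power_measure \<sigma> n).
        (\<forall>\<alpha>\<in>loop_collections n. on_diagonal \<alpha> f \<in> square_integrable (power_measure \<sigma> (card \<alpha>))) \<and>
        (\<forall>\<epsilon>>0. \<exists>h\<in>sym_test_functions atlas n. ext_norm \<sigma> n (\<lambda>x. f x - h x) < \<epsilon>)}"

type_synonym 'a fock = "nat \<Rightarrow> (nat \<Rightarrow> 'a) \<Rightarrow> complex"

definition ext_fock ::
  "('a::topological_space, 'n::finite) chart set \<Rightarrow> 'a measure \<Rightarrow> 'a fock set" where
  "ext_fock atlas \<sigma> = {F. (\<forall>n. F n \<in> ext_space_n atlas \<sigma> n) \<and>
     summable (\<lambda>n. (ext_norm \<sigma> n (F n))\<^sup>2 * fact n)}"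

definition fock_inner :: "'a measure \<Rightarrow> 'a fock \<Rightarrow> 'a fock \<Rightarrow> complex" where
  "fock_inner \<sigma> F G = (\<Sum>n. ext_inner \<sigma> n (F n) (G n) * fact n)"

definition fock_norm :: "'a measure \<Rightarrow> 'a fock \<Rightarrow> real" where
  "fock_norm \<sigma> F = sqrt (\<Sum>n. (ext_norm \<sigma> n (F n))\<^sup>2 * fact n)"

definition fock_fin :: "('a::topological_space, 'n::finite) chart set \<Rightarrow> 'a fock set" where
  "fock_fin atlas = {F. (\<forall>n. F n \<in> sym_test_functions atlas n) \<and>
     (\<exists>N. \<forall>n>N. \<forall>x \<in> {..<n} \<rightarrow>\<^sub>E UNIV. F n x = 0)}"

definition vacuum :: "'a fock" where
  "vacuum n x = (if n = 0 then 1 else 0)"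


section \<open>The Jacobi fields\<close>

text \<open>
  The variables are numbered from \<open>0\<close>, so \<open>x 0\<close> is the first one, and \<open>case_nat y x\<close> is the tuple \<open>x\<close>
  preceded by \<open>y\<close>. In \<open>creation\<close>, \<open>neutral\<close>, \<open>annihilation1\<close> and \<open>annihilation2\<close>, the argument \<open>n\<close> is
  the degree of the function \<open>f\<close> operated on.
\<close>

definition creation :: "('a \<Rightarrow> real) \<Rightarrow> nat \<Rightarrow> ((nat \<Rightarrow> 'a) \<Rightarrow> complex) \<Rightarrow> (nat \<Rightarrow> 'a) \<Rightarrow> complex" where
  "creation \<xi> n f = symmetrize (Suc n) (\<lambda>x. complex_of_real (\<xi> (x 0)) * f (\<lambda>i. x (Suc i)))"

definition neutral :: "('a \<Rightarrow> real) \<Rightarrow> nat \<Rightarrow> ((nat \<Rightarrow> 'a) \<Rightarrow> complex) \<Rightarrow> (nat \<Rightarrow> 'a) \<Rightarrow> complex" where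
  "neutral \<xi> n f x = of_nat n * symmetrize n (\<lambda>y. complex_of_real (\<xi> (y 0)) * f y) x"

definition annihilation1 ::
  "'a measure \<Rightarrow> ('a \<Rightarrow> real) \<Rightarrow> nat \<Rightarrow> ((nat \<Rightarrow> 'a) \<Rightarrow> complex) \<Rightarrow> (nat \<Rightarrow> 'a) \<Rightarrow> complex" where
  "annihilation1 \<sigma> \<xi> n f x = of_nat n * (LINT y|\<sigma>. complex_of_real (\<xi> y) * f (case_nat y x))"

definition annihilation2 :: "('a \<Rightarrow> real) \<Rightarrow> nat \<Rightarrow> ((nat \<Rightarrow> 'a) \<Rightarrow> complex) \<Rightarrow> (nat \<Rightarrow> 'a) \<Rightarrow> complex" where
  "annihilation2 \<xi> n f x = of_nat n * of_nat (n - 1) *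
     symmetrize (n - 1) (\<lambda>y. complex_of_real (\<xi> (y 0)) * f (case_nat (y 0) y)) x"

definition c_coeff :: "real \<Rightarrow> real" where
  "c_coeff lam = (if lam \<le> 2 then lam / 2 else 2 / (lam + sqrt (lam\<^sup>2 - 4)))"

definition jacobi_op :: "'a measure \<Rightarrow> real \<Rightarrow> ('a \<Rightarrow> real) \<Rightarrow> 'a fock \<Rightarrow> 'a fock" where
  "jacobi_op \<sigma> lam \<xi> F n x =
     (case n of 0 \<Rightarrow> 0 | Suc m \<Rightarrow> creation \<xi> m (F m) x)
     + complex_of_real lam * neutral \<xi> n (F n) x
     + annihilation1 \<sigma> \<xi> (Suc n) (F (Suc n)) x + annihilation2 \<xi> (Suc n) (F (Suc n)) x
     + complex_of_real (c_coeff lam * (LINT y|\<sigma>. \<xi> y)) * F n x"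

text \<open>The graph of the closure of \<open>jacobi_op \<sigma> lam \<xi>\<close> with domain \<open>fock_fin atlas\<close>.\<close>

definition jacobi_closure ::
  "('a::topological_space, 'n::finite) chart set \<Rightarrow> 'a measure \<Rightarrow> real \<Rightarrow> ('a \<Rightarrow> real) \<Rightarrow>
     ('a fock \<times> 'a fock) set" where
  "jacobi_closure atlas \<sigma> lam \<xi> =
     {(F, G). F \<in> ext_fock atlas \<sigma> \<and> G \<in> ext_fock atlas \<sigma> \<and>
        (\<exists>H. (\<forall>k. H k \<in> fock_fin atlas) \<and>
          (\<lambda>k. fock_norm \<sigma> (\<lambda>n x. H k n x - F n x)) \<longlonglongrightarrow> 0 \<and>
          (\<lambda>k. fock_norm \<sigma> (\<lambda>n x. jacobi_op \<sigma> lam \<xi> (H k) n x - G n x)) \<longlonglongrightarrow> 0)}"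

definition fock_unitary ::
  "('a::topological_space, 'n::finite) chart set \<Rightarrow> 'a measure \<Rightarrow> 'b measure \<Rightarrow>
     ('a fock \<Rightarrow> 'b \<Rightarrow> complex) \<Rightarrow> bool" where
  "fock_unitary atlas \<sigma> M I \<longleftrightarrow>
     (\<forall>F\<in>ext_fock atlas \<sigma>. I F \<in> square_integrable M) \<and>
     (\<forall>F\<in>ext_fock atlas \<sigma>. \<forall>G\<in>ext_fock atlas \<sigma>. \<forall>a b.
        AE \<omega> in M. I (\<lambda>n x. a * F n x + b * G n x) \<omega> = a * I F \<omega> + b * I G \<omega>) \<and>
     (\<forall>F\<in>ext_fock atlas \<sigma>. \<forall>G\<in>ext_fock atlas \<sigma>.
        (LINT \<omega>|M. cnj (I F \<omega>) * I G \<omega>) = fock_inner \<sigma> F G) \<and>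
     (\<forall>h\<in>square_integrable M. \<exists>F\<in>ext_fock atlas \<sigma>. AE \<omega> in M. I F \<omega> = h \<omega>)"

text \<open>
  The defining property of the pair of \<open>\<mu>\<close> and \<open>I\<close>. In the last clause, \<open>I\<close> maps the graph of the
  closed operator onto the graph of the (maximal) operator of multiplication by \<open>\<omega> \<xi>\<close>.
\<close>

definition spectral_pair ::
  "('a::topological_space, 'n::finite) chart set \<Rightarrow> 'a measure \<Rightarrow> real \<Rightarrow>
     (('a \<Rightarrow> real) \<Rightarrow> real) measure \<Rightarrow> ('a fock \<Rightarrow> (('a \<Rightarrow> real) \<Rightarrow> real) \<Rightarrow> complex) \<Rightarrow> bool" where
  "spectral_pair atlas \<sigma> lam \<mu> I \<longleftrightarrow>
     prob_space \<mu> \<and> space \<mu> = dual_space atlas \<and> sets \<mu> = sets (cylinder_algebra atlas) \<and>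
     fock_unitary atlas \<sigma> \<mu> I \<and>
     (AE \<omega> in \<mu>. I vacuum \<omega> = 1) \<and>
     (\<forall>\<xi>\<in>test_functions atlas. \<forall>F\<in>ext_fock atlas \<sigma>. \<forall>G\<in>ext_fock atlas \<sigma>.
        (F, G) \<in> jacobi_closure atlas \<sigma> lam \<xi> \<longleftrightarrow>
        (AE \<omega> in \<mu>. I G \<omega> = complex_of_real (\<omega> \<xi>) * I F \<omega>))"


section \<open>Levy noise\<close>

definition levy_measure :: "real measure \<Rightarrow> bool" where
  "levy_measure \<nu> \<longleftrightarrow> sets \<nu> = sets borel \<and> emeasure \<nu> {0} = 0 \<and>
     (\<integral>\<^sup>+ s. ennreal (min 1 (s\<^sup>2)) \<partial>\<nu>) < \<infinity>"

definition levy_integrand :: "('a \<Rightarrow> real) \<Rightarrow> 'a \<times> real \<Rightarrow> complex" where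
  "levy_integrand \<phi> = (\<lambda>(x, s). exp (\<i> * complex_of_real (s * \<phi> x)) - 1 - \<i> * complex_of_real (s * \<phi> x))"

text \<open>Integrability is required because \<open>lebesgue_integral\<close> is \<open>0\<close> for non-integrable functions.\<close>

definition levy_noise_measure ::
  "('a::topological_space, 'n::finite) chart set \<Rightarrow> 'a measure \<Rightarrow> (('a \<Rightarrow> real) \<Rightarrow> real) measure \<Rightarrow>
     real measure \<Rightarrow> real \<Rightarrow> bool" where
  "levy_noise_measure atlas \<sigma> \<mu> \<nu> c \<longleftrightarrow>
     prob_space \<mu> \<and> space \<mu> = dual_space atlas \<and> sets \<mu> = sets (cylinder_algebra atlas) \<and>
     levy_measure \<nu> \<and>
     (\<forall>\<phi>\<in>test_functions atlas.
        integrable (\<sigma> \<Otimes>\<^sub>M \<nu>) (levy_integrand \<phi>) \<and>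
        (LINT \<omega>|\<mu>. exp (\<i> * complex_of_real (\<omega> \<phi>))) =
          exp ((LINT z|(\<sigma> \<Otimes>\<^sub>M \<nu>). levy_integrand \<phi> z) + \<i> * complex_of_real (c * (LINT x|\<sigma>. \<phi> x))))"

end

theory Submission
  imports Defs "HOL-Complex_Analysis.Complex_Analysis"
begin

text \<open>
  Since \<open>I\<close> intertwines the Jacobi operator of \<open>\<phi>\<close> with multiplication by \<open>\<omega> \<phi>\<close> and maps the vacuum
  to \<open>1\<close>, the moments of \<open>\<omega> \<phi>\<close> under \<open>\<mu>\<close> are the vacuum expectations of the powers of that operator.
  These are found by solving \<open>F' = J F\<close>, \<open>F(0) = vacuum\<close> as a formal power series in \<open>t\<close>. The ansatz
  \<open>F(t)\<^sub>n = l(t) u(t)\<^sup>\<otimes>\<^sup>n / n!\<close> closes: on such a vector the creation operator, \<open>lam\<close> times the neutral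
  operator and the second annihilation operator add up to the derivative in the direction
  \<open>\<phi> (1 + lam u + u\<^sup>2)\<close>, while the first annihilation operator multiplies by \<open>\<integral> \<phi> u d\<sigma>\<close>. Hence
  \<open>u(t)(x) = f (t \<phi>(x))\<close>, where \<open>f\<close> solves the Riccati equation \<open>f' = 1 + lam f + f\<^sup>2\<close>, \<open>f(0) = 0\<close>, and
  \<open>l' / l = \<integral> \<phi> u d\<sigma> + c \<integral> \<phi> d\<sigma>\<close> (lemma \<open>jacobi_op_exp_vector\<close>). The coefficients of \<open>F\<close> are polynomials
  in the values of \<open>\<phi>\<close> and lie in the domain of the Jacobi operator, and their components of degree \<open>0\<close>
  show that \<open>l\<close> is the exponential generating series of the moments (lemma \<open>evaluation_moments\<close>).

  For the Levy measure \<open>\<nu>\<close>, write \<open>D = sqrt (4 - lam\<^sup>2) / 2\<close> and \<open>tan \<theta> = lam / (2 D)\<close>. Then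
  \<open>f(t) = D tan (D t + \<theta>) - lam / 2\<close>, and \<open>f'(t) = D\<^sup>2 / cos\<^sup>2 (D t + \<theta>)\<close> is the Laplace transform of
  \<open>s\<^sup>2 \<nu>(ds)\<close>. Indeed \<open>|\<Gamma>(1 + i y)|\<^sup>2 = \<pi> y / sinh (\<pi> y)\<close> by the reflection formula, and the integral
  \<open>\<integral> u exp (2 u y) / sinh (\<pi> u) du = 1 / (2 cos\<^sup>2 y)\<close> follows from the geometric series of \<open>1 / sinh\<close> and
  the reflection formula of the trigamma function. So the Taylor coefficients of \<open>f\<close> are moments of
  \<open>\<nu>\<close> (lemma \<open>meixner_riccati\<close>), and \<open>l\<close> is the Taylor series at \<open>0\<close> of
  \<open>G(z) = exp (\<integral> (exp (z s \<phi>(x)) - 1 - z s \<phi>(x)) \<sigma>(dx) \<nu>(ds) + c z \<integral> \<phi> d\<sigma>)\<close>.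

  It remains to pass from moments to the Fourier transform. The function \<open>G\<close> is holomorphic in a strip
  around the imaginary axis, so the moments grow slowly enough to make \<open>exp (\<epsilon> |\<omega> \<phi>|)\<close> integrable for
  some \<open>\<epsilon> > 0\<close>. The Laplace transform of \<open>\<omega> \<phi>\<close> is therefore holomorphic in a strip as well, and has the
  same derivatives at \<open>0\<close> as \<open>G\<close>. The two functions agree on the strip, and the assertion is their
  equality at \<open>z = \<i>\<close> (lemma \<open>characteristic_function_eq\<close>).
\<close>

section \<open>Integrals depending holomorphically on a parameter\<close>

lemma cauchy_deriv_bound:
  fixes f :: "complex \<Rightarrow> complex"
  assumes "f holomorphic_on ball z r" "0 < s" "s < r" "\<And>w. w \<in> ball z r \<Longrightarrow> norm (f w) \<le> B"
  shows "norm (deriv f z) \<le> B / s"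
proof -
  have sub: "cball z s \<subseteq> ball z r" using assms(3) by auto
  have "norm ((deriv ^^ 1) f z) \<le> fact 1 * B / s ^ 1"
  proof (rule Cauchy_inequality[OF _ _ \<open>0 < s\<close>])
    show "f holomorphic_on ball z s"
      using assms(1,3) by (rule_tac holomorphic_on_subset[OF assms(1)]) auto
    show "continuous_on (cball z s) f"
      using holomorphic_on_imp_continuous_on[OF holomorphic_on_subset[OF assms(1) sub]] .
    show "norm (f x) \<le> B" if "norm (z - x) = s" for x
      using that sub by (intro assms(4)) (auto simp: dist_norm assms(3))
  qed
  thus ?thesis by simp
qed

text \<open>
  A domination of the values alone suffices: by the Cauchy estimate it controls the derivative in the
  parameter, hence all difference quotients near \<open>z\<close>, and dominated convergence applies to them.
\<close>

lemma integral_has_field_derivative: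
  fixes f :: "complex \<Rightarrow> 'b \<Rightarrow> complex" and q :: "'b \<Rightarrow> real"
  assumes r: "0 < r"
    and hol: "\<And>p. p \<in> space M \<Longrightarrow> (\<lambda>w. f w p) holomorphic_on ball z r"
    and meas: "\<And>w. w \<in> ball z r \<Longrightarrow> f w \<in> borel_measurable M"
    and q: "integrable M q"
    and bound: "\<And>w p. w \<in> ball z r \<Longrightarrow> p \<in> space M \<Longrightarrow> norm (f w p) \<le> q p"
  shows "((\<lambda>w. LINT p|M. f w p) has_field_derivative (LINT p|M. deriv (\<lambda>w. f w p) z)) (at z)"
    and "(\<lambda>p. deriv (\<lambda>w. f w p) z) \<in> borel_measurable M"
proof -
  have int: "integrable M (f w)" if "w \<in> ball z r" for w
    by (rule Bochner_Integration.integrable_bound[OF q meas[OF that]])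
      (use bound[OF that] in \<open>auto intro!: AE_I2 order.trans[OF _ abs_ge_self]\<close>)
  have deriv_at: "((\<lambda>w. f w p) has_field_derivative deriv (\<lambda>w. f w p) w) (at w)"
    if "p \<in> space M" "w \<in> ball z r" for p w
    using holomorphic_derivI[OF hol[OF that(1)] _ that(2)] by simp
  have lip: "norm (f w p - f z p) \<le> (4 * q p / r) * norm (w - z)"
    if p: "p \<in> space M" and w: "w \<in> ball z (r/2)" for p w
  proof (rule field_differentiable_bound[of "ball z (r/2)"])
    fix v assume v: "v \<in> ball z (r/2)"
    have sub: "ball v (r/2) \<subseteq> ball z r"
    proof
      fix y assume "y \<in> ball v (r/2)"
      thus "y \<in> ball z r" using v dist_triangle[of z y v] by (auto simp: dist_commute)
    qed
    show "((\<lambda>w. f w p) has_field_derivative deriv (\<lambda>w. f w p) v) (at v within ball z (r/2))"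
      using v r by (intro has_field_derivative_at_within[OF deriv_at[OF p]]) auto
    have "norm (deriv (\<lambda>w. f w p) v) \<le> q p / (r/4)"
      by (rule cauchy_deriv_bound[where r = "r/2"])
        (use sub r p in \<open>auto intro!: holomorphic_on_subset[OF hol] bound\<close>)
    thus "norm (deriv (\<lambda>w. f w p) v) \<le> 4 * q p / r" by (simp add: field_simps)
  qed (use w r in auto)
  let ?D = "\<lambda>p. deriv (\<lambda>w. f w p) z"
  have quot: "(\<lambda>i. (f (X i) p - f z p) / (X i - z)) \<longlonglongrightarrow> ?D p"
    if "\<And>i. X i \<noteq> z" "X \<longlonglongrightarrow> z" "p \<in> space M" for X p
    using deriv_at[OF that(3), of z] r that(1,2)
    unfolding has_field_derivative_iff tendsto_at_iff_sequentially by (auto simp: o_def)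
  have main: "(\<lambda>i. LINT p|M. (f (X i) p - f z p) / (X i - z)) \<longlonglongrightarrow> (LINT p|M. ?D p) \<and>
       ?D \<in> borel_measurable M"
    if X: "\<And>i. X i \<noteq> z" "X \<longlonglongrightarrow> z" and near: "\<And>i. X i \<in> ball z (r/2)" for X
  proof
    have near': "X i \<in> ball z r" for i using near[of i] r by auto
    have z: "z \<in> ball z r" using r by simp
    show m: "?D \<in> borel_measurable M"
      by (rule borel_measurable_LIMSEQ_metric[where f = "\<lambda>i p. (f (X i) p - f z p) / (X i - z)"])
        (use meas[OF z] meas[OF near'] quot[OF X] in auto)
    show "(\<lambda>i. LINT p|M. (f (X i) p - f z p) / (X i - z)) \<longlonglongrightarrow> (LINT p|M. ?D p)"
    proof (rule integral_dominated_convergence[where w = "\<lambda>p. 4 * q p / r"])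
      show "integrable M (\<lambda>p. 4 * q p / r)" using q by simp
      show "AE p in M. (\<lambda>i. (f (X i) p - f z p) / (X i - z)) \<longlonglongrightarrow> ?D p"
        using quot[OF X] by auto
      show "AE p in M. norm ((f (X i) p - f z p) / (X i - z)) \<le> 4 * q p / r" for i
        using lip[OF _ near[of i]] X(1)[of i] by (auto simp: norm_divide divide_le_eq)
      show "(\<lambda>p. (f (X i) p - f z p) / (X i - z)) \<in> borel_measurable M" for i
        using meas[OF z] meas[OF near'] by auto
    qed (rule m)
  qed
  show "((\<lambda>w. LINT p|M. f w p) has_field_derivative (LINT p|M. ?D p)) (at z)"
    unfolding has_field_derivative_iff tendsto_at_iff_sequentially
  proof (intro allI impI)
    fix X assume X: "\<forall>i. X i \<in> UNIV - {z}" "X \<longlonglongrightarrow> z"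
    have "eventually (\<lambda>i. X i \<in> ball z (r/2)) sequentially"
      using X(2) r by (intro topological_tendstoD) auto
    then obtain N where "\<forall>i\<ge>N. X i \<in> ball z (r/2)"
      unfolding eventually_sequentially by blast
    hence N: "X (i + N) \<in> ball z (r/2)" for i by simp
    have N': "X (i + N) \<in> ball z r" for i using N[of i] r by auto
    have "(\<lambda>i. LINT p|M. (f (X (i + N)) p - f z p) / (X (i + N) - z)) \<longlonglongrightarrow> (LINT p|M. ?D p)"
      using main[of "\<lambda>i. X (i + N)"] X N by (auto intro: LIMSEQ_ignore_initial_segment)
    also have "(\<lambda>i. LINT p|M. (f (X (i + N)) p - f z p) / (X (i + N) - z)) =
      (\<lambda>i. ((LINT p|M. f (X (i + N)) p) - (LINT p|M. f z p)) / (X (i + N) - z))"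
      using int N' r by (simp add: Bochner_Integration.integral_diff)
    finally show "((\<lambda>y. ((LINT p|M. f y p) - (LINT p|M. f z p)) / (y - z)) \<circ> X) \<longlonglongrightarrow> (LINT p|M. ?D p)"
      unfolding o_def by (rule LIMSEQ_offset)
  qed
  \<comment> \<open>Measurability of the derivative needs one sequence of difference quotients that stay near \<open>z\<close>.\<close>
  define X where "X = (\<lambda>n. z + complex_of_real (r / 4 / real (Suc n)))"
  have "(\<lambda>n. z + complex_of_real (r / 4 / real (Suc n))) \<longlonglongrightarrow> z + complex_of_real 0"
    by (intro tendsto_intros LIMSEQ_Suc[OF lim_const_over_n])
  hence "X \<longlonglongrightarrow> z" by (simp add: X_def)
  moreover have "X n \<noteq> z" "X n \<in> ball z (r/2)" for n
  proof -
    show "X n \<noteq> z" using r by (simp add: X_def del: of_nat_Suc)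
    have "dist z (X n) = r / 4 / real (Suc n)"
      using r by (simp add: X_def dist_norm norm_divide del: of_nat_Suc)
    also have "\<dots> \<le> r / 4" using r by (simp add: divide_le_eq)
    also have "\<dots> < r / 2" using r by simp
    finally show "X n \<in> ball z (r/2)" by simp
  qed
  ultimately show "?D \<in> borel_measurable M" using main[of X] by blast
qed

text \<open>
  The induction on \<open>n\<close> carries measurability and local domination along, since both pass from a
  holomorphic family to its derivative.
\<close>

lemma higher_deriv_integral:
  fixes f :: "complex \<Rightarrow> 'b \<Rightarrow> complex"
  assumes S: "open S"
    and hol: "\<And>p. p \<in> space M \<Longrightarrow> (\<lambda>w. f w p) holomorphic_on S"
    and meas: "\<And>w. w \<in> S \<Longrightarrow> f w \<in> borel_measurable M"
    and bound: "\<And>z. z \<in> S \<Longrightarrow> \<exists>r q. 0 < r \<and> ball z r \<subseteq> S \<and> integrable M (q :: 'b \<Rightarrow> real) \<and>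
       (\<forall>w\<in>ball z r. \<forall>p\<in>space M. norm (f w p) \<le> q p)"
  shows "(\<lambda>z. LINT p|M. f z p) holomorphic_on S"
    and "z \<in> S \<Longrightarrow> (deriv ^^ n) (\<lambda>z. LINT p|M. f z p) z = (LINT p|M. (deriv ^^ n) (\<lambda>w. f w p) z)"
proof -
  have step: "((\<lambda>w. LINT p|M. h w p) has_field_derivative (LINT p|M. deriv (\<lambda>w. h w p) z)) (at z) \<and>
      (\<lambda>p. deriv (\<lambda>w. h w p) z) \<in> borel_measurable M"
    if "z \<in> S" "\<And>p. p \<in> space M \<Longrightarrow> (\<lambda>w. h w p) holomorphic_on S"
      "\<And>w. w \<in> S \<Longrightarrow> h w \<in> borel_measurable M"
      "\<exists>r q. 0 < r \<and> ball z r \<subseteq> S \<and> integrable M (q :: 'b \<Rightarrow> real) \<and>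
       (\<forall>w\<in>ball z r. \<forall>p\<in>space M. norm (h w p) \<le> q p)" for h :: "complex \<Rightarrow> 'b \<Rightarrow> complex" and z
  proof -
    from that(4) obtain r q where rq: "0 < r" "ball z r \<subseteq> S" "integrable M (q :: 'b \<Rightarrow> real)"
       "\<forall>w\<in>ball z r. \<forall>p\<in>space M. norm (h w p) \<le> q p" by blast
    show ?thesis
      using integral_has_field_derivative[of r M h z q] rq that(2,3)
      by (blast intro: holomorphic_on_subset)
  qed
  show "(\<lambda>z. LINT p|M. f z p) holomorphic_on S"
    using step[OF _ hol meas bound] S
    by (auto simp: holomorphic_on_open)
  show "(deriv ^^ n) (\<lambda>z. LINT p|M. f z p) z = (LINT p|M. (deriv ^^ n) (\<lambda>w. f w p) z)"
    if "z \<in> S"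
    using that
  proof (induction n arbitrary: z)
    case (Suc n)
    define h where "h = (\<lambda>w p. (deriv ^^ n) (\<lambda>w. f w p) w)"
    have hol': "(\<lambda>w. h w p) holomorphic_on S" if "p \<in> space M" for p
      unfolding h_def by (intro holomorphic_higher_deriv hol that S)
    have "(\<forall>z\<in>S. h z \<in> borel_measurable M) \<and> (\<forall>z\<in>S. \<exists>r q. 0 < r \<and> ball z r \<subseteq> S \<and> integrable M (q :: 'b \<Rightarrow> real) \<and>
       (\<forall>w\<in>ball z r. \<forall>p\<in>space M. norm (h w p) \<le> q p))"
      unfolding h_def
    proof (induction n)
      case 0 thus ?case using meas bound by auto
    next
      case (Suc n)
      let ?h = "\<lambda>w p. (deriv ^^ n) (\<lambda>w. f w p) w"
      have hh: "(\<lambda>w. ?h w p) holomorphic_on S" if "p \<in> space M" for p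
        by (intro holomorphic_higher_deriv hol that S)
      have "\<exists>r q. 0 < r \<and> ball z r \<subseteq> S \<and> integrable M (q :: 'b \<Rightarrow> real) \<and>
         (\<forall>w\<in>ball z r. \<forall>p\<in>space M. norm (deriv (\<lambda>w. ?h w p) w) \<le> q p)" if z: "z \<in> S" for z
      proof -
        obtain r q where rq: "0 < r" "ball z r \<subseteq> S" "integrable M (q :: 'b \<Rightarrow> real)"
          "\<forall>w\<in>ball z r. \<forall>p\<in>space M. norm (?h w p) \<le> q p" using Suc z by blast
        have "norm (deriv (\<lambda>w. ?h w p) w) \<le> 4 * q p / r" if w: "w \<in> ball z (r/2)" and p: "p \<in> space M" for w p
        proof -
          have sub: "ball w (r/2) \<subseteq> ball z r"
          proof
            fix y assume "y \<in> ball w (r/2)"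
            thus "y \<in> ball z r" using w dist_triangle[of z y w] by (auto simp: dist_commute)
          qed
          have "norm (deriv (\<lambda>w. ?h w p) w) \<le> q p / (r/4)"
            by (rule cauchy_deriv_bound[where r = "r/2"])
              (use sub rq p in \<open>auto intro!: holomorphic_on_subset[OF hh]\<close>)
          thus ?thesis by (simp add: field_simps)
        qed
        thus ?thesis using rq
          by (intro exI[of _ "r/2"] exI[of _ "\<lambda>p. 4 * q p / r"]) auto
      qed
      moreover have "(\<lambda>p. deriv (\<lambda>w. ?h w p) z) \<in> borel_measurable M" if "z \<in> S" for z
        using step[of z ?h] Suc hh that by blast
      ultimately show ?case by simp
    qed
    hence "((\<lambda>w. LINT p|M. h w p) has_field_derivative (LINT p|M. deriv (\<lambda>w. h w p) z)) (at z)"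
      using step[of z h] hol' Suc.prems by blast
    moreover have "\<forall>\<^sub>F w in nhds z. (deriv ^^ n) (\<lambda>z. LINT p|M. f z p) w = (LINT p|M. h w p)"
      unfolding h_def using Suc.IH S Suc.prems by (intro eventually_nhds_in_open[THEN eventually_mono]) auto
    ultimately show ?case
      by (simp add: h_def deriv_cong_ev[of "(deriv ^^ n) (\<lambda>z. LINT p|M. f z p)"] DERIV_imp_deriv)
  qed simp
qed

definition strip :: "real \<Rightarrow> complex set" where
  "strip \<delta> = {z. \<bar>Re z\<bar> < \<delta>}"

lemma open_strip: "open (strip \<delta>)"
  unfolding strip_def by (intro open_Collect_less continuous_intros)

lemma connected_strip: "connected (strip \<delta>)"
proof -
  have "strip \<delta> = {z. Re z < \<delta>} \<inter> {z. Re z > -\<delta>}" by (auto simp: strip_def)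
  thus ?thesis
    by (metis convex_Int convex_halfspace_Re_lt convex_halfspace_Re_gt convex_connected)
qed

lemma higher_deriv_exp_times:
  "(deriv ^^ n) (\<lambda>z. c * exp (z * a)) = (\<lambda>z. c * a ^ n * exp (z * a :: complex))"
proof (induction n)
  case (Suc n)
  have "deriv (\<lambda>z. c * a ^ n * exp (z * a)) z = c * a ^ Suc n * exp (z * a)" for z
    by (rule DERIV_imp_deriv) (auto intro!: derivative_eq_intros)
  with Suc show ?case by auto
qed simp

text \<open>
  On the strip, \<open>w exp (\<delta> |h|)\<close> dominates the integrand uniformly in \<open>z\<close>. The weight \<open>w\<close> allows for
  measures with infinite mass near \<open>0\<close>, such as a Levy measure weighted by \<open>s\<^sup>2\<close>.
\<close>

lemma laplace_transform_holomorphic: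
  fixes h w :: "'b \<Rightarrow> real"
  assumes [measurable]: "h \<in> borel_measurable M" "w \<in> borel_measurable M"
    and w: "\<And>p. w p \<ge> 0" and \<delta>: "\<delta> > 0"
    and int: "integrable M (\<lambda>p. w p * exp (\<delta> * \<bar>h p\<bar>))"
  shows "(\<lambda>z. LINT p|M. of_real (w p) * exp (z * of_real (h p))) holomorphic_on strip \<delta>"
    and "(deriv ^^ n) (\<lambda>z. LINT p|M. of_real (w p) * exp (z * of_real (h p))) 0 =
      complex_of_real (LINT p|M. w p * h p ^ n)"
proof -
  let ?f = "\<lambda>z p. complex_of_real (w p) * exp (z * complex_of_real (h p))"
  have bound: "\<exists>r q. 0 < r \<and> ball z r \<subseteq> strip \<delta> \<and> integrable M (q :: 'b \<Rightarrow> real) \<and>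
       (\<forall>v\<in>ball z r. \<forall>p\<in>space M. norm (?f v p) \<le> q p)" if z: "z \<in> strip \<delta>" for z
  proof -
    obtain r where r: "0 < r" "ball z r \<subseteq> strip \<delta>"
      using open_strip z by (meson open_contains_ball)
    have "norm (?f v p) \<le> w p * exp (\<delta> * \<bar>h p\<bar>)" if "v \<in> ball z r" for v p
    proof -
      have "Re v * h p \<le> \<bar>Re v\<bar> * \<bar>h p\<bar>" by (metis abs_ge_self abs_mult)
      also have "\<dots> \<le> \<delta> * \<bar>h p\<bar>"
        using that r by (intro mult_right_mono) (auto simp: strip_def)
      finally show ?thesis using w[of p] by (auto simp: norm_mult intro!: mult_left_mono)
    qed
    with r int show ?thesis by blast
  qed
  have hol: "(\<lambda>v. ?f v p) holomorphic_on strip \<delta>" for p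
    by (intro holomorphic_intros)
  have meas: "?f v \<in> borel_measurable M" for v by measurable
  show "(\<lambda>z. LINT p|M. ?f z p) holomorphic_on strip \<delta>"
    by (rule higher_deriv_integral(1)[OF open_strip hol meas bound])
  have "(deriv ^^ n) (\<lambda>z. LINT p|M. ?f z p) 0 = (LINT p|M. (deriv ^^ n) (\<lambda>v. ?f v p) 0)"
    by (rule higher_deriv_integral(2)[OF open_strip hol meas bound]) (use \<delta> in \<open>auto simp: strip_def\<close>)
  also have "\<dots> = (LINT p|M. complex_of_real (w p * h p ^ n))"
    by (simp add: higher_deriv_exp_times)
  also have "\<dots> = complex_of_real (LINT p|M. w p * h p ^ n)" by (rule integral_complex_of_real)
  finally show "(deriv ^^ n) (\<lambda>z. LINT p|M. ?f z p) 0 = complex_of_real (LINT p|M. w p * h p ^ n)" .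
qed

lemma power_div_fact_le_exp:
  fixes x :: real
  assumes "x \<ge> 0"
  shows "x ^ n / fact n \<le> exp x"
proof -
  have "(\<Sum>k\<in>{n}. x ^ k /\<^sub>R fact k) \<le> (\<Sum>k. x ^ k /\<^sub>R fact k)"
    using assms by (intro sum_le_suminf summable_exp_generic) auto
  thus ?thesis by (simp add: exp_def divide_inverse_commute)
qed

text \<open>
  The factor \<open>|h|\<^sup>n\<close> is absorbed by \<open>n! / \<delta>\<^sup>n exp (\<delta> |h|)\<close>, which is one term of the exponential series.
\<close>

lemma integrable_power_of_exponential_moment:
  fixes h :: "'b \<Rightarrow> real"
  assumes [measurable]: "h \<in> borel_measurable M" and \<delta>: "\<delta> > 0"
    and int: "integrable M (\<lambda>p. (h p)\<^sup>2 * exp (\<delta> * \<bar>h p\<bar>))"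
  shows "integrable M (\<lambda>p. h p ^ (n + 2))"
proof (rule Bochner_Integration.integrable_bound)
  show "integrable M (\<lambda>p. fact n / \<delta> ^ n * ((h p)\<^sup>2 * exp (\<delta> * \<bar>h p\<bar>)))"
    using int by (rule integrable_mult_right)
  have "norm (h p ^ (n + 2)) \<le> norm (fact n / \<delta> ^ n * ((h p)\<^sup>2 * exp (\<delta> * \<bar>h p\<bar>)))" for p
  proof -
    have "\<bar>h p\<bar> ^ n * \<delta> ^ n / fact n \<le> exp (\<delta> * \<bar>h p\<bar>)"
      using power_div_fact_le_exp[of "\<delta> * \<bar>h p\<bar>" n] \<delta> by (simp add: power_mult_distrib mult.commute)
    hence "\<bar>h p\<bar> ^ n \<le> fact n / \<delta> ^ n * exp (\<delta> * \<bar>h p\<bar>)" using \<delta> by (simp add: field_simps)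
    hence "\<bar>h p\<bar> ^ n * (h p)\<^sup>2 \<le> fact n / \<delta> ^ n * exp (\<delta> * \<bar>h p\<bar>) * (h p)\<^sup>2"
      by (intro mult_right_mono) auto
    moreover have "norm (h p ^ (n + 2)) = \<bar>h p\<bar> ^ n * (h p)\<^sup>2"
      by (simp add: power_add power_abs abs_mult power2_eq_square)
    ultimately show ?thesis using \<delta> by (simp add: mult_ac abs_mult)
  qed
  thus "AE p in M. norm (h p ^ (n + 2)) \<le> norm (fact n / \<delta> ^ n * ((h p)\<^sup>2 * exp (\<delta> * \<bar>h p\<bar>)))" by simp
qed measurable

lemma (in pair_sigma_finite) integrable_product:
  fixes a :: "'a \<Rightarrow> real" and b :: "'b \<Rightarrow> real"
  assumes a: "integrable M1 a" and b: "integrable M2 b"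
  shows "integrable (M1 \<Otimes>\<^sub>M M2) (\<lambda>(x, y). a x * b y)"
    and "(LINT p|(M1 \<Otimes>\<^sub>M M2). (case p of (x, y) \<Rightarrow> a x * b y)) = (LINT x|M1. a x) * (LINT y|M2. b y)"
proof -
  have [measurable]: "a \<in> borel_measurable M1" "b \<in> borel_measurable M2" using a b by auto
  show int: "integrable (M1 \<Otimes>\<^sub>M M2) (\<lambda>(x, y). a x * b y)"
  proof (rule Fubini_integrable)
    show "integrable M1 (\<lambda>x. LINT y|M2. norm (case (x, y) of (x, y) \<Rightarrow> a x * b y))"
      using a by (simp add: abs_mult)
    show "AE x in M1. integrable M2 (\<lambda>y. case (x, y) of (x, y) \<Rightarrow> a x * b y)"
      using b by simp
  qed measurable
  show "(LINT p|(M1 \<Otimes>\<^sub>M M2). (case p of (x, y) \<Rightarrow> a x * b y)) = (LINT x|M1. a x) * (LINT y|M2. b y)"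
    using integral_fst'[OF int] by simp
qed

text \<open>
  The bound \<open>exp |y| \<le> 2 cosh y\<close> involves even powers only, so that the integrated series has
  nonnegative terms and monotone convergence turns its summability into integrability.
\<close>

lemma integrable_exp_abs:
  fixes X :: "'b \<Rightarrow> real"
  assumes [measurable]: "X \<in> borel_measurable M" and \<epsilon>: "\<epsilon> \<ge> 0"
    and int: "\<And>n. even n \<Longrightarrow> integrable M (\<lambda>\<omega>. X \<omega> ^ n)"
    and sum: "summable (\<lambda>n. if even n then \<epsilon> ^ n / fact n * (LINT \<omega>|M. X \<omega> ^ n) else 0)"
  shows "integrable M (\<lambda>\<omega>. exp (\<epsilon> * \<bar>X \<omega>\<bar>))"
proof (rule integrableI_bounded)
  let ?t = "\<lambda>n \<omega>. if even n then (\<epsilon> * X \<omega>) ^ n /\<^sub>R fact n else 0"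
  have t_nonneg: "0 \<le> ?t n \<omega>" for n \<omega>
    by (cases "even n") (simp_all add: zero_le_even_power)
  have "ennreal (norm (exp (\<epsilon> * \<bar>X \<omega>\<bar>))) \<le> 2 * (\<Sum>n. ennreal (?t n \<omega>))" for \<omega>
  proof -
    have "exp (\<epsilon> * \<bar>X \<omega>\<bar>) \<le> 2 * cosh (\<epsilon> * X \<omega>)"
      by (cases "X \<omega> \<ge> 0") (simp_all add: cosh_field_def)
    hence "ennreal (norm (exp (\<epsilon> * \<bar>X \<omega>\<bar>))) \<le> ennreal (2 * cosh (\<epsilon> * X \<omega>))"
      by (intro ennreal_leI) simp
    also have "\<dots> = 2 * ennreal (cosh (\<epsilon> * X \<omega>))" by (simp add: ennreal_mult')
    also have "ennreal (cosh (\<epsilon> * X \<omega>)) = (\<Sum>n. ennreal (?t n \<omega>))"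
      using suminf_ennreal_eq[OF t_nonneg cosh_converges[of "\<epsilon> * X \<omega>"]] by simp
    finally show ?thesis .
  qed
  hence "(\<integral>\<^sup>+\<omega>. ennreal (norm (exp (\<epsilon> * \<bar>X \<omega>\<bar>))) \<partial>M) \<le> (\<integral>\<^sup>+\<omega>. 2 * (\<Sum>n. ennreal (?t n \<omega>)) \<partial>M)"
    by (intro nn_integral_mono)
  also have "\<dots> = 2 * (\<integral>\<^sup>+\<omega>. (\<Sum>n. ennreal (?t n \<omega>)) \<partial>M)"
    by (rule nn_integral_cmult) measurable
  also have "(\<integral>\<^sup>+\<omega>. (\<Sum>n. ennreal (?t n \<omega>)) \<partial>M) = (\<Sum>n. \<integral>\<^sup>+\<omega>. ennreal (?t n \<omega>) \<partial>M)"
    by (rule nn_integral_suminf) measurable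
  also have "\<dots> = (\<Sum>n. ennreal (if even n then \<epsilon> ^ n / fact n * (LINT \<omega>|M. X \<omega> ^ n) else 0))"
  proof (rule arg_cong[where f = suminf], rule ext)
    fix n
    show "(\<integral>\<^sup>+\<omega>. ennreal (?t n \<omega>) \<partial>M) = ennreal (if even n then \<epsilon> ^ n / fact n * (LINT \<omega>|M. X \<omega> ^ n) else 0)"
    proof (cases "even n")
      case True
      have eq: "?t n = (\<lambda>\<omega>. \<epsilon> ^ n / fact n * X \<omega> ^ n)"
        using True by (auto simp: power_mult_distrib divide_inverse mult_ac)
      have "integrable M (?t n)" unfolding eq using int[OF True] by (rule integrable_mult_right)
      hence "(\<integral>\<^sup>+\<omega>. ennreal (?t n \<omega>) \<partial>M) = ennreal (LINT \<omega>|M. ?t n \<omega>)"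
        using t_nonneg by (intro nn_integral_eq_integral) auto
      also have "(LINT \<omega>|M. ?t n \<omega>) = \<epsilon> ^ n / fact n * (LINT \<omega>|M. X \<omega> ^ n)"
        unfolding eq by (rule integral_mult_right_zero)
      finally show ?thesis using True by simp
    qed simp
  qed
  also have "\<dots> = ennreal (\<Sum>n. if even n then \<epsilon> ^ n / fact n * (LINT \<omega>|M. X \<omega> ^ n) else 0)"
    using \<epsilon> sum by (intro suminf_ennreal2) (auto intro!: mult_nonneg_nonneg Bochner_Integration.integral_nonneg zero_le_even_power)
  also have "2 * \<dots> < \<infinity>" by (simp add: ennreal_mult_less_top)
  finally show "(\<integral>\<^sup>+\<omega>. ennreal (norm (exp (\<epsilon> * \<bar>X \<omega>\<bar>))) \<partial>M) < \<infinity>" .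
qed measurable

lemma compensated_exp_bound:
  "cmod (exp (z * of_real h) - 1 - z * of_real h) \<le> (cmod z)\<^sup>2 * (h\<^sup>2 * exp (\<bar>Re z\<bar> * \<bar>h\<bar>))"
proof -
  have "cmod (exp (z * of_real h) - (\<Sum>k\<le>1. (z * of_real h) ^ k / fact k)) \<le>
      exp \<bar>Re (z * of_real h)\<bar> * cmod (z * of_real h) ^ Suc 1 / fact 1"
    by (rule Taylor_exp)
  also have "exp (z * of_real h) - (\<Sum>k\<le>1. (z * of_real h) ^ k / fact k) = exp (z * of_real h) - 1 - z * of_real h"
    by simp
  also have "exp \<bar>Re (z * of_real h)\<bar> * cmod (z * of_real h) ^ Suc 1 / fact 1 = (cmod z)\<^sup>2 * (h\<^sup>2 * exp (\<bar>Re z\<bar> * \<bar>h\<bar>))"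
    by (simp add: norm_mult abs_mult power2_eq_square)
  finally show ?thesis .
qed

lemma higher_deriv_compensated_exp:
  "(deriv ^^ n) (\<lambda>z. exp (z * of_real h) - 1 - z * of_real h :: complex) 0 =
    (if n < 2 then 0 else of_real (h ^ n))"
proof -
  let ?f = "\<lambda>z. exp (z * of_real h) - 1 - z * of_real h :: complex"
  have d1: "deriv ?f = (\<lambda>z. of_real h * exp (z * of_real h) - of_real h)"
    by (rule ext, rule DERIV_imp_deriv) (auto intro!: derivative_eq_intros)
  have d2: "deriv (\<lambda>z. of_real h * exp (z * of_real h) - of_real h :: complex) = (\<lambda>z. (of_real h)\<^sup>2 * exp (z * of_real h))"
    by (rule ext, rule DERIV_imp_deriv) (auto intro!: derivative_eq_intros simp: power2_eq_square)
  consider "n = 0" | "n = 1" | m where "n = Suc (Suc m)" by (cases n; cases "n - 1") auto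
  thus ?thesis
  proof cases
    case 3
    have "(deriv ^^ n) ?f = (deriv ^^ m) (\<lambda>z. (of_real h)\<^sup>2 * exp (z * of_real h))"
      by (simp add: 3 funpow_Suc_right d1 d2 del: funpow.simps)
    hence "(deriv ^^ n) ?f 0 = (of_real h)\<^sup>2 * of_real h ^ m"
      by (simp only: higher_deriv_exp_times mult_zero_left exp_zero mult_1_right)
    also have "\<dots> = of_real (h ^ n)" by (simp add: 3 power2_eq_square)
    finally have "(deriv ^^ n) ?f 0 = of_real (h ^ n)" .
    moreover have "\<not> n < 2" using 3 by simp
    ultimately show ?thesis by (simp only: if_False)
  qed (simp_all add: d1)
qed

text \<open>
  This is the Levy exponent as a function of a complex argument. The compensator makes the integrand
  of size \<open>|z|\<^sup>2 h\<^sup>2 exp (\<delta> |h|)\<close>, and it removes exactly the derivatives of order \<open>0\<close> and \<open>1\<close> at the origin.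
\<close>

lemma compensated_exp_integral_holomorphic:
  fixes h :: "'b \<Rightarrow> real"
  assumes [measurable]: "h \<in> borel_measurable M" and \<delta>: "\<delta> > 0"
    and int: "integrable M (\<lambda>p. (h p)\<^sup>2 * exp (\<delta> * \<bar>h p\<bar>))"
  defines "H \<equiv> \<lambda>z. LINT p|M. exp (z * of_real (h p)) - 1 - z * of_real (h p)"
  shows "H holomorphic_on strip \<delta>"
    and "(deriv ^^ n) H 0 = (if n < 2 then 0 else of_real (LINT p|M. h p ^ n))"
    and "z \<in> strip \<delta> \<Longrightarrow> integrable M (\<lambda>p. exp (z * of_real (h p)) - 1 - z * of_real (h p))"
proof -
  let ?f = "\<lambda>z p. exp (z * complex_of_real (h p)) - 1 - z * of_real (h p)"
  have norm_le: "cmod (?f v p) \<le> (cmod v)\<^sup>2 * ((h p)\<^sup>2 * exp (\<delta> * \<bar>h p\<bar>))" if "v \<in> strip \<delta>" for v p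
  proof -
    have "\<bar>Re v\<bar> * \<bar>h p\<bar> \<le> \<delta> * \<bar>h p\<bar>" using that by (intro mult_right_mono) (auto simp: strip_def)
    hence "(cmod v)\<^sup>2 * ((h p)\<^sup>2 * exp (\<bar>Re v\<bar> * \<bar>h p\<bar>)) \<le> (cmod v)\<^sup>2 * ((h p)\<^sup>2 * exp (\<delta> * \<bar>h p\<bar>))"
      by (intro mult_left_mono) auto
    with compensated_exp_bound[of v "h p"] show ?thesis by linarith
  qed
  have bound: "\<exists>r q. 0 < r \<and> ball z r \<subseteq> strip \<delta> \<and> integrable M (q :: 'b \<Rightarrow> real) \<and>
       (\<forall>v\<in>ball z r. \<forall>p\<in>space M. norm (?f v p) \<le> q p)" if z: "z \<in> strip \<delta>" for z
  proof -
    obtain r where r: "0 < r" "ball z r \<subseteq> strip \<delta>"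
      using open_strip z by (meson open_contains_ball)
    have "norm (?f v p) \<le> (cmod z + r)\<^sup>2 * ((h p)\<^sup>2 * exp (\<delta> * \<bar>h p\<bar>))" if v: "v \<in> ball z r" for v p
    proof -
      have "cmod v \<le> cmod z + r" using v norm_triangle_ineq[of z "v - z"] by (simp add: dist_norm norm_minus_commute)
      hence "(cmod v)\<^sup>2 * ((h p)\<^sup>2 * exp (\<delta> * \<bar>h p\<bar>)) \<le> (cmod z + r)\<^sup>2 * ((h p)\<^sup>2 * exp (\<delta> * \<bar>h p\<bar>))"
        by (intro mult_right_mono power_mono) auto
      thus ?thesis using norm_le[of v p] v r by (meson order.trans subsetD)
    qed
    moreover have "integrable M (\<lambda>p. (cmod z + r)\<^sup>2 * ((h p)\<^sup>2 * exp (\<delta> * \<bar>h p\<bar>)))"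
      using int by (rule integrable_mult_right)
    ultimately show ?thesis using r by blast
  qed
  have hol: "(\<lambda>v. ?f v p) holomorphic_on strip \<delta>" for p
    by (intro holomorphic_intros)
  have meas: "?f v \<in> borel_measurable M" for v by measurable
  show "H holomorphic_on strip \<delta>"
    unfolding H_def by (rule higher_deriv_integral(1)[OF open_strip hol meas bound])
  have "(deriv ^^ n) H 0 = (LINT p|M. (deriv ^^ n) (\<lambda>v. ?f v p) 0)"
    unfolding H_def
    by (rule higher_deriv_integral(2)[OF open_strip hol meas bound]) (use \<delta> in \<open>auto simp: strip_def\<close>)
  also have "\<dots> = (LINT p|M. (if n < 2 then 0 else of_real (h p ^ n)))"
    by (simp only: higher_deriv_compensated_exp)
  also have "\<dots> = (if n < 2 then 0 else of_real (LINT p|M. h p ^ n))"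
  proof (cases "n < 2")
    case False
    have "(LINT p|M. complex_of_real (h p ^ n)) = of_real (LINT p|M. h p ^ n)" by (rule integral_complex_of_real)
    thus ?thesis using False by (simp only: if_False)
  qed simp
  finally show "(deriv ^^ n) H 0 = (if n < 2 then 0 else of_real (LINT p|M. h p ^ n))" .
  show "integrable M (?f z)" if "z \<in> strip \<delta>"
  proof (rule Bochner_Integration.integrable_bound)
    show "integrable M (\<lambda>p. (cmod z)\<^sup>2 * ((h p)\<^sup>2 * exp (\<delta> * \<bar>h p\<bar>)))"
      using int by (rule integrable_mult_right)
    show "AE p in M. norm (?f z p) \<le> norm ((cmod z)\<^sup>2 * ((h p)\<^sup>2 * exp (\<delta> * \<bar>h p\<bar>)))"
      using norm_le[OF that] by (intro AE_I2) (auto intro: order.trans)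
  qed (rule meas)
qed

section \<open>The Laplace transform of the kernel \<open>u / sinh (\<pi> u)\<close>\<close>

text \<open>
  The logarithmic derivative of the reflection formula of the Gamma function.
\<close>

lemma Digamma_reflection:
  fixes z :: complex
  assumes z: "z \<notin> \<int>"
  shows "Digamma z - Digamma (1 - z) = - of_real pi * cot (of_real pi * z)"
proof -
  have z1: "1 - z \<notin> \<int>" using z by (metis Ints_1 Ints_diff diff_diff_eq2 add_diff_cancel_left')
  have np: "z \<notin> \<int>\<^sub>\<le>\<^sub>0" "1 - z \<notin> \<int>\<^sub>\<le>\<^sub>0" using z z1 nonpos_Ints_Int by blast+
  have sin0: "sin (of_real pi * z) \<noteq> 0"
    using z by (auto simp: sin_eq_0 Ints_def mult.commute)
  have "((\<lambda>w. rGamma w * rGamma (1 - w)) has_field_derivative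
      (-rGamma z * Digamma z) * rGamma (1 - z) + rGamma z * (rGamma (1 - z) * Digamma (1 - z))) (at z)"
    using np by (auto intro!: derivative_eq_intros)
  moreover have "((\<lambda>w. sin (of_real pi * w) / of_real pi) has_field_derivative cos (of_real pi * z)) (at z)"
    by (auto intro!: derivative_eq_intros)
  ultimately have "(-rGamma z * Digamma z) * rGamma (1 - z) + rGamma z * (rGamma (1 - z) * Digamma (1 - z))
      = cos (of_real pi * z)"
    unfolding rGamma_reflection_complex using DERIV_unique by blast
  hence "- (rGamma z * rGamma (1 - z)) * (Digamma z - Digamma (1 - z)) = cos (of_real pi * z)"
    by (simp add: algebra_simps)
  thus ?thesis using sin0
    unfolding rGamma_reflection_complex cot_def by (simp add: field_simps)
qed

lemma Polygamma_1_reflection: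
  fixes z :: complex
  assumes z: "z \<notin> \<int>"
  shows "Polygamma 1 z + Polygamma 1 (1 - z) = (of_real pi / sin (of_real pi * z))\<^sup>2"
proof -
  have z1: "1 - z \<notin> \<int>" using z by (metis Ints_1 Ints_diff diff_diff_eq2 add_diff_cancel_left')
  have np: "z \<notin> \<int>\<^sub>\<le>\<^sub>0" "1 - z \<notin> \<int>\<^sub>\<le>\<^sub>0" using z z1 nonpos_Ints_Int by blast+
  have sin0: "sin (of_real pi * z) \<noteq> 0"
    using z by (auto simp: sin_eq_0 Ints_def mult.commute)
  have "((\<lambda>w. Digamma w - Digamma (1 - w)) has_field_derivative Polygamma 1 z + Polygamma 1 (1 - z)) (at z)"
    using np by (auto intro!: derivative_eq_intros)
  moreover have "((\<lambda>w. Digamma w - Digamma (1 - w)) has_field_derivative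
      (of_real pi / sin (of_real pi * z))\<^sup>2) (at z)"
  proof (rule DERIV_cong_ev[OF refl _ refl, THEN iffD2])
    show "\<forall>\<^sub>F w in nhds z. Digamma w - Digamma (1 - w) = - of_real pi * cot (of_real pi * w)"
    proof -
      have "open (- \<int> :: complex set)" by (intro open_Compl closed_of_int_image[of UNIV, folded Ints_def])
      hence "\<forall>\<^sub>F w in nhds z. w \<in> - \<int>" using z by (intro eventually_nhds_in_open) auto
      thus ?thesis by eventually_elim (use Digamma_reflection in auto)
    qed
    show "((\<lambda>w. - of_real pi * cot (of_real pi * w)) has_field_derivative
      (of_real pi / sin (of_real pi * z))\<^sup>2) (at z)"
      using sin0 by (auto intro!: derivative_eq_intros DERIV_chain2[OF DERIV_cot] simp: field_simps power2_eq_square)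
  qed
  ultimately show ?thesis using DERIV_unique by blast
qed

lemma Polygamma_1_reflection_real:
  fixes x :: real
  assumes "0 < x" "x < 1"
  shows "Polygamma 1 x + Polygamma 1 (1 - x) = (pi / sin (pi * x))\<^sup>2"
proof -
  have "complex_of_real x \<notin> \<int>" 
  proof
    assume "complex_of_real x \<in> \<int>"
    hence "x \<in> \<int>" by simp
    thus False using assms by (auto simp: Ints_def)
  qed
  from Polygamma_1_reflection[OF this]
  have "complex_of_real (Polygamma 1 x + Polygamma 1 (1 - x)) = complex_of_real ((pi / sin (pi * x))\<^sup>2)"
    using assms Polygamma_of_real[of x 1, where 'a=complex] Polygamma_of_real[of "1 - x" 1, where 'a=complex]
      sin_of_real[of "pi * x", where 'a=complex] by simp
  thus ?thesis by (simp only: of_real_eq_iff)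
qed

text \<open>
  As \<open>\<Gamma>\<close> commutes with conjugation, the left-hand side is \<open>\<Gamma>(1 + i y) \<Gamma>(1 - i y)\<close>, to which the
  functional equation and the reflection formula apply.
\<close>

lemma Gamma_1_imaginary:
  fixes y :: real
  assumes "y \<noteq> 0"
  shows "(cmod (Gamma (1 + \<i> * of_real y)))\<^sup>2 = pi * y / sinh (pi * y)"
proof -
  have y: "\<i> * complex_of_real y \<noteq> 0" using assms by simp
  have Gamma1: "Gamma (1 + \<i> * of_real y) = \<i> * of_real y * Gamma (\<i> * of_real y)"
  proof -
    have "\<i> * complex_of_real y \<notin> \<int>\<^sub>\<le>\<^sub>0"
      using assms by (auto simp: complex_eq_iff elim!: nonpos_Ints_cases)
    from Gamma_plus1[OF this] show ?thesis by (simp add: add.commute)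
  qed
  have "complex_of_real ((cmod (Gamma (1 + \<i> * of_real y)))\<^sup>2) =
      Gamma (1 + \<i> * of_real y) * cnj (Gamma (1 + \<i> * of_real y))"
    by (rule complex_norm_square)
  also have "\<dots> = \<i> * of_real y * Gamma (\<i> * of_real y) * Gamma (1 - \<i> * of_real y)"
    by (subst Gamma1) (simp add: cnj_Gamma)
  also have "\<dots> =
      \<i> * of_real y * (of_real pi / sin (of_real pi * (\<i> * of_real y)))"
    by (simp only: mult.assoc Gamma_reflection_complex)
  also have "sin (of_real pi * (\<i> * of_real y)) = \<i> * of_real (sinh (pi * y))"
  proof -
    have "complex_of_real (sinh (pi * y)) = sinh (of_real (pi * y))"
      unfolding sinh_field_def
      by (simp only: of_real_divide of_real_diff exp_of_real of_real_numeral flip: of_real_minus)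
    moreover have "\<i> * (of_real pi * (\<i> * of_real y)) = - complex_of_real (pi * y)"
      by (simp add: complex_eq_iff)
    ultimately show ?thesis unfolding sin_conv_sinh by simp
  qed
  finally have "complex_of_real ((cmod (Gamma (1 + \<i> * of_real y)))\<^sup>2) = complex_of_real (pi * y / sinh (pi * y))"
    using assms by (simp add: field_simps)
  thus ?thesis by (simp only: of_real_eq_iff)
qed

lemma nn_integral_gamma_kernel:
  fixes a :: real
  assumes a: "a > 0"
  shows "(\<integral>\<^sup>+u\<in>{0..}. ennreal (u * exp (- a * u)) \<partial>lborel) = ennreal (1 / a\<^sup>2)"
proof -
  have "1 = (\<integral>\<^sup>+x. ennreal (x^1 * exp (-x)) * indicator {0 ..} x \<partial>lborel)"
    by (subst nn_intergal_power_times_exp_Ici) simp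
  also have "\<dots> = ennreal a * (\<integral>\<^sup>+x. ennreal ((a * x)^1 * exp (-(a * x))) * indicator {0 ..} (a * x) \<partial>lborel)"
    using a by (subst nn_integral_real_affine[of _ a 0]) auto
  also have "\<dots> = ennreal a * (\<integral>\<^sup>+x. ennreal a * (ennreal (x * exp (- a * x)) * indicator {0 ..} x) \<partial>lborel)"
  proof (rule arg_cong2[where f = "(*)", OF refl], rule nn_integral_cong)
    show "ennreal ((a * x) ^ 1 * exp (- (a * x))) * indicator {0..} (a * x) =
      ennreal a * (ennreal (x * exp (- a * x)) * indicator {0..} x)" for x
    proof (cases "x \<ge> 0")
      case True
      have "ennreal (a * (x * exp (- a * x))) = ennreal a * ennreal (x * exp (- a * x))"
        using a True by (intro ennreal_mult) auto
      thus ?thesis using a True by (simp add: mult.assoc)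
    qed (use a in \<open>auto simp: indicator_def zero_le_mult_iff\<close>)
  qed
  also have "\<dots> = ennreal a * (ennreal a * (\<integral>\<^sup>+u\<in>{0..}. ennreal (u * exp (- a * u)) \<partial>lborel))"
    by (subst nn_integral_cmult) auto
  finally have "1 = ennreal (a\<^sup>2) * (\<integral>\<^sup>+u\<in>{0..}. ennreal (u * exp (- a * u)) \<partial>lborel)"
    using a by (simp add: power2_eq_square ennreal_mult mult.assoc)
  hence "ennreal (1 / a\<^sup>2) = ennreal (1 / a\<^sup>2) * (ennreal (a\<^sup>2) * (\<integral>\<^sup>+u\<in>{0..}. ennreal (u * exp (- a * u)) \<partial>lborel))"
    by simp
  also have "\<dots> = (\<integral>\<^sup>+u\<in>{0..}. ennreal (u * exp (- a * u)) \<partial>lborel)"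
    using a by (simp flip: mult.assoc ennreal_mult)
  finally show ?thesis ..
qed

lemma borel_measurable_sinh [measurable]: "(sinh :: real \<Rightarrow> real) \<in> borel_measurable borel"
  by (intro borel_measurable_continuous_onI continuous_intros)

text \<open>
  Expanding \<open>1 / sinh (\<pi> u) = 2 \<Sum>\<^sub>n exp (- (2 n + 1) \<pi> u)\<close> and integrating term by term gives the series
  \<open>\<Sum>\<^sub>n 2 / ((2 n + 1) \<pi> - 2 y)\<^sup>2\<close>, which is a trigamma value up to the factor \<open>2 \<pi>\<^sup>2\<close>.
\<close>

lemma nn_integral_half_sinh:
  fixes y :: real
  assumes y: "\<bar>y\<bar> < pi / 2"
  shows "(\<integral>\<^sup>+u\<in>{0<..}. ennreal (u * exp (2 * u * y) / sinh (pi * u)) \<partial>lborel) =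
    ennreal (Polygamma 1 (1/2 - y/pi) / (2 * pi\<^sup>2))"
proof -
  \<comment> \<open>The decay rates of the terms in the geometric series.\<close>
  define a where "a n = (2 * real n + 1) * pi - 2 * y" for n
  have a: "a n > 0" for n
  proof -
    have "1 * pi \<le> (2 * real n + 1) * pi" by (intro mult_right_mono) auto
    thus ?thesis using y unfolding a_def by linarith
  qed
  have series: "(\<lambda>n. 2 * (u * exp (- a n * u))) sums (u * exp (2 * u * y) / sinh (pi * u))" if u: "u > 0" for u
  proof -
    have "(\<lambda>n. 2 * u * exp (2 * u * y) * exp (- pi * u) * exp (- 2 * pi * u) ^ n) sums
       (2 * u * exp (2 * u * y) * exp (- pi * u) * (1 / (1 - exp (- 2 * pi * u))))"
      using u by (intro sums_mult geometric_sums) auto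
    also have "(\<lambda>n. 2 * u * exp (2 * u * y) * exp (- pi * u) * exp (- 2 * pi * u) ^ n) =
      (\<lambda>n. 2 * (u * exp (- a n * u)))"
      by (auto simp: a_def exp_of_nat_mult[symmetric] exp_add[symmetric] algebra_simps simp flip: exp_add)
    also have "2 * u * exp (2 * u * y) * exp (- pi * u) * (1 / (1 - exp (- 2 * pi * u))) = 
      u * exp (2 * u * y) / sinh (pi * u)"
    proof -
      have "exp (pi * u) * (1 - exp (- 2 * pi * u)) = 2 * sinh (pi * u)"
        by (simp add: sinh_field_def algebra_simps flip: exp_add)
      moreover have "1 - exp (- 2 * pi * u) \<noteq> 0" "sinh (pi * u) \<noteq> 0" using u by auto
      ultimately have "exp (- pi * u) * (1 / (1 - exp (- 2 * pi * u))) = 1 / (2 * sinh (pi * u))"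
        by (simp add: exp_minus field_simps)
      hence "2 * u * exp (2 * u * y) * (exp (- pi * u) * (1 / (1 - exp (- 2 * pi * u)))) = u * exp (2 * u * y) / sinh (pi * u)"
        by simp
      thus ?thesis by (simp only: mult.assoc)
    qed
    finally show ?thesis .
  qed
  have "(\<integral>\<^sup>+u\<in>{0<..}. ennreal (u * exp (2 * u * y) / sinh (pi * u)) \<partial>lborel) =
    (\<integral>\<^sup>+u. (\<Sum>n. 2 * (ennreal (u * exp (- a n * u)) * indicator {0..} u)) \<partial>lborel)"
  proof (rule nn_integral_cong)
    fix u :: real
    show "ennreal (u * exp (2 * u * y) / sinh (pi * u)) * indicator {0<..} u =
       (\<Sum>n. 2 * (ennreal (u * exp (- a n * u)) * indicator {0..} u))"
    proof (cases "u > 0")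
      case True
      have "(\<Sum>n. ennreal (2 * (u * exp (- a n * u)))) = ennreal (\<Sum>n. 2 * (u * exp (- a n * u)))"
        using True sums_summable[OF series[OF True]] by (intro suminf_ennreal2) auto
      also have "(\<Sum>n. 2 * (u * exp (- a n * u))) = u * exp (2 * u * y) / sinh (pi * u)"
        using series[OF True] by (rule sums_unique[symmetric])
      finally show ?thesis using True by (simp add: ennreal_mult)
    qed (auto simp: indicator_def)
  qed
  also have "\<dots> = (\<Sum>n. \<integral>\<^sup>+u. 2 * (ennreal (u * exp (- a n * u)) * indicator {0..} u) \<partial>lborel)"
    by (rule nn_integral_suminf) auto
  also have "\<dots> = (\<Sum>n. 2 * ennreal (1 / (a n)\<^sup>2))"
    using nn_integral_gamma_kernel[OF a] by (subst nn_integral_cmult) auto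
  also have "\<dots> = (\<Sum>n. ennreal (2 / (a n)\<^sup>2))"
    by (simp add: ennreal_mult'[symmetric] flip: ennreal_numeral)
  also have "\<dots> = ennreal (Polygamma 1 (1/2 - y/pi) / (2 * pi\<^sup>2))"
  proof (rule suminf_ennreal_eq)
    have "1/2 - y/pi \<noteq> 0" using y by (auto simp: field_simps)
    from Polygamma_LIMSEQ[OF this, of 1]
    have "(\<lambda>n. 1 / (2 * pi\<^sup>2) * inverse ((1/2 - y/pi + real n)\<^sup>2)) sums (1 / (2 * pi\<^sup>2) * Polygamma 1 (1/2 - y/pi))"
      by (intro sums_mult) (simp add: power2_eq_square)
    moreover have "1 / (2 * pi\<^sup>2) * inverse ((1/2 - y/pi + real n)\<^sup>2) = 2 / (a n)\<^sup>2" for n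
    proof -
      have "a n = 2 * pi * (1/2 - y/pi + real n)" by (simp add: a_def field_simps)
      moreover have "1 / (2 * pi\<^sup>2) * inverse (x\<^sup>2) = 2 / (2 * pi * x)\<^sup>2" for x :: real
        by (simp add: field_simps)
      ultimately show ?thesis by metis
    qed
    ultimately show "(\<lambda>n. 2 / (a n)\<^sup>2) sums (Polygamma 1 (1/2 - y/pi) / (2 * pi\<^sup>2))" by simp
  qed auto
  finally show ?thesis .
qed

text \<open>
  The two half lines contribute trigamma values at \<open>1/2 - y/\<pi>\<close> and \<open>1/2 + y/\<pi>\<close>. These arguments add up
  to \<open>1\<close>, so the reflection formula evaluates the sum.
\<close>

lemma nn_integral_sinh:
  fixes y :: real
  assumes y: "\<bar>y\<bar> < pi / 2"
  shows "(\<integral>\<^sup>+u. ennreal (u * exp (2 * u * y) / sinh (pi * u)) \<partial>lborel) = ennreal (1 / (2 * (cos y)\<^sup>2))"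
proof -
  let ?f = "\<lambda>y u. ennreal (u * exp (2 * u * y) / sinh (pi * u))"
  have pg: "Polygamma 1 (1/2 - x/pi) \<ge> 0" if "\<bar>x\<bar> < pi / 2" for x :: real
  proof -
    have "1/2 - x/pi > 0" using that by (auto simp: field_simps)
    hence "1/2 - x/pi \<notin> \<int>\<^sub>\<le>\<^sub>0" by (metis nonpos_Ints_nonpos not_le)
    thus ?thesis by (intro less_imp_le Polygamma_real_odd_pos) auto
  qed
  have "(\<integral>\<^sup>+u. ?f y u \<partial>lborel) = (\<integral>\<^sup>+u. ?f y u * indicator {0<..} u + ?f y u * indicator {..<0} u \<partial>lborel)"
    by (intro nn_integral_cong) (auto simp: indicator_def)
  also have "\<dots> = (\<integral>\<^sup>+u\<in>{0<..}. ?f y u \<partial>lborel) + (\<integral>\<^sup>+u\<in>{..<0}. ?f y u \<partial>lborel)"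
    by (rule nn_integral_add) auto
  also have "(\<integral>\<^sup>+u\<in>{..<0}. ?f y u \<partial>lborel) = (\<integral>\<^sup>+u\<in>{0<..}. ?f (-y) u \<partial>lborel)"
    by (subst nn_integral_real_affine[of _ "-1" 0]) (auto simp: indicator_def intro!: nn_integral_cong)
  also have "(\<integral>\<^sup>+u\<in>{0<..}. ?f y u \<partial>lborel) + (\<integral>\<^sup>+u\<in>{0<..}. ?f (-y) u \<partial>lborel) =
     ennreal (Polygamma 1 (1/2 - y/pi) / (2 * pi\<^sup>2) + Polygamma 1 (1/2 - (-y)/pi) / (2 * pi\<^sup>2))"
  proof -
    have y': "\<bar>- y\<bar> < pi / 2" using y by simp
    have nn: "0 \<le> Polygamma 1 (1/2 - y/pi) / (2 * pi\<^sup>2)" "0 \<le> Polygamma 1 (1/2 - (-y)/pi) / (2 * pi\<^sup>2)"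
      using pg[OF y] pg[OF y'] by (intro divide_nonneg_nonneg; simp)+
    show ?thesis
      using arg_cong2[OF nn_integral_half_sinh[OF y] nn_integral_half_sinh[OF y'], of "(+)"]
      by (rule trans) (rule ennreal_plus[OF nn, symmetric])
  qed
  also have "Polygamma 1 (1/2 - y/pi) / (2 * pi\<^sup>2) + Polygamma 1 (1/2 - (-y)/pi) / (2 * pi\<^sup>2) =
     (Polygamma 1 (1/2 - y/pi) + Polygamma 1 (1 - (1/2 - y/pi))) / (2 * pi\<^sup>2)"
    by (simp add: add_divide_distrib)
  also have "\<dots> = (pi / sin (pi * (1/2 - y/pi)))\<^sup>2 / (2 * pi\<^sup>2)"
    using y by (subst Polygamma_1_reflection_real) (auto simp: field_simps)
  also have "sin (pi * (1/2 - y/pi)) = cos y"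
    by (simp add: cos_sin_eq right_diff_distrib)
  also have "(pi / cos y)\<^sup>2 / (2 * pi\<^sup>2) = 1 / (2 * (cos y)\<^sup>2)" by (simp add: power_divide)
  finally show ?thesis .
qed

section \<open>The Levy measure and the Riccati equation\<close>

definition meixner_density :: "real \<Rightarrow> real \<Rightarrow> real" where
  "meixner_density lam s = sqrt (4 - lam\<^sup>2) / (2 * pi)
       * (cmod (Gamma (1 + \<i> * complex_of_real ((4 - lam\<^sup>2) powr (- 1 / 2) * s))))\<^sup>2
       * exp (2 * s * (4 - lam\<^sup>2) powr (- 1 / 2) * arctan (lam * (4 - lam\<^sup>2) powr (- 1 / 2)))
       * (1 / s\<^sup>2)"

definition meixner_measure :: "real \<Rightarrow> real measure" where
  "meixner_measure lam = density lborel (\<lambda>s. ennreal (meixner_density lam s))"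

text \<open>
  The parameters \<open>D\<close> and \<open>\<theta>\<close> are those of the solution \<open>D tan (D t + \<theta>) - lam / 2\<close> of the Riccati
  equation \<open>f' = 1 + lam f + f\<^sup>2\<close>, \<open>f(0) = 0\<close>.
\<close>

context
  fixes lam D \<theta> :: real
  assumes lam: "0 \<le> lam" "lam < 2"
  defines "D \<equiv> sqrt (4 - lam\<^sup>2) / 2" and "\<theta> \<equiv> arctan (lam / (2 * D))"
begin

lemma meixner_scale_pos: "D > 0" and meixner_scale_square: "4 * D\<^sup>2 = 4 - lam\<^sup>2"
proof -
  have "lam\<^sup>2 < 2\<^sup>2" using lam by (intro power_strict_mono) auto
  thus "D > 0" "4 * D\<^sup>2 = 4 - lam\<^sup>2" by (auto simp: D_def power_divide)
qed

lemma meixner_angle_bounds: "0 \<le> \<theta>" "\<theta> < pi / 2"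
  using lam meixner_scale_pos arctan_ubound[of "lam / (2 * D)"] by (auto simp: \<theta>_def)

text \<open>
  In the variable \<open>u = s / (2 D)\<close>, the density of \<open>s\<^sup>2 \<nu>(ds)\<close> is the kernel whose Laplace transform is known.
\<close>

lemma meixner_density_eq:
  assumes "s \<noteq> 0"
  shows "s\<^sup>2 * meixner_density lam s = D * ((s / (2*D)) * exp (2 * (s / (2*D)) * \<theta>) / sinh (pi * (s / (2*D))))"
proof -
  have "4 - lam\<^sup>2 > 0" using meixner_scale_pos meixner_scale_square by (metis zero_less_mult_iff zero_less_numeral zero_less_power)
  hence "(4 - lam\<^sup>2) powr (- 1 / 2) = 1 / (2 * D)"
    by (simp add: D_def powr_half_sqrt powr_minus divide_simps)
  hence eq: "meixner_density lam s = (2 * D) / (2 * pi) * (cmod (Gamma (1 + \<i> * complex_of_real (s / (2 * D)))))\<^sup>2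
     * exp (2 * (s / (2*D)) * \<theta>) * (1 / s\<^sup>2)"
    by (simp add: meixner_density_def D_def \<theta>_def)
  show ?thesis
    using assms meixner_scale_pos unfolding eq by (subst Gamma_1_imaginary) (auto simp: field_simps)
qed

lemma meixner_density_nonneg: "meixner_density lam s \<ge> 0"
  using meixner_scale_pos by (auto simp: meixner_density_def D_def)

lemma borel_measurable_meixner_density [measurable]: "meixner_density lam \<in> borel_measurable borel"
proof -
  have "(\<lambda>s. if s = 0 then 0 else
    (D * ((s / (2*D)) * exp (2 * (s / (2*D)) * \<theta>) / sinh (pi * (s / (2*D))))) / s\<^sup>2) \<in> borel_measurable borel"
    by measurable
  also have "(\<lambda>s. if s = 0 then 0 else
    (D * ((s / (2*D)) * exp (2 * (s / (2*D)) * \<theta>) / sinh (pi * (s / (2*D))))) / s\<^sup>2) = meixner_density lam"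
  proof
    fix s :: real
    show "(if s = 0 then 0 else
    (D * ((s / (2*D)) * exp (2 * (s / (2*D)) * \<theta>) / sinh (pi * (s / (2*D))))) / s\<^sup>2) = meixner_density lam s"
    proof (cases "s = 0")
      case False
      show ?thesis unfolding meixner_density_eq[OF False, symmetric] using False by simp
    qed (simp add: meixner_density_def)
  qed
  finally show ?thesis .
qed

lemma sets_meixner_measure [measurable_cong, simp]: "sets (meixner_measure lam) = sets borel"
  by (simp add: meixner_measure_def)

lemma nn_integral_meixner:
  assumes t: "\<bar>\<theta> + D * t\<bar> < pi / 2"
  shows "(\<integral>\<^sup>+s. ennreal (s\<^sup>2 * exp (s * t)) \<partial>meixner_measure lam) = ennreal (D\<^sup>2 / (cos (\<theta> + D * t))\<^sup>2)"
proof -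
  let ?g = "\<lambda>u. ennreal (u * exp (2 * u * (\<theta> + D * t)) / sinh (pi * u))"
  have "(\<integral>\<^sup>+s. ennreal (s\<^sup>2 * exp (s * t)) \<partial>meixner_measure lam) =
    (\<integral>\<^sup>+s. ennreal (meixner_density lam s) * ennreal (s\<^sup>2 * exp (s * t)) \<partial>lborel)"
    unfolding meixner_measure_def by (subst nn_integral_density) auto
  also have "\<dots> = ennreal \<bar>2 * D\<bar> * (\<integral>\<^sup>+u. ennreal (meixner_density lam (0 + 2 * D * u)) *
      ennreal ((0 + 2 * D * u)\<^sup>2 * exp ((0 + 2 * D * u) * t)) \<partial>lborel)"
    using meixner_scale_pos by (subst nn_integral_real_affine[of _ "2 * D" 0]) auto
  also have "(\<integral>\<^sup>+u. ennreal (meixner_density lam (0 + 2 * D * u)) *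
      ennreal ((0 + 2 * D * u)\<^sup>2 * exp ((0 + 2 * D * u) * t)) \<partial>lborel) =
     (\<integral>\<^sup>+u. ennreal D * ?g u \<partial>lborel)"
  proof (rule nn_integral_cong)
    fix u :: real
    show "ennreal (meixner_density lam (0 + 2 * D * u)) * ennreal ((0 + 2 * D * u)\<^sup>2 * exp ((0 + 2 * D * u) * t)) =
      ennreal D * ?g u"
    proof (cases "u = 0")
      case False
      define s where "s = 2 * D * u"
      have s: "s \<noteq> 0" "u = s / (2 * D)" using False meixner_scale_pos by (auto simp: s_def)
      have "ennreal (meixner_density lam s) * ennreal (s\<^sup>2 * exp (s * t)) =
         ennreal (s\<^sup>2 * meixner_density lam s * exp (s * t))"
        using meixner_density_nonneg[of s] by (simp add: ennreal_mult'[symmetric] mult_ac)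
      also have "\<dots> = ennreal (D * (u * exp (2 * u * \<theta>) / sinh (pi * u)) * exp (2 * u * (D * t)))"
        unfolding meixner_density_eq[OF s(1)] s(2)[symmetric] by (simp add: s_def mult_ac)
      also have "\<dots> = ennreal (D * (u * exp (2 * u * (\<theta> + D * t)) / sinh (pi * u)))"
        by (simp add: distrib_left exp_add mult_ac)
      also have "\<dots> = ennreal D * ?g u"
        using meixner_scale_pos by (intro ennreal_mult') auto
      finally show ?thesis by (simp add: s_def)
    qed simp
  qed
  also have "\<dots> = ennreal D * (\<integral>\<^sup>+u. ?g u \<partial>lborel)"
    by (rule nn_integral_cmult) measurable
  also have "\<dots> = ennreal D * ennreal (1 / (2 * (cos (\<theta> + D * t))\<^sup>2))"
    by (simp only: nn_integral_sinh[OF t])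
  also have "ennreal \<bar>2 * D\<bar> * (ennreal D * ennreal (1 / (2 * (cos (\<theta> + D * t))\<^sup>2))) =
    ennreal (\<bar>2 * D\<bar> * (D * (1 / (2 * (cos (\<theta> + D * t))\<^sup>2))))"
    using meixner_scale_pos by (subst ennreal_mult'[symmetric], simp)+ simp
  also have "\<bar>2 * D\<bar> * (D * (1 / (2 * (cos (\<theta> + D * t))\<^sup>2))) = D\<^sup>2 / (cos (\<theta> + D * t))\<^sup>2"
    using meixner_scale_pos by (simp add: power2_eq_square)
  finally show ?thesis .
qed

lemma has_bochner_integral_meixner:
  assumes t: "\<bar>\<theta> + D * t\<bar> < pi / 2"
  shows "has_bochner_integral (meixner_measure lam) (\<lambda>s. s\<^sup>2 * exp (s * t)) (D\<^sup>2 / (cos (\<theta> + D * t))\<^sup>2)"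
  by (rule has_bochner_integral_nn_integral[OF _ _ _ nn_integral_meixner[OF t]]) auto

lemma integrable_meixner:
  assumes "0 \<le> t" "D * t < pi / 2 - \<theta>"
  shows "integrable (meixner_measure lam) (\<lambda>s. s\<^sup>2 * exp (t * \<bar>s\<bar>))"
proof -
  have "0 \<le> D * t" using assms meixner_scale_pos by simp
  hence "\<bar>\<theta> + D * t\<bar> < pi / 2" "\<bar>\<theta> + D * (-t)\<bar> < pi / 2"
    using assms(2) meixner_angle_bounds by linarith+
  from this[THEN has_bochner_integral_meixner, THEN integrable.intros]
  have "integrable (meixner_measure lam) (\<lambda>s. s\<^sup>2 * exp (s * t) + s\<^sup>2 * exp (s * (-t)))"
    by (rule Bochner_Integration.integrable_add)
  thus ?thesis
  proof (rule Bochner_Integration.integrable_bound)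
    have "exp (t * \<bar>s\<bar>) \<le> exp (s * t) + exp (s * (-t))" for s :: real
      by (cases "s \<ge> 0") (simp_all add: mult.commute)
    hence "s\<^sup>2 * exp (t * \<bar>s\<bar>) \<le> s\<^sup>2 * (exp (s * t) + exp (s * (-t)))" for s :: real
      by (intro mult_left_mono) auto
    thus "AE s in meixner_measure lam. norm (s\<^sup>2 * exp (t * \<bar>s\<bar>)) \<le> norm (s\<^sup>2 * exp (s * t) + s\<^sup>2 * exp (s * (-t)))"
      by (auto simp: distrib_left)
  qed auto
qed

text \<open>
  Both sides are holomorphic near \<open>0\<close>, and they agree for real \<open>z\<close>.
\<close>

lemma meixner_laplace:
  fixes z :: complex
  assumes z: "norm z < (pi / 2 - \<theta>) / (2 * D)"
  shows "(LINT s|meixner_measure lam. of_real (s\<^sup>2) * exp (z * of_real s)) =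
    of_real (D\<^sup>2) / (cos (of_real \<theta> + of_real D * z))\<^sup>2"
proof -
  define r where "r = (pi / 2 - \<theta>) / (2 * D)"
  have r: "r > 0" using meixner_angle_bounds meixner_scale_pos by (simp add: r_def)
  have Dr: "D * r < pi / 2 - \<theta>" using meixner_angle_bounds meixner_scale_pos by (simp add: r_def)
  let ?R = "\<lambda>z. LINT s|meixner_measure lam. of_real (s\<^sup>2) * exp (z * of_real s)"
  let ?C = "\<lambda>z. of_real (D\<^sup>2) / (cos (of_real \<theta> + of_real D * z))\<^sup>2 :: complex"
  have sub: "ball 0 r \<subseteq> strip r"
    by (auto simp: strip_def intro: le_less_trans[OF abs_Re_le_cmod])
  have "?R holomorphic_on strip r"
    using r Dr by (intro laplace_transform_holomorphic(1) integrable_meixner) auto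
  hence hR: "?R holomorphic_on ball 0 r" using sub by (rule holomorphic_on_subset)
  have cos0: "cos (of_real \<theta> + of_real D * z) \<noteq> 0" if "z \<in> ball 0 r" for z :: complex
  proof
    assume "cos (of_real \<theta> + of_real D * z) = 0"
    \<comment> \<open>Complex zeros of the cosine are real, at odd multiples of \<open>\<pi>/2\<close>.\<close>
    then obtain n :: int where n: "of_real \<theta> + of_real D * z = of_real (n * pi) + of_real pi / 2"
      by (auto simp: cos_eq_0)
    have "\<theta> + D * Re z = n * pi + pi / 2" using arg_cong[OF n, of Re] by simp
    moreover have "\<bar>D * Re z\<bar> < D * r"
      using that sub meixner_scale_pos by (auto simp: abs_mult strip_def)
    ultimately have "\<bar>n * pi + pi / 2\<bar> < pi / 2" using Dr meixner_angle_bounds by linarith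
    hence "real_of_int n * pi < 0 * pi" "- 1 * pi < real_of_int n * pi" by linarith+
    hence "real_of_int n < 0" "- 1 < real_of_int n"
      by (simp_all only: mult_less_cancel_right_pos[OF pi_gt_zero])
    thus False by simp
  qed
  have "?C holomorphic_on ball 0 r"
    using cos0 by (intro holomorphic_intros) auto
  with hR have diff: "(\<lambda>z. ?R z - ?C z) holomorphic_on ball 0 r" by (rule holomorphic_on_diff)
  have "?R (of_real t) - ?C (of_real t) = 0" if "\<bar>t\<bar> < r" for t
  proof -
    have "\<bar>D * t\<bar> < D * r" using that meixner_scale_pos by (simp add: abs_mult)
    hence "\<bar>\<theta> + D * t\<bar> < pi / 2" using Dr meixner_angle_bounds by linarith
    note integral = has_bochner_integral_integral_eq[OF has_bochner_integral_meixner[OF this]]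
    have "?R (of_real t) = (LINT s|meixner_measure lam. complex_of_real (s\<^sup>2 * exp (s * t)))"
      by (simp add: exp_of_real[symmetric] mult.commute)
    also have "\<dots> = complex_of_real (D\<^sup>2 / (cos (\<theta> + D * t))\<^sup>2)"
      unfolding integral_complex_of_real integral ..
    also have "\<dots> = ?C (of_real t)" by (simp add: cos_of_real[symmetric])
    finally show ?thesis by simp
  qed
  hence zero: "?R v - ?C v = 0" if "v \<in> of_real ` {-r<..<r}" for v :: complex using that by auto
  have lim: "0 islimpt (of_real ` {-r<..<r} :: complex set)"
    unfolding islimpt_approachable
  proof (intro allI impI)
    fix e :: real assume "e > 0"
    thus "\<exists>x'\<in>of_real ` {- r<..<r}. x' \<noteq> (0::complex) \<and> dist x' 0 < e"
      using r by (intro bexI[of _ "of_real (min (e/2) (r/2))"]) auto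
  qed
  have "?R z - ?C z = 0"
    by (rule analytic_continuation[OF diff open_ball connected_ball _ _ lim zero])
      (use r z in \<open>auto simp: r_def\<close>)
  thus ?thesis by simp
qed

text \<open>
  The solution \<open>T\<close> of the Riccati equation has as its derivative the Laplace transform of \<open>s\<^sup>2 \<nu>(ds)\<close>,
  whose derivatives at \<open>0\<close> are the moments of \<open>\<nu>\<close> of order at least \<open>2\<close>.
\<close>

lemma meixner_riccati:
  obtains f :: "complex fps" where
    "fps_nth f 0 = 0" "fps_deriv f = 1 + fps_const (of_real lam) * f + f\<^sup>2"
    "\<And>k. fps_nth f (Suc k) = of_real ((LINT s|meixner_measure lam. s ^ (k + 2)) / fact (Suc k))"
proof -
  define r where "r = (pi / 2 - \<theta>) / (2 * D)"
  have r: "r > 0" "D * r < pi / 2 - \<theta>" using meixner_angle_bounds meixner_scale_pos by (auto simp: r_def)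
  let ?R = "\<lambda>z. LINT s|meixner_measure lam. of_real (s\<^sup>2) * exp (z * of_real s)"
  define T where "T = (\<lambda>z. of_real D * tan (of_real \<theta> + of_real D * z) - of_real lam / 2 :: complex)"
  have cos\<theta>: "cos \<theta> \<noteq> 0" using meixner_angle_bounds cos_gt_zero_pi[of \<theta>] by simp
  define S where "S = {z. cos (complex_of_real \<theta> + of_real D * z) \<noteq> 0}"
  have "open S" unfolding S_def by (intro open_Collect_neq continuous_intros)
  moreover have "0 \<in> S" using cos\<theta> by (simp add: S_def cos_of_real)
  ultimately have S: "open S" "0 \<in> S" by auto
  have ev: "\<forall>\<^sub>F z in nhds 0. cos (complex_of_real \<theta> + of_real D * z) \<noteq> 0"
    using eventually_nhds_in_open[OF S] by (simp add: S_def)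
  have dT: "(T has_field_derivative of_real (D\<^sup>2) / (cos (of_real \<theta> + of_real D * z))\<^sup>2) (at z)"
    if "cos (complex_of_real \<theta> + of_real D * z) \<noteq> 0" for z
    unfolding T_def using that
    by (auto intro!: derivative_eq_intros simp: field_simps power2_eq_square)
  have ric: "of_real (D\<^sup>2) / (cos (of_real \<theta> + of_real D * z))\<^sup>2 = 1 + of_real lam * T z + (T z)\<^sup>2"
    if "cos (complex_of_real \<theta> + of_real D * z) \<noteq> 0" for z
  proof -
    let ?t = "tan (complex_of_real \<theta> + of_real D * z)"
    have "of_real (D\<^sup>2) / (cos (complex_of_real \<theta> + of_real D * z))\<^sup>2 = of_real (D\<^sup>2) * (1 + ?t\<^sup>2)"
      unfolding tan_sec[OF that] by (simp add: field_simps)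
    moreover have "complex_of_real (D\<^sup>2) = 1 - of_real lam ^ 2 / 4"
      using arg_cong[OF meixner_scale_square, of complex_of_real] by (simp add: field_simps)
    hence "of_real (D\<^sup>2) * (1 + ?t\<^sup>2) = 1 + of_real lam * T z + (T z)\<^sup>2"
      unfolding T_def by (simp add: algebra_simps power2_eq_square)
    ultimately show ?thesis by simp
  qed
  have "T holomorphic_on S" using S(1) dT by (auto simp: holomorphic_on_open S_def)
  hence "T analytic_on {0}" using S by (auto simp: analytic_at)
  define f where "f = fps_expansion T 0"
  have Tf: "T has_fps_expansion f"
    unfolding f_def by (rule analytic_at_imp_has_fps_expansion_0) fact
  have ev_ric: "\<forall>\<^sub>F z in nhds 0. deriv T z = 1 + of_real lam * T z + (T z)\<^sup>2"
    using ev by eventually_elim (rule trans[OF DERIV_imp_deriv[OF dT] ric])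
  have "deriv T has_fps_expansion fps_deriv f"
    using Tf by (rule has_fps_expansion_deriv)
  moreover have "deriv T has_fps_expansion 1 + fps_const (of_real lam) * f + f\<^sup>2"
    unfolding has_fps_expansion_cong[OF ev_ric refl] by (intro fps_expansion_intros Tf)
  ultimately have fric: "fps_deriv f = 1 + fps_const (of_real lam) * f + f\<^sup>2"
    by (rule fps_expansion_unique_complex)
  have "T 0 = of_real (D * tan \<theta> - lam / 2)" by (simp add: T_def tan_of_real)
  also have "D * tan \<theta> = lam / 2" using meixner_scale_pos by (simp add: \<theta>_def tan_arctan)
  finally have f0: "fps_nth f 0 = 0" using fps_nth_fps_expansion[OF Tf, of 0] by simp
  have "eventually (\<lambda>z::complex. z \<in> ball 0 r) (nhds 0)"
    using r by (intro eventually_nhds_in_open) auto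
  hence ev_R: "\<forall>\<^sub>F z in nhds 0. deriv T z = ?R z"
    using ev
  proof eventually_elim
    case (elim z)
    have "?R z = of_real (D\<^sup>2) / (cos (of_real \<theta> + of_real D * z))\<^sup>2"
      by (rule meixner_laplace) (use elim in \<open>auto simp: r_def\<close>)
    thus ?case using DERIV_imp_deriv[OF dT[OF elim(2)]] by simp
  qed
  have "fps_nth f (Suc k) = of_real ((LINT s|meixner_measure lam. s ^ (k + 2)) / fact (Suc k))" for k
  proof -
    have "(deriv ^^ Suc k) T 0 = (deriv ^^ k) (deriv T) 0" by (simp add: funpow_swap1)
    also have "\<dots> = (deriv ^^ k) ?R 0" by (rule higher_deriv_cong_ev[OF ev_R refl])
    also have "\<dots> = of_real (LINT s|meixner_measure lam. s\<^sup>2 * s ^ k)"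
      using r by (intro laplace_transform_holomorphic(2)[where \<delta> = r] integrable_meixner) auto
    also have "(LINT s|meixner_measure lam. s\<^sup>2 * s ^ k) = (LINT s|meixner_measure lam. s ^ (k + 2))"
      by (simp add: power2_eq_square mult_ac)
    finally show ?thesis using fps_nth_fps_expansion[OF Tf, of "Suc k"] by simp
  qed
  with f0 fric show ?thesis using that by blast
qed

end

lemma meixner_exponential_moment:
  assumes "0 \<le> lam" "lam < 2"
  obtains \<delta> where "\<delta> > 0" "integrable (meixner_measure lam) (\<lambda>s. s\<^sup>2 * exp (\<delta> * \<bar>s\<bar>))"
proof -
  let ?D = "sqrt (4 - lam\<^sup>2) / 2" and ?\<theta> = "arctan (lam / (2 * (sqrt (4 - lam\<^sup>2) / 2)))"
  let ?\<delta> = "(pi / 2 - ?\<theta>) / (2 * ?D)"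
  have D: "?D > 0" and \<theta>: "?\<theta> < pi / 2" using meixner_scale_pos[OF assms] meixner_angle_bounds[OF assms] by auto
  have "?\<delta> > 0" "?D * ?\<delta> < pi / 2 - ?\<theta>" using D \<theta> by auto
  thus ?thesis using integrable_meixner[OF assms, of ?\<delta>] that[of ?\<delta>] by simp
qed

lemma sigma_finite_meixner: "sigma_finite_measure (meixner_measure lam)" if "0 \<le> lam" "lam < 2"
  unfolding meixner_measure_def
  using borel_measurable_meixner_density[OF that]
  by (subst sigma_finite_measure.sigma_finite_iff_density_finite[OF sigma_finite_lborel]) auto

lemma levy_measure_meixner:
  assumes "0 \<le> lam" "lam < 2"
  shows "levy_measure (meixner_measure lam)"
  unfolding levy_measure_def
proof (intro conjI)
  have [measurable]: "meixner_density lam \<in> borel_measurable borel"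
    by (rule borel_measurable_meixner_density[OF assms])
  show "emeasure (meixner_measure lam) {0} = 0"
    unfolding meixner_measure_def by (subst emeasure_density) auto
  obtain \<delta> where \<delta>: "\<delta> > 0" "integrable (meixner_measure lam) (\<lambda>s. s\<^sup>2 * exp (\<delta> * \<bar>s\<bar>))"
    by (rule meixner_exponential_moment[OF assms])
  have "(\<integral>\<^sup>+s. ennreal (min 1 (s\<^sup>2)) \<partial>meixner_measure lam) \<le>
    (\<integral>\<^sup>+s. ennreal (norm (s\<^sup>2 * exp (\<delta> * \<bar>s\<bar>))) \<partial>meixner_measure lam)"
  proof (intro nn_integral_mono ennreal_leI)
    fix s :: real
    have "s\<^sup>2 * 1 \<le> s\<^sup>2 * exp (\<delta> * \<bar>s\<bar>)" using \<delta>(1) by (intro mult_left_mono) auto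
    thus "min 1 (s\<^sup>2) \<le> norm (s\<^sup>2 * exp (\<delta> * \<bar>s\<bar>))" by simp
  qed
  also have "\<dots> < \<infinity>" using \<delta>(2) by (simp add: integrable_iff_bounded)
  finally show "(\<integral>\<^sup>+s. ennreal (min 1 (s\<^sup>2)) \<partial>meixner_measure lam) < \<infinity>" .
qed (simp add: meixner_measure_def)

lemma meixner_measure_eq_density:
  "meixner_measure lam = density lborel (\<lambda>s. ennreal
      (sqrt (4 - lam\<^sup>2) / (2 * pi)
       * (cmod (Gamma (1 + \<i> * complex_of_real ((4 - lam\<^sup>2) powr (- 1 / 2) * s))))\<^sup>2
       * exp (2 * s * (4 - lam\<^sup>2) powr (- 1 / 2) * arctan (lam * (4 - lam\<^sup>2) powr (- 1 / 2)))
       * (1 / s\<^sup>2)))"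
  by (simp only: meixner_measure_def meixner_density_def)

section \<open>Exponential vectors and the Jacobi operators\<close>

text \<open>
  Composing with a transposition shows that the sum does not depend on \<open>i0\<close>; so it may be averaged over
  all positions, and then each permutation contributes the same sum.
\<close>

lemma sum_permutations_eq_average:
  fixes H :: "nat \<Rightarrow> complex"
  assumes "i0 < n"
  shows "(\<Sum>\<pi> | \<pi> permutes {..<n}. H (\<pi> i0)) = fact n * (\<Sum>i<n. H i) / of_nat n"
proof -
  let ?P = "{\<pi>. \<pi> permutes {..<n}}"
  have same: "(\<Sum>\<pi>\<in>?P. H (\<pi> i)) = (\<Sum>\<pi>\<in>?P. H (\<pi> i0))" if "i < n" for i
  proof -
    have t: "Transposition.transpose i0 i permutes {..<n}"
      using assms that by (intro permutes_swap_id) auto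
    have "(\<Sum>\<pi>\<in>?P. H (\<pi> i0)) = (\<Sum>\<pi>\<in>?P. H ((\<pi> \<circ> Transposition.transpose i0 i) i0))"
      by (rule sum.reindex_bij_witness[where i = "\<lambda>\<pi>. \<pi> \<circ> Transposition.transpose i0 i" and j = "\<lambda>\<pi>. \<pi> \<circ> Transposition.transpose i0 i"])
        (auto simp: o_assoc[symmetric] permutes_compose[OF t])
    thus ?thesis by simp
  qed
  have "of_nat n * (\<Sum>\<pi>\<in>?P. H (\<pi> i0)) = (\<Sum>i<n. \<Sum>\<pi>\<in>?P. H (\<pi> i))"
    using same by simp
  also have "\<dots> = (\<Sum>\<pi>\<in>?P. \<Sum>i<n. H (\<pi> i))" by (rule sum.swap)
  also have "\<dots> = (\<Sum>\<pi>\<in>?P. \<Sum>i<n. H i)"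
  proof (rule sum.cong[OF refl])
    fix \<pi> assume "\<pi> \<in> ?P"
    thus "(\<Sum>i<n. H (\<pi> i)) = (\<Sum>i<n. H i)"
      using sum.permute[of \<pi> "{..<n}" H] by (simp add: o_def)
  qed
  also have "\<dots> = fact n * (\<Sum>i<n. H i)"
    by (simp add: card_permutations)
  finally show ?thesis using assms by (simp add: field_simps)
qed

text \<open>
  The functions symmetrized in the Jacobi operators single out one variable of a product that is
  otherwise symmetric, so that their value at \<open>x \<circ> \<pi>\<close> depends on \<open>\<pi> 0\<close> only.
\<close>

lemma symmetrize_eq_average:
  assumes "0 < n" "\<And>\<pi>. \<pi> permutes {..<n} \<Longrightarrow> f (x \<circ> \<pi>) = H (\<pi> 0)"
  shows "symmetrize n f x = (\<Sum>i<n. H i) / of_nat n"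
proof -
  have "(\<Sum>\<pi> | \<pi> permutes {..<n}. f (x \<circ> \<pi>)) = (\<Sum>\<pi> | \<pi> permutes {..<n}. H (\<pi> 0))"
    using assms(2) by (intro sum.cong) auto
  thus ?thesis
    unfolding symmetrize_def sum_permutations_eq_average[OF assms(1)] by simp
qed

text \<open>
  The power series \<open>f (a t)\<close> in \<open>t\<close>.
\<close>

definition dilate :: "complex fps \<Rightarrow> real \<Rightarrow> complex fps" where
  "dilate f a = f oo (fps_const (of_real a) * fps_X)"

lemma dilate_nth: "fps_nth (dilate f a) k = of_real a ^ k * fps_nth f k"
  unfolding dilate_def fps_compose_linear by simp

lemma fps_deriv_dilate_riccati:
  assumes "fps_deriv f = 1 + fps_const c * f + f\<^sup>2"
  shows "fps_deriv (dilate f a) =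
    fps_const (of_real a) * (1 + fps_const c * dilate f a + (dilate f a)\<^sup>2)"
proof -
  let ?b = "fps_const (complex_of_real a) * fps_X"
  have "fps_deriv (dilate f a) = (fps_deriv f oo ?b) * fps_deriv ?b"
    unfolding dilate_def by (rule fps_compose_deriv) simp
  also have "fps_deriv ?b = fps_const (of_real a)" by simp
  also have "fps_deriv f oo ?b = 1 + fps_const c * dilate f a + (dilate f a)\<^sup>2"
    unfolding assms dilate_def
    by (simp add: fps_compose_add_distrib fps_compose_mult_distrib power2_eq_square)
  finally show ?thesis by (simp add: mult.commute)
qed

lemma fps_deriv_prod:
  fixes v :: "'i \<Rightarrow> complex fps"
  assumes "finite A"
  shows "fps_deriv (\<Prod>i\<in>A. v i) = (\<Sum>i\<in>A. fps_deriv (v i) * (\<Prod>j\<in>A - {i}. v j))"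
  using assms
proof (induction A rule: finite_induct)
  case (insert a A)
  have "(\<Sum>i\<in>A. fps_deriv (v i) * (\<Prod>j\<in>insert a A - {i}. v j)) =
    (\<Sum>i\<in>A. v a * (fps_deriv (v i) * (\<Prod>j\<in>A - {i}. v j)))"
  proof (rule sum.cong)
    fix i assume "i \<in> A"
    hence "insert a A - {i} = insert a (A - {i})" using insert by auto
    thus "fps_deriv (v i) * (\<Prod>j\<in>insert a A - {i}. v j) = v a * (fps_deriv (v i) * (\<Prod>j\<in>A - {i}. v j))"
      using insert by (simp add: mult_ac)
  qed simp
  with insert show ?case by (simp add: sum_distrib_left mult_ac)
qed simp

text \<open>
  The coefficient of \<open>t\<^sup>k\<close> in the vector with components \<open>l(t) (\<Prod>i<n. f (t \<phi>(x\<^sub>i))) / n!\<close>. Working with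
  coefficients keeps each vector finite: if \<open>f\<close> has no constant term, only degrees \<open>n \<le> k\<close> occur.
\<close>

definition exp_vector :: "complex fps \<Rightarrow> complex fps \<Rightarrow> ('a \<Rightarrow> real) \<Rightarrow> nat \<Rightarrow> 'a fock" where
  "exp_vector f l \<phi> k n x = fps_nth (l * (\<Prod>i<n. dilate f (\<phi> (x i)))) k / fact n"

lemma exp_vector_0:
  fixes \<phi> :: "'a \<Rightarrow> real"
  assumes "fps_nth f 0 = 0" "fps_nth l 0 = 1"
  shows "exp_vector f l \<phi> 0 = vacuum"
proof (intro ext)
  fix n :: nat and x :: "nat \<Rightarrow> 'a"
  have "fps_nth (\<Prod>i<n. dilate f (\<phi> (x i))) 0 = (\<Prod>i<n. fps_nth (dilate f (\<phi> (x i))) 0)"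
    by (induction n) auto
  thus "exp_vector f l \<phi> 0 n x = vacuum n x"
    using assms by (cases n) (auto simp: exp_vector_def vacuum_def dilate_nth)
qed

lemma prod_lessThan_permutes_shift:
  assumes "\<pi> permutes {..<Suc m}"
  shows "(\<Prod>i<m. v (\<pi> (Suc i))) = (\<Prod>j\<in>{..<Suc m} - {\<pi> 0}. v j)"
proof -
  have "(\<Prod>j\<in>{..<Suc m} - {\<pi> 0}. v j) = (\<Prod>i\<in>{..<Suc m} - {0}. v (\<pi> i))"
  proof (rule prod.reindex_cong[of \<pi>])
    show "inj_on \<pi> ({..<Suc m} - {0})" using permutes_inj_on[OF assms] by blast
    have "\<pi> ` ({..<Suc m} - {0}) = \<pi> ` {..<Suc m} - \<pi> ` {0}"
      using permutes_inj[OF assms] by (rule image_set_diff)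
    thus "{..<Suc m} - {\<pi> 0} = \<pi> ` ({..<Suc m} - {0})"
      using permutes_image[OF assms] by simp
  qed simp
  also have "\<dots> = (\<Prod>i<m. v (\<pi> (Suc i)))"
    by (rule prod.reindex_bij_witness[of _ Suc "\<lambda>i. i - 1"]) auto
  finally show ?thesis ..
qed

text \<open>
  This is the equation \<open>F' = J F\<close>, read coefficientwise. With \<open>P = \<Prod>i u\<^sub>i\<close> and \<open>Q i\<close> the same product without
  the factor \<open>i\<close>, symmetrization turns creation, neutral and second annihilation operator into sums over \<open>i\<close>
  of \<open>\<phi>(x\<^sub>i) u\<^sub>i\<^sup>j Q i\<close> with \<open>j = 0, 1, 2\<close>. By the Riccati equation they combine to \<open>P'\<close>, while the first
  annihilation operator and the constant term account for \<open>l'\<close>.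
\<close>

lemma jacobi_op_exp_vector:
  fixes \<sigma> :: "'a measure" and \<phi> :: "'a \<Rightarrow> real" and f l :: "complex fps"
  assumes int: "\<And>j. integrable \<sigma> (\<lambda>y. \<phi> y ^ Suc j)"
    and f: "fps_deriv f = 1 + fps_const (of_real lam) * f + f\<^sup>2"
    and l: "fps_deriv l = l * (Abs_fps (\<lambda>j. fps_nth f j * of_real (LINT y|\<sigma>. \<phi> y ^ Suc j)) +
              fps_const (of_real (c_coeff lam * (LINT y|\<sigma>. \<phi> y))))"
  shows "jacobi_op \<sigma> lam \<phi> (exp_vector f l \<phi> k) = (\<lambda>n x. of_nat (Suc k) * exp_vector f l \<phi> (Suc k) n x)"
proof (intro ext)
  fix n and x :: "nat \<Rightarrow> 'a"
  let ?F = "exp_vector f l \<phi> k"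
  define u where "u i = dilate f (\<phi> (x i))" for i
  define a where "a i = complex_of_real (\<phi> (x i))" for i
  define P where "P = (\<Prod>i<n. u i)"
  define Q where "Q i = (\<Prod>j\<in>{..<n} - {i}. u j)" for i
  define U where "U = Abs_fps (\<lambda>j. fps_nth f j * of_real (LINT y|\<sigma>. \<phi> y ^ Suc j))"
  define c where "c = complex_of_real (c_coeff lam * (LINT y|\<sigma>. \<phi> y))"
  let ?nth = "\<lambda>A. fps_nth A k"
  have uQ: "u i * Q i = P" if "i < n" for i
    unfolding P_def Q_def using that by (subst prod.remove[of "{..<n}" i]) auto

  have creation: "(case n of 0 \<Rightarrow> 0 | Suc m \<Rightarrow> creation \<phi> m (?F m) x) =
      (\<Sum>i<n. ?nth (fps_const (a i) * (l * Q i))) / fact n"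
  proof (cases n)
    case (Suc m)
    have "creation \<phi> m (?F m) x = (\<Sum>i<Suc m. ?nth (fps_const (a i) * (l * Q i)) / fact m) / of_nat (Suc m)"
      unfolding creation_def
    proof (rule symmetrize_eq_average)
      fix \<pi> assume \<pi>: "\<pi> permutes {..<Suc m}"
      show "complex_of_real (\<phi> ((x \<circ> \<pi>) 0)) * ?F m (\<lambda>i. (x \<circ> \<pi>) (Suc i)) =
        ?nth (fps_const (a (\<pi> 0)) * (l * Q (\<pi> 0))) / fact m"
        using prod_lessThan_permutes_shift[OF \<pi>, of u]
        by (simp add: exp_vector_def a_def Q_def u_def Suc)
    qed simp
    thus ?thesis unfolding Suc by (simp add: sum_divide_distrib[symmetric] field_simps)
  qed simp

  have permP: "(\<Prod>i<n. u (\<pi> i)) = P" if "\<pi> permutes {..<n}" for \<pi>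
    using prod.permute[OF that, of u] by (simp add: P_def o_def)

  have neutral: "neutral \<phi> n (?F n) x = (\<Sum>i<n. ?nth (fps_const (a i) * (l * (u i * Q i)))) / fact n"
  proof (cases "n = 0")
    case False
    have "symmetrize n (\<lambda>y. complex_of_real (\<phi> (y 0)) * ?F n y) x =
        (\<Sum>i<n. ?nth (fps_const (a i) * (l * (u i * Q i))) / fact n) / of_nat n"
    proof (rule symmetrize_eq_average)
      fix \<pi> assume \<pi>: "\<pi> permutes {..<n}"
      have "\<pi> 0 < n" using permutes_in_image[OF \<pi>, of 0] False by simp
      moreover have "?F n (x \<circ> \<pi>) = ?nth (l * P) / fact n"
        using permP[OF \<pi>] by (simp add: exp_vector_def u_def)
      ultimately show "complex_of_real (\<phi> ((x \<circ> \<pi>) 0)) * ?F n (x \<circ> \<pi>) =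
        ?nth (fps_const (a (\<pi> 0)) * (l * (u (\<pi> 0) * Q (\<pi> 0)))) / fact n"
        by (simp add: a_def uQ)
    qed (use False in simp)
    thus ?thesis unfolding neutral_def using False by (simp add: sum_divide_distrib[symmetric])
  qed (simp add: neutral_def)

  have ann2: "annihilation2 \<phi> (Suc n) (?F (Suc n)) x =
      (\<Sum>i<n. ?nth (fps_const (a i) * (l * ((u i)\<^sup>2 * Q i)))) / fact n"
  proof (cases "n = 0")
    case False
    have "symmetrize n (\<lambda>y. complex_of_real (\<phi> (y 0)) * ?F (Suc n) (case_nat (y 0) y)) x =
        (\<Sum>i<n. ?nth (fps_const (a i) * (l * ((u i)\<^sup>2 * Q i))) / fact (Suc n)) / of_nat n"
    proof (rule symmetrize_eq_average)
      fix \<pi> assume \<pi>: "\<pi> permutes {..<n}"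
      have "\<pi> 0 < n" using permutes_in_image[OF \<pi>, of 0] False by simp
      hence "u (\<pi> 0) * P = (u (\<pi> 0))\<^sup>2 * Q (\<pi> 0)"
        using uQ[of "\<pi> 0"] by (simp add: power2_eq_square mult.assoc)
      moreover have "?F (Suc n) (case_nat ((x \<circ> \<pi>) 0) (x \<circ> \<pi>)) = ?nth (l * (u (\<pi> 0) * P)) / fact (Suc n)"
        using permP[OF \<pi>]
        by (simp add: exp_vector_def u_def prod.lessThan_Suc_shift del: prod.lessThan_Suc fact_Suc)
      ultimately show "complex_of_real (\<phi> ((x \<circ> \<pi>) 0)) * ?F (Suc n) (case_nat ((x \<circ> \<pi>) 0) (x \<circ> \<pi>)) =
        ?nth (fps_const (a (\<pi> 0)) * (l * ((u (\<pi> 0))\<^sup>2 * Q (\<pi> 0)))) / fact (Suc n)"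
        by (simp add: a_def del: fact_Suc)
    qed (use False in simp)
    thus ?thesis unfolding annihilation2_def using False
      by (simp add: sum_divide_distrib[symmetric] field_simps del: of_nat_Suc)
  qed (simp add: annihilation2_def)

  have ann1: "annihilation1 \<sigma> \<phi> (Suc n) (?F (Suc n)) x = ?nth (l * P * U) / fact n"
  proof -
    have "(LINT y|\<sigma>. complex_of_real (\<phi> y) * ?F (Suc n) (case_nat y x)) =
      (LINT y|\<sigma>. (\<Sum>j=0..k. fps_nth (l * P) j * fps_nth f (k - j) / fact (Suc n) * complex_of_real (\<phi> y ^ Suc (k - j))))"
    proof (rule Bochner_Integration.integral_cong)
      fix y
      have "?F (Suc n) (case_nat y x) = ?nth (l * P * dilate f (\<phi> y)) / fact (Suc n)"
        by (simp add: exp_vector_def P_def u_def prod.lessThan_Suc_shift mult_ac del: prod.lessThan_Suc)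
      also have "?nth (l * P * dilate f (\<phi> y)) = (\<Sum>j=0..k. fps_nth (l * P) j * (of_real (\<phi> y) ^ (k - j) * fps_nth f (k - j)))"
        by (simp add: fps_mult_nth[of "l * P"] dilate_nth)
      finally show "complex_of_real (\<phi> y) * ?F (Suc n) (case_nat y x) =
        (\<Sum>j=0..k. fps_nth (l * P) j * fps_nth f (k - j) / fact (Suc n) * complex_of_real (\<phi> y ^ Suc (k - j)))"
        by (simp add: sum_distrib_left sum_divide_distrib mult_ac)
    qed simp
    also have "\<dots> = (\<Sum>j=0..k. fps_nth (l * P) j * fps_nth f (k - j) / fact (Suc n) *
        complex_of_real (LINT y|\<sigma>. \<phi> y ^ Suc (k - j)))"
    proof (subst Bochner_Integration.integral_sum)
      show "integrable \<sigma> (\<lambda>y. fps_nth (l * P) j * fps_nth f (k - j) / fact (Suc n) * complex_of_real (\<phi> y ^ Suc (k - j)))" for j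
        using int[of "k - j"] by (intro integrable_mult_right integrable_of_real)
      show "(\<Sum>j=0..k. LINT y|\<sigma>. fps_nth (l * P) j * fps_nth f (k - j) / fact (Suc n) * complex_of_real (\<phi> y ^ Suc (k - j))) =
        (\<Sum>j=0..k. fps_nth (l * P) j * fps_nth f (k - j) / fact (Suc n) * complex_of_real (LINT y|\<sigma>. \<phi> y ^ Suc (k - j)))"
        by (simp only: integral_mult_right_zero integral_complex_of_real)
    qed
    also have "\<dots> = ?nth (l * P * U) / fact (Suc n)"
      unfolding fps_mult_nth[of "l * P" U] sum_divide_distrib
      by (intro sum.cong refl) (simp add: U_def)
    finally show ?thesis
      unfolding annihilation1_def by (simp add: field_simps del: of_nat_Suc)
  qed

  have "of_nat (Suc k) * fps_nth (l * P) (Suc k) = ?nth (fps_deriv (l * P))"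
    by (simp only: fps_deriv_nth Suc_eq_plus1)
  also have "fps_deriv (l * P) = l * P * U + fps_const c * (l * P) + l * fps_deriv P"
    unfolding fps_deriv_mult l U_def c_def by (simp add: algebra_simps)
  also have "fps_deriv P = (\<Sum>i<n. fps_const (a i) * (1 + fps_const (of_real lam) * u i + (u i)\<^sup>2) * Q i)"
    unfolding P_def Q_def by (simp add: fps_deriv_prod u_def a_def fps_deriv_dilate_riccati[OF f])
  also have "l * \<dots> = (\<Sum>i<n. fps_const (a i) * (l * Q i)) +
      fps_const (of_real lam) * (\<Sum>i<n. fps_const (a i) * (l * (u i * Q i))) +
      (\<Sum>i<n. fps_const (a i) * (l * ((u i)\<^sup>2 * Q i)))"
    unfolding sum_distrib_left sum.distrib[symmetric]
    by (intro sum.cong refl) (simp add: algebra_simps)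
  finally have "of_nat (Suc k) * fps_nth (l * P) (Suc k) =
      ?nth (l * P * U) + c * ?nth (l * P) + (\<Sum>i<n. ?nth (fps_const (a i) * (l * Q i))) +
      of_real lam * (\<Sum>i<n. ?nth (fps_const (a i) * (l * (u i * Q i)))) +
      (\<Sum>i<n. ?nth (fps_const (a i) * (l * ((u i)\<^sup>2 * Q i))))"
    by (simp add: fps_sum_nth add_ac)
  moreover have "?F n x = ?nth (l * P) / fact n"
    and "exp_vector f l \<phi> (Suc k) n x = fps_nth (l * P) (Suc k) / fact n"
    by (simp_all add: exp_vector_def P_def u_def)
  ultimately show "jacobi_op \<sigma> lam \<phi> ?F n x = of_nat (Suc k) * exp_vector f l \<phi> (Suc k) n x"
    unfolding jacobi_op_def creation neutral ann1 ann2
    by (simp add: c_def add_divide_distrib[symmetric] del: of_nat_Suc)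
qed

section \<open>Smoothness of polynomials in functions of single variables\<close>

text \<open>
  The algebra of functions generated by iterated partial derivatives of functions of the single
  variables \<open>y i\<close>. It is closed under partial differentiation, which is what makes its members smooth.
\<close>

inductive_set tensor_algebra :: "nat \<Rightarrow> (nat \<Rightarrow> real ^ 'n \<Rightarrow> real) \<Rightarrow> ((nat \<Rightarrow> real ^ 'n::finite) \<Rightarrow> complex) set"
  for n :: nat and h :: "nat \<Rightarrow> real ^ 'n \<Rightarrow> real" where
  gen: "i < n \<Longrightarrow> \<tau>s \<in> lists vec_shifts \<Longrightarrow> (\<lambda>y. complex_of_real (partials \<tau>s (h i) (y i))) \<in> tensor_algebra n h"
| const: "(\<lambda>y. c) \<in> tensor_algebra n h"
| add: "F \<in> tensor_algebra n h \<Longrightarrow> G \<in> tensor_algebra n h \<Longrightarrow> (\<lambda>y. F y + G y) \<in> tensor_algebra n h"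
| mult: "F \<in> tensor_algebra n h \<Longrightarrow> G \<in> tensor_algebra n h \<Longrightarrow> (\<lambda>y. F y * G y) \<in> tensor_algebra n h"

lemma has_vector_derivative_partial:
  assumes "(\<lambda>t. F (\<tau> t y)) differentiable (at 0)"
  shows "((\<lambda>t. F (\<tau> t y)) has_vector_derivative partial \<tau> F y) (at 0)"
  using assms unfolding partial_def by (simp add: vector_derivative_works)

lemma tuple_shift_0 [simp]: "tuple_shift i j 0 y = y"
  by (simp add: tuple_shift_def)

text \<open>
  Product and sum rule express the partial derivatives inside the algebra; this invariant is strong
  enough for an induction along the generation of the algebra.
\<close>

lemma tensor_algebra_partial:
  assumes h: "\<And>i. i < n \<Longrightarrow> smooth_on vec_shifts (W i) (h i)"
    and F: "F \<in> tensor_algebra n h"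
  shows "continuous_on (PiE {..<n} W) F \<and>
    (\<forall>i<n. \<forall>j. (\<forall>y\<in>PiE {..<n} W. (\<lambda>t. F (tuple_shift i j t y)) differentiable (at 0)) \<and>
      (\<exists>G\<in>tensor_algebra n h. \<forall>y\<in>PiE {..<n} W. partial (tuple_shift i j) F y = G y))"
  (is "?C F \<and> (\<forall>i<n. \<forall>j. ?D i j F \<and> ?E i j F)")
  using F
proof (induction rule: tensor_algebra.induct)
  case (gen i \<tau>s)
  let ?p = "partials \<tau>s (h i)"
  have cont: "continuous_on (W i) ?p"
    using h[OF gen(1)] gen(2) unfolding smooth_on_def by blast
  have diff: "(\<lambda>t. ?p (vec_shift j t v)) differentiable (at 0)" if "v \<in> W i" for v j
    using h[OF gen(1)] gen(2) that unfolding smooth_on_def vec_shifts_def by blast+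
  have deriv: "((\<lambda>t. complex_of_real (?p (tuple_shift i' j t y i))) has_vector_derivative
      (if i' = i then of_real (partial (vec_shift j) ?p (y i)) else 0)) (at 0)"
    if "y \<in> PiE {..<n} W" for i' j y
  proof (cases "i' = i")
    case True
    have "y i \<in> W i" using that gen(1) by auto
    from has_vector_derivative_partial[of ?p "vec_shift j" "y i", OF diff[OF this]]
    have "((\<lambda>t. complex_of_real (?p (vec_shift j t (y i)))) has_vector_derivative
      complex_of_real (partial (vec_shift j) ?p (y i))) (at 0)"
      by (rule bounded_linear.has_vector_derivative[OF bounded_linear_of_real])
    thus ?thesis using True by (simp add: tuple_shift_def vec_shift_def)
  qed (simp add: tuple_shift_def)
  have "?C (\<lambda>y. complex_of_real (?p (y i)))"
  proof -
    have "continuous_on (PiE {..<n} W) (\<lambda>y. ?p (y i))"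
    proof (rule continuous_on_compose2[of "W i"])
      show "continuous_on (PiE {..<n} W) (\<lambda>y. y i)"
        by (rule continuous_on_subset[OF continuous_on_product_coordinates]) simp
    qed (use cont gen(1) in \<open>auto simp: PiE_iff\<close>)
    thus ?thesis by (intro continuous_on_of_real)
  qed
  moreover have "?D i' j (\<lambda>y. complex_of_real (?p (y i)))" for i' j
    using deriv by (blast intro: differentiableI_vector)
  moreover have "?E i' j (\<lambda>y. complex_of_real (?p (y i)))" for i' j
  proof (rule bexI)
    have "vec_shift j # \<tau>s \<in> lists vec_shifts" using gen(2) by (auto simp: vec_shifts_def)
    from tensor_algebra.gen[OF gen(1) this, of h]
    show "(\<lambda>y. if i' = i then complex_of_real (partials (vec_shift j # \<tau>s) (h i) (y i)) else 0) \<in> tensor_algebra n h"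
      by (cases "i' = i") (auto intro: tensor_algebra.const)
    show "\<forall>y\<in>PiE {..<n} W. partial (tuple_shift i' j) (\<lambda>y. complex_of_real (?p (y i))) y =
       (if i' = i then complex_of_real (partials (vec_shift j # \<tau>s) (h i) (y i)) else 0)"
      unfolding partial_def[of "tuple_shift i' j"] using vector_derivative_at[OF deriv] by simp
  qed
  ultimately show ?case by blast
next
  case (const c)
  have "?E i j (\<lambda>y. c)" for i j
    by (rule bexI[OF _ tensor_algebra.const[of 0]]) (simp add: partial_def)
  thus ?case by simp
next
  case (add F G)
  have "?C (\<lambda>y. F y + G y)" using add by (intro continuous_on_add) auto
  moreover have "?D i j (\<lambda>y. F y + G y)" "?E i j (\<lambda>y. F y + G y)" if i: "i < n" for i j
  proof -
    note IH = add.IH(1)[THEN conjunct2, rule_format, OF i, of j] add.IH(2)[THEN conjunct2, rule_format, OF i, of j]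
    from conjunct2[OF IH(1)] conjunct2[OF IH(2)] obtain F' G' where FG: "F' \<in> tensor_algebra n h" "G' \<in> tensor_algebra n h"
      "\<forall>y\<in>PiE {..<n} W. partial (tuple_shift i j) F y = F' y"
      "\<forall>y\<in>PiE {..<n} W. partial (tuple_shift i j) G y = G' y" by blast
    have "((\<lambda>t. F (tuple_shift i j t y) + G (tuple_shift i j t y)) has_vector_derivative F' y + G' y) (at 0)"
      if "y \<in> PiE {..<n} W" for y
      using has_vector_derivative_partial[of F "tuple_shift i j" y]
        has_vector_derivative_partial[of G "tuple_shift i j" y] IH that FG(3,4)
      by (intro has_vector_derivative_add) auto
    note deriv = this
    show "?D i j (\<lambda>y. F y + G y)" using deriv by (blast intro: differentiableI_vector)
    show "?E i j (\<lambda>y. F y + G y)"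
      by (rule bexI[OF _ tensor_algebra.add[OF FG(1,2)]])
        (use vector_derivative_at[OF deriv] in \<open>simp add: partial_def[of "tuple_shift i j"]\<close>)
  qed
  ultimately show ?case by blast
next
  case (mult F G)
  have "?C (\<lambda>y. F y * G y)" using mult by (intro continuous_on_mult) auto
  moreover have "?D i j (\<lambda>y. F y * G y)" "?E i j (\<lambda>y. F y * G y)" if i: "i < n" for i j
  proof -
    note IH = mult.IH(1)[THEN conjunct2, rule_format, OF i, of j] mult.IH(2)[THEN conjunct2, rule_format, OF i, of j]
    from conjunct2[OF IH(1)] conjunct2[OF IH(2)] obtain F' G' where FG: "F' \<in> tensor_algebra n h" "G' \<in> tensor_algebra n h"
      "\<forall>y\<in>PiE {..<n} W. partial (tuple_shift i j) F y = F' y"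
      "\<forall>y\<in>PiE {..<n} W. partial (tuple_shift i j) G y = G' y" by blast
    have "((\<lambda>t. F (tuple_shift i j t y) * G (tuple_shift i j t y)) has_vector_derivative F y * G' y + F' y * G y) (at 0)"
      if "y \<in> PiE {..<n} W" for y
      using has_vector_derivative_mult[OF has_vector_derivative_partial[of F "tuple_shift i j" y]
        has_vector_derivative_partial[of G "tuple_shift i j" y]] IH that FG(3,4)
      by simp
    note deriv = this
    show "?D i j (\<lambda>y. F y * G y)" using deriv by (blast intro: differentiableI_vector)
    show "?E i j (\<lambda>y. F y * G y)"
      by (rule bexI[OF _ tensor_algebra.add[OF tensor_algebra.mult[OF mult.hyps(1) FG(2)] tensor_algebra.mult[OF FG(1) mult.hyps(2)]]])
        (use vector_derivative_at[OF deriv] in \<open>simp add: partial_def[of "tuple_shift i j"]\<close>)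
  qed
  ultimately show ?case by blast
qed

text \<open>
  A partial derivative at a point of the box depends only on values inside the box, although the box
  need not be open in the product topology.
\<close>

lemma eventually_tuple_shift_in:
  assumes "\<And>i. i < n \<Longrightarrow> open (W i)" "i < n" "y \<in> PiE {..<n} W"
  shows "\<forall>\<^sub>F t in nhds 0. tuple_shift i j t y \<in> PiE {..<n} W"
proof -
  have "((\<lambda>t::real. y i + t *\<^sub>R axis j 1) \<longlongrightarrow> y i + 0 *\<^sub>R axis j 1) (nhds 0)"
    by (intro tendsto_intros filterlim_ident)
  hence "\<forall>\<^sub>F t in nhds 0. y i + t *\<^sub>R axis j 1 \<in> W i"
    using assms by (intro topological_tendstoD) auto
  thus ?thesis
    by eventually_elim (use assms(2,3) in \<open>auto simp: tuple_shift_def PiE_iff extensional_def\<close>)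
qed

lemma partials_tensor_algebra:
  assumes op: "\<And>i. i < n \<Longrightarrow> open (W i)"
    and h: "\<And>i. i < n \<Longrightarrow> smooth_on vec_shifts (W i) (h i)"
    and F: "F \<in> tensor_algebra n h" and \<tau>s: "\<tau>s \<in> lists (tuple_shifts n)"
  shows "\<exists>G\<in>tensor_algebra n h. \<forall>y\<in>PiE {..<n} W. partials \<tau>s F y = G y"
  using \<tau>s
proof (induction \<tau>s)
  case Nil thus ?case using F by auto
next
  case (Cons \<tau> \<tau>s)
  then obtain G where G: "G \<in> tensor_algebra n h" "\<forall>y\<in>PiE {..<n} W. partials \<tau>s F y = G y" by auto
  from Cons obtain i j where \<tau>: "\<tau> = tuple_shift i j" "i < n" by (auto simp: tuple_shifts_def)
  from tensor_algebra_partial[OF h G(1)] \<tau>(2) obtain G' where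
    G': "G' \<in> tensor_algebra n h" "\<forall>y\<in>PiE {..<n} W. partial (tuple_shift i j) G y = G' y" by blast
  have "partial \<tau> (partials \<tau>s F) y = partial \<tau> G y" if y: "y \<in> PiE {..<n} W" for y
    unfolding partial_def \<tau>
    by (rule vector_derivative_cong_eq)
      (use eventually_tuple_shift_in[OF op \<tau>(2) y, of j] G(2) in \<open>auto elim!: eventually_mono\<close>)
  with G' \<tau> show ?case by auto
qed

lemma smooth_on_tensor_algebra:
  fixes F :: "(nat \<Rightarrow> real ^ 'n::finite) \<Rightarrow> complex"
  assumes op: "\<And>i. i < n \<Longrightarrow> open (W i)"
    and h: "\<And>i. i < n \<Longrightarrow> smooth_on vec_shifts (W i) (h i)"
    and F: "F \<in> tensor_algebra n h"
  shows "smooth_on (tuple_shifts n) (PiE {..<n} W) F"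
  unfolding smooth_on_def
proof (intro ballI conjI)
  fix \<tau>s :: "(real \<Rightarrow> (nat \<Rightarrow> real ^ 'n) \<Rightarrow> (nat \<Rightarrow> real ^ 'n)) list"
  assume "\<tau>s \<in> lists (tuple_shifts n)"
  from partials_tensor_algebra[OF op h F this] obtain G where
    G: "G \<in> tensor_algebra n h" "\<forall>y\<in>PiE {..<n} W. partials \<tau>s F y = G y" by blast
  note G_smooth = tensor_algebra_partial[OF h G(1)]
  show "continuous_on (PiE {..<n} W) (partials \<tau>s F)"
    using G_smooth G(2) continuous_on_cong[of _ _ "partials \<tau>s F" G] by simp
  fix \<tau> :: "real \<Rightarrow> (nat \<Rightarrow> real ^ 'n) \<Rightarrow> (nat \<Rightarrow> real ^ 'n)" and y
  assume "\<tau> \<in> tuple_shifts n" and y: "y \<in> PiE {..<n} W"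
  then obtain i j where \<tau>: "\<tau> = tuple_shift i j" "i < n" by (auto simp: tuple_shifts_def)
  have "((\<lambda>t. G (\<tau> t y)) has_vector_derivative partial \<tau> G y) (at 0)"
    using G_smooth \<tau> y by (intro has_vector_derivative_partial) auto
  moreover have "\<forall>\<^sub>F t in nhds 0. tuple_shift i j t y \<in> PiE {..<n} W"
    by (rule eventually_tuple_shift_in[OF op \<tau>(2) y])
  hence "\<forall>\<^sub>F t in nhds 0. partials \<tau>s F (\<tau> t y) = G (\<tau> t y)"
    by eventually_elim (use G(2) \<tau>(1) in auto)
  ultimately have "((\<lambda>t. partials \<tau>s F (\<tau> t y)) has_vector_derivative partial \<tau> G y) (at 0)"
    using eventually_nhds_x_imp_x
    by (subst has_vector_derivative_cong_ev[where g = "\<lambda>t. G (\<tau> t y)"]) (auto elim!: eventually_mono)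
  thus "(\<lambda>t. partials \<tau>s F (\<tau> t y)) differentiable (at 0)"
    by (rule differentiableI_vector)
qed

text \<open>
  A coefficient of a product of power series is a polynomial in the coefficients of the factors, so
  properties stable under sums and products pass to it. It is used for smoothness, measurability and
  boundedness alike.
\<close>

lemma fps_prod_closed:
  fixes Pr :: "('c \<Rightarrow> complex) \<Rightarrow> bool" and v :: "nat \<Rightarrow> 'c \<Rightarrow> complex fps"
  assumes const: "\<And>c. Pr (\<lambda>_. c)"
    and add: "\<And>F G. Pr F \<Longrightarrow> Pr G \<Longrightarrow> Pr (\<lambda>x. F x + G x)"
    and mult: "\<And>F G. Pr F \<Longrightarrow> Pr G \<Longrightarrow> Pr (\<lambda>x. F x * G x)"
    and v: "\<And>i k. i < n \<Longrightarrow> Pr (\<lambda>x. fps_nth (v i x) k)"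
  shows "Pr (\<lambda>x. fps_nth (l * (\<Prod>i<n. v i x)) k)"
proof -
  have sum: "finite A \<Longrightarrow> (\<And>i. i \<in> A \<Longrightarrow> Pr (F i)) \<Longrightarrow> Pr (\<lambda>x. \<Sum>i\<in>A. F i x)" for A :: "nat set" and F
    by (induction A rule: finite_induct) (auto intro: const add)
  have prod: "Pr (\<lambda>x. fps_nth (\<Prod>i<m. v i x) k)" if "m \<le> n" for m k
    using that
  proof (induction m arbitrary: k)
    case 0
    show ?case by (cases k) (auto intro: const)
  next
    case (Suc m)
    thus ?case
      unfolding prod.lessThan_Suc fps_mult_nth by (intro sum mult v) auto
  qed
  show ?thesis
    unfolding fps_mult_nth by (intro sum mult prod const) auto
qed

section \<open>Exponential vectors as elements of the extended Fock space\<close>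

text \<open>
  The index of the variable that each position of \<open>repeat_entries ms x\<close> reads; it does not depend on \<open>x\<close>.
\<close>

definition entry_indices :: "nat list \<Rightarrow> nat list" where
  "entry_indices ms = concat (map (\<lambda>j. replicate (ms ! j) j) [0..<length ms])"

lemma length_entry_indices: "length (entry_indices ms) = sum_list ms"
proof -
  have "length (entry_indices ms) = sum_list (map (\<lambda>j. ms ! j) [0..<length ms])"
    by (simp add: entry_indices_def length_concat o_def)
  also have "map (\<lambda>j. ms ! j) [0..<length ms] = ms" by (rule map_nth)
  finally show ?thesis .
qed

lemma repeat_entries_eq:
  assumes "i < sum_list ms"
  shows "repeat_entries ms x i = x (entry_indices ms ! i)"
proof -
  have "concat (map (\<lambda>j. replicate (ms ! j) (x j)) [0..<length ms]) = map x (entry_indices ms)"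
    by (simp add: entry_indices_def map_concat o_def map_replicate)
  thus ?thesis using assms by (simp add: repeat_entries_def length_entry_indices)
qed

lemma set_entry_indices: "(\<And>m. m \<in> set ms \<Longrightarrow> 0 < m) \<Longrightarrow> set (entry_indices ms) = {..<length ms}"
  by (auto simp: entry_indices_def set_replicate_conv_if)

text \<open>
  Restricting a function of \<open>n\<close> variables to the diagonal of \<open>\<alpha>\<close> thus fills all \<open>n\<close> places, and each of the
  \<open>card \<alpha>\<close> remaining variables occurs in at least one of them.
\<close>

lemma loop_sizes:
  assumes "\<alpha> \<in> loop_collections n"
  shows "length (loop_sizes \<alpha>) = card \<alpha>" "sum_list (loop_sizes \<alpha>) = n"
    "m \<in> set (loop_sizes \<alpha>) \<Longrightarrow> 0 < m"
proof -
  have inj: "inj_on loop_points \<alpha>" and part: "partition_on {1..n} (loop_points ` \<alpha>)"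
    using assms by (auto simp: loop_collections_def)
  have "finite (loop_points ` \<alpha>)" using finite_elements[OF _ part] by simp
  hence fin: "finite \<alpha>" using inj by (rule finite_imageD)
  define \<kappa>s where "\<kappa>s = (SOME \<kappa>s. distinct \<kappa>s \<and> set \<kappa>s = \<alpha>)"
  have "\<exists>\<kappa>s. distinct \<kappa>s \<and> set \<kappa>s = \<alpha>" using finite_distinct_list[OF fin] by blast
  hence \<kappa>s: "distinct \<kappa>s" "set \<kappa>s = \<alpha>" unfolding \<kappa>s_def by (metis (mono_tags, lifting) someI_ex)+
  have ls: "loop_sizes \<alpha> = map (card \<circ> loop_points) \<kappa>s" by (simp add: loop_sizes_def \<kappa>s_def)
  show "length (loop_sizes \<alpha>) = card \<alpha>" using \<kappa>s by (simp add: ls distinct_card[symmetric])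
  have fin': "finite (loop_points \<kappa>)" if "\<kappa> \<in> \<alpha>" for \<kappa>
    using partition_onD1[OF part] that by (metis UN_upper finite_atLeastAtMost finite_subset)
  have "sum_list (loop_sizes \<alpha>) = (\<Sum>\<kappa>\<in>\<alpha>. card (loop_points \<kappa>))"
    using \<kappa>s by (simp add: ls sum_list_distinct_conv_sum_set)
  also have "\<dots> = sum card (loop_points ` \<alpha>)" using inj by (simp add: sum.reindex)
  also have "\<dots> = card (\<Union>(loop_points ` \<alpha>))"
    by (rule card_Union_disjoint[symmetric])
      (use partition_onD2[OF part] fin' in \<open>auto simp: disjoint_def pairwise_def disjnt_def\<close>)
  also have "\<dots> = n" by (simp add: partition_onD1[OF part, symmetric])
  finally show "sum_list (loop_sizes \<alpha>) = n" .
  show "0 < m" if m: "m \<in> set (loop_sizes \<alpha>)"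
  proof -
    from m obtain \<kappa> where \<kappa>: "\<kappa> \<in> \<alpha>" "m = card (loop_points \<kappa>)" by (auto simp: ls \<kappa>s)
    have "loop_points \<kappa> \<noteq> {}" using partition_onD3[OF part] \<kappa>(1) by force
    thus ?thesis using \<kappa> fin' by (simp add: card_gt_0_iff)
  qed
qed

lemma loop_collections_0: "loop_collections 0 = {{}}"
proof -
  have "\<alpha> = {}" if "partition_on {1..0::nat} (loop_points ` \<alpha>)" for \<alpha>
    using partition_onD1[OF that] partition_onD3[OF that] by force
  moreover have "partition_on {} {}" by (simp add: partition_on_empty)
  ultimately show ?thesis by (auto simp: loop_collections_def)
qed

lemma ext_inner_degree_0:
  "ext_inner \<sigma> 0 f h = cnj (f (\<lambda>_. undefined)) * h (\<lambda>_. undefined)"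
proof -
  have "(SOME \<kappa>s. distinct \<kappa>s \<and> set \<kappa>s = {}) = ([] :: nat list set list)"
    by (rule some_equality) auto
  hence "loop_sizes {} = []" by (simp add: loop_sizes_def)
  hence "repeat_entries (loop_sizes {}) x = (\<lambda>_. undefined)" for x :: "nat \<Rightarrow> 'a"
    by (simp add: repeat_entries_def restrict_def)
  thus ?thesis
    by (simp add: ext_inner_def loop_collections_0 on_diagonal_def power_measure_def
        PiM_empty lebesgue_integral_count_space_finite)
qed

lemma ext_inner_zero_left: "ext_inner \<sigma> n (\<lambda>_. 0) h = 0"
  by (simp add: ext_inner_def on_diagonal_def)

lemma ext_norm_zero: "ext_norm \<sigma> n (\<lambda>_. 0) = 0"
  by (simp add: ext_norm_def ext_inner_zero_left)

text \<open>
  The vacuum has degree \<open>0\<close>, and the power of \<open>X\<close> with exponent \<open>0\<close> is a single point of mass \<open>1\<close>.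
\<close>

lemma fock_inner_vacuum:
  fixes \<sigma> :: "'a measure"
  shows "fock_inner \<sigma> vacuum F = F 0 (\<lambda>_. undefined)"
proof -
  have "(vacuum :: 'a fock) n = (\<lambda>_. 0)" if "n \<noteq> 0" for n using that by (auto simp: vacuum_def)
  hence "fock_inner \<sigma> vacuum F = (\<Sum>n\<in>{0}. ext_inner \<sigma> n (vacuum n) (F n) * fact n)"
    unfolding fock_inner_def by (intro suminf_finite) (auto simp: ext_inner_zero_left)
  thus ?thesis by (simp add: ext_inner_degree_0 vacuum_def)
qed

lemma fps_prod_nth_eq_0:
  assumes "\<And>i. i < n \<Longrightarrow> fps_nth (v i) 0 = 0" "k < n"
  shows "fps_nth (l * (\<Prod>i<n. v i :: complex fps)) k = 0"
proof -
  have *: "fps_nth (\<Prod>i<m. v i) j = 0" if "m \<le> n" "j < m" for m j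
    using that
  proof (induction m arbitrary: j)
    case (Suc m)
    have "fps_nth (\<Prod>i<m. v i) i * fps_nth (v m) (j - i) = 0" if "i \<le> j" for i
      using Suc that assms(1)[of m] by (cases "i < m") (auto simp: not_less)
    thus ?case unfolding prod.lessThan_Suc fps_mult_nth by (intro sum.neutral) simp
  qed simp
  show ?thesis unfolding fps_mult_nth using * assms(2) by (intro sum.neutral) simp
qed

lemma exp_vector_eq_0:
  fixes \<phi> :: "'a \<Rightarrow> real"
  assumes "fps_nth f 0 = 0" "k < n"
  shows "exp_vector f l \<phi> k n = (\<lambda>_. 0)"
proof
  fix x
  have "fps_nth (l * (\<Prod>i<n. dilate f (\<phi> (x i)))) k = 0"
    by (rule fps_prod_nth_eq_0) (use assms in \<open>simp_all add: dilate_nth\<close>)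
  thus "exp_vector f l \<phi> k n x = 0" by (simp add: exp_vector_def)
qed

lemma exp_vector_support:
  assumes "fps_nth f 0 = 0" "exp_vector f l \<phi> k n x \<noteq> 0" "i < n"
  shows "\<phi> (x i) \<noteq> 0"
proof
  assume "\<phi> (x i) = 0"
  hence "dilate f (\<phi> (x i)) = 0"
    using assms(1) by (auto simp: fps_eq_iff dilate_nth power_0_left)
  hence "(\<Prod>i<n. dilate f (\<phi> (x i))) = 0" using assms(3) by (auto simp: prod_zero_iff)
  with assms(2) show False by (simp add: exp_vector_def)
qed

text \<open>
  As a subset of the full function space, the box is a product over all indices, with one-point factors
  at the indices from \<open>n\<close> on.
\<close>

lemma compact_closed_PiE:
  fixes K :: "'a::t2_space set"
  assumes "compact K"
  shows "compact ({..<n::nat} \<rightarrow>\<^sub>E K)" and "closed ({..<n} \<rightarrow>\<^sub>E K)"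
proof -
  have eq: "{..<n} \<rightarrow>\<^sub>E K = PiE UNIV (\<lambda>i. if i < n then K else {undefined})"
  proof (rule set_eqI)
    fix x :: "nat \<Rightarrow> 'a"
    have "x \<in> {..<n} \<rightarrow>\<^sub>E K \<longleftrightarrow> (\<forall>i. (i < n \<longrightarrow> x i \<in> K) \<and> (\<not> i < n \<longrightarrow> x i = undefined))"
      unfolding PiE_iff extensional_def by blast
    also have "\<dots> \<longleftrightarrow> (\<forall>i. x i \<in> (if i < n then K else {undefined}))"
      by (intro all_cong1) simp
    finally show "x \<in> {..<n} \<rightarrow>\<^sub>E K \<longleftrightarrow> x \<in> PiE UNIV (\<lambda>i. if i < n then K else {undefined})"
      by (simp only: PiE_UNIV_domain Pi_iff ball_UNIV)
  qed
  have "compactin (product_topology (\<lambda>_. euclidean) UNIV) (PiE UNIV (\<lambda>i. if i < n then K else {undefined}))"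
    unfolding compactin_PiE using assms by (intro disjI2 ballI) simp
  thus "compact ({..<n} \<rightarrow>\<^sub>E K)" unfolding eq by (simp add: euclidean_product_topology)
  have "closedin (product_topology (\<lambda>_. euclidean) UNIV) (PiE UNIV (\<lambda>i. if i < n then K else {undefined}))"
    unfolding closedin_product_topology using compact_imp_closed[OF assms] by (intro disjI2 ballI) simp
  thus "closed ({..<n} \<rightarrow>\<^sub>E K)" unfolding eq by (simp add: euclidean_product_topology)
qed

context noise_setting
begin

lemma space_sigma: "space \<sigma> = UNIV" and sets_sigma [measurable_cong]: "sets \<sigma> = sets borel"
proof -
  show "sets \<sigma> = sets borel" using radon by (simp add: radon_measure_def)
  from sets_eq_imp_space_eq[OF this] show "space \<sigma> = UNIV" by simp
qed

lemma chart_inv_left: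
  assumes "k \<in> atlas" "x \<in> fst k"
  shows "chart_inv k (snd k x) = x" "snd k x \<in> chart_image k"
  using chart_homeomorphism[OF assms(1)] assms(2) by (auto simp: chart_inv_def chart_image_def)

lemma continuous_test_function:
  assumes "\<phi> \<in> test_functions atlas"
  shows "continuous_on UNIV \<phi>"
proof -
  have "continuous_on (\<Union>k\<in>atlas. fst k) \<phi>"
  proof (rule continuous_on_open_UN)
    fix k assume k: "k \<in> atlas"
    show "open (fst k)" using chart_open[OF k] by simp
    have "smooth_on vec_shifts (chart_image k) (\<phi> \<circ> chart_inv k)"
      using assms k by (auto simp: test_functions_def)
    hence "continuous_on (chart_image k) (\<phi> \<circ> chart_inv k)"
      unfolding smooth_on_def by (metis lists.Nil partials.simps(1))
    moreover have "continuous_on (fst k) (snd k)"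
      using chart_homeomorphism[OF k] by (auto simp: homeomorphism_def)
    ultimately have "continuous_on (fst k) (\<lambda>x. (\<phi> \<circ> chart_inv k) (snd k x))"
      by (rule continuous_on_compose2) (use chart_inv_left[OF k] in auto)
    thus "continuous_on (fst k) \<phi>"
      using chart_inv_left[OF k] by (simp cong: continuous_on_cong_simp)
  qed
  thus ?thesis by (simp add: charts_cover)
qed

text \<open>
  Every point of a manifold has a neighbourhood inside a compact set, of finite measure for a Radon
  measure, and by the Lindelof property countably many of them suffice.
\<close>

lemma sigma_finite: "sigma_finite_measure \<sigma>"
proof
  define \<F> where "\<F> = {V :: 'a set. open V \<and> emeasure \<sigma> V < \<infinity>}"
  have cover: "\<exists>V\<in>\<F>. x \<in> V" for x
  proof -
    obtain k where k: "k \<in> atlas" "x \<in> fst k" using charts_cover by blast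
    have hom: "homeomorphism (fst k) (chart_image k) (snd k) (chart_inv k)"
      using chart_homeomorphism[OF k(1)] by simp
    obtain e where e: "e > 0" "cball (snd k x) e \<subseteq> chart_image k"
      using chart_open[OF k(1)] chart_inv_left(2)[OF k] open_contains_cball by blast
    define K where "K = chart_inv k ` cball (snd k x) e"
    define V where "V = fst k \<inter> snd k -` ball (snd k x) e"
    have "compact K" unfolding K_def
      using hom e by (intro compact_continuous_image) (auto simp: homeomorphism_def intro: continuous_on_subset)
    hence K: "emeasure \<sigma> K < \<infinity>" "K \<in> sets \<sigma>"
      using radon by (auto simp: radon_measure_def intro: borel_compact)
    have "V \<subseteq> K"
    proof
      fix y assume y: "y \<in> V"
      hence "y = chart_inv k (snd k y)" using chart_inv_left[OF k(1)] by (simp add: V_def)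
      thus "y \<in> K" using y by (auto simp: K_def V_def intro!: image_eqI[of _ _ "snd k y"])
    qed
    hence "emeasure \<sigma> V \<le> emeasure \<sigma> K" using K by (intro emeasure_mono)
    moreover have "open V" unfolding V_def
      using hom chart_open[OF k(1)] by (intro continuous_open_preimage) (auto simp: homeomorphism_def)
    ultimately have "V \<in> \<F>" using K by (auto simp: \<F>_def)
    moreover have "x \<in> V" using k e by (simp add: V_def)
    ultimately show ?thesis by blast
  qed
  obtain \<F>' where \<F>': "\<F>' \<subseteq> \<F>" "countable \<F>'" "\<Union>\<F>' = \<Union>\<F>"
    by (rule Lindelof[of \<F>]) (simp add: \<F>_def)
  have "\<Union>\<F> = UNIV" using cover by blast
  moreover have "V \<in> sets \<sigma>" "emeasure \<sigma> V \<noteq> \<infinity>" if "V \<in> \<F>'" for V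
    using that \<F>'(1) by (auto simp: \<F>_def sets_sigma)
  ultimately show "\<exists>A. countable A \<and> A \<subseteq> sets \<sigma> \<and> \<Union>A = space \<sigma> \<and> (\<forall>a\<in>A. emeasure \<sigma> a \<noteq> \<infinity>)"
    using \<F>' unfolding space_sigma by (intro exI[of _ \<F>']) (simp add: subset_iff)
qed

context
  fixes \<phi> :: "'a \<Rightarrow> real"
  assumes \<phi>: "\<phi> \<in> test_functions atlas"
begin

lemma measurable_test_function [measurable]: "\<phi> \<in> borel_measurable \<sigma>"
  using borel_measurable_continuous_onI[OF continuous_test_function[OF \<phi>]]
  by (simp cong: measurable_cong_sets[OF sets_sigma])

lemma test_function_support:
  obtains K where "compact K" "K \<in> sets \<sigma>" "emeasure \<sigma> K < \<infinity>" "\<And>x. x \<notin> K \<Longrightarrow> \<phi> x = 0"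
proof
  let ?K = "closure {x. \<phi> x \<noteq> 0}"
  show "compact ?K" using \<phi> by (simp add: test_functions_def)
  thus "emeasure \<sigma> ?K < \<infinity>" "?K \<in> sets \<sigma>"
    using radon by (auto simp: radon_measure_def)
  show "\<phi> x = 0" if "x \<notin> ?K" for x using that closure_subset[of "{x. \<phi> x \<noteq> 0}"] by auto
qed

lemma test_function_bounded: obtains B where "0 \<le> B" "\<And>x. \<bar>\<phi> x\<bar> \<le> B"
proof -
  obtain K where K: "compact K" "K \<in> sets \<sigma>" "emeasure \<sigma> K < \<infinity>" "\<And>x. x \<notin> K \<Longrightarrow> \<phi> x = 0" by (rule test_function_support) blast
  have "compact (\<phi> ` K)"
    using continuous_on_subset[OF continuous_test_function[OF \<phi>]] K(1) by (intro compact_continuous_image) auto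
  then obtain B where "\<forall>y\<in>\<phi> ` K. norm y \<le> B" using compact_imp_bounded bounded_iff by metis
  hence "\<bar>\<phi> x\<bar> \<le> \<bar>B\<bar>" for x using K(4)[of x] by (cases "x \<in> K") force+
  thus ?thesis using that[of "\<bar>B\<bar>"] by simp
qed

lemma integrable_power_test_function: "integrable \<sigma> (\<lambda>y. \<phi> y ^ Suc j)"
proof -
  obtain K where K: "compact K" "K \<in> sets \<sigma>" "emeasure \<sigma> K < \<infinity>" "\<And>x. x \<notin> K \<Longrightarrow> \<phi> x = 0" by (rule test_function_support) blast
  obtain B where B: "\<And>x. \<bar>\<phi> x\<bar> \<le> B" by (rule test_function_bounded) blast
  show ?thesis
  proof (rule integrableI_bounded_set[OF K(2) _ K(3), of _ "B ^ Suc j"])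
    show "AE y in \<sigma>. y \<in> K \<longrightarrow> norm (\<phi> y ^ Suc j) \<le> B ^ Suc j"
      using B by (auto simp del: power_Suc simp: power_abs intro!: AE_I2 power_mono)
    show "AE y in \<sigma>. y \<notin> K \<longrightarrow> \<phi> y ^ Suc j = 0" using K(4) by auto
  qed measurable
qed

text \<open>
  The tuple \<open>r x\<close> stands for the different ways of feeding points into the vector: directly, through
  charts, or repeated along a diagonal.
\<close>

lemma exp_vector_closed:
  assumes "\<And>c. Pr (\<lambda>_. c)"
    and "\<And>F G. Pr F \<Longrightarrow> Pr G \<Longrightarrow> Pr (\<lambda>x. F x + G x)"
    and mult: "\<And>F G. Pr F \<Longrightarrow> Pr G \<Longrightarrow> Pr (\<lambda>x. F x * G x)"
    and r: "\<And>i. i < n \<Longrightarrow> Pr (\<lambda>x. complex_of_real (\<phi> (r x i)))"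
  shows "Pr (\<lambda>x. exp_vector f l \<phi> k n (r x))"
proof -
  have "Pr (\<lambda>x. complex_of_real (\<phi> (r x i)) ^ j)" if "i < n" for i j
  proof (induction j)
    case 0 show ?case unfolding power_0 by (rule assms(1))
  next
    case (Suc j) show ?case unfolding power_Suc by (rule mult[OF r[OF that] Suc.IH])
  qed
  hence "Pr (\<lambda>x. fps_nth (l * (\<Prod>i<n. dilate f (\<phi> (r x i)))) k)"
    by (intro fps_prod_closed[of Pr] assms(1-3)) (auto simp: dilate_nth intro!: assms(1) mult)
  from mult[OF this assms(1)[of "1 / fact n"]]
  show ?thesis by (simp add: exp_vector_def)
qed

lemma exp_vector_sym_test_functions:
  assumes "fps_nth f 0 = 0"
  shows "exp_vector f l \<phi> k n \<in> sym_test_functions atlas n"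
  unfolding sym_test_functions_def
proof (intro CollectI conjI allI impI)
  fix ks :: "nat \<Rightarrow> ('a, 'n) chart" assume ks: "\<forall>i<n. ks i \<in> atlas"
  let ?h = "\<lambda>i. \<phi> \<circ> chart_inv (ks i)"
  show "smooth_on (tuple_shifts n) (PiE {..<n} (\<lambda>i. chart_image (ks i)))
    (\<lambda>y. exp_vector f l \<phi> k n (\<lambda>i\<in>{..<n}. chart_inv (ks i) (y i)))"
  proof (rule smooth_on_tensor_algebra)
    show "open (chart_image (ks i))" "smooth_on vec_shifts (chart_image (ks i)) (?h i)" if "i < n" for i
      using that ks chart_open \<phi> by (auto simp: test_functions_def)
    show "(\<lambda>y. exp_vector f l \<phi> k n (\<lambda>i\<in>{..<n}. chart_inv (ks i) (y i))) \<in> tensor_algebra n ?h"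
    proof (rule exp_vector_closed[where Pr = "\<lambda>F. F \<in> tensor_algebra n ?h"])
      fix i assume i: "i < n"
      have "(\<lambda>y. complex_of_real (partials [] (?h i) (y i))) \<in> tensor_algebra n ?h"
        using i by (rule tensor_algebra.gen) simp
      thus "(\<lambda>y. complex_of_real (\<phi> ((\<lambda>i\<in>{..<n}. chart_inv (ks i) (y i)) i))) \<in> tensor_algebra n ?h"
        using i by simp
    qed (auto intro: tensor_algebra.intros)
  qed
next
  obtain K where K: "compact K" "K \<in> sets \<sigma>" "emeasure \<sigma> K < \<infinity>" "\<And>x. x \<notin> K \<Longrightarrow> \<phi> x = 0" by (rule test_function_support) blast
  let ?S = "{x \<in> {..<n} \<rightarrow>\<^sub>E UNIV. exp_vector f l \<phi> k n x \<noteq> 0}"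
  have "?S \<subseteq> {..<n} \<rightarrow>\<^sub>E K"
  proof
    fix x assume x: "x \<in> ?S"
    hence "x i \<in> K" if "i < n" for i
      using exp_vector_support[OF assms _ that, of l \<phi> k x] K(4)[of "x i"] by blast
    thus "x \<in> {..<n} \<rightarrow>\<^sub>E K" using x by (simp add: PiE_iff)
  qed
  hence "closure ?S \<subseteq> {..<n} \<rightarrow>\<^sub>E K"
    by (rule closure_minimal[OF _ compact_closed_PiE(2)[OF K(1)]])
  thus "compact (closure ?S)"
    using compact_closed_PiE(1)[OF K(1), of n] compact_Int_closed[of "{..<n} \<rightarrow>\<^sub>E K" "closure ?S"]
    by (simp add: Int_absorb1)
next
  show "symmetric_fun n (exp_vector f l \<phi> k n)"
    unfolding symmetric_fun_def
  proof (intro ballI allI impI)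
    fix x :: "nat \<Rightarrow> 'a" and \<pi> :: "nat \<Rightarrow> nat" assume "\<pi> permutes {..<n}"
    from prod.permute[OF this, of "\<lambda>i. dilate f (\<phi> (x i))"]
    show "exp_vector f l \<phi> k n (x \<circ> \<pi>) = exp_vector f l \<phi> k n x"
      by (simp add: exp_vector_def o_def)
  qed
qed

lemma exp_vector_bounded: "\<exists>C. \<forall>x. cmod (exp_vector f l \<phi> k n x) \<le> C"
proof (rule exp_vector_closed[where r = "\<lambda>x. x" and Pr = "\<lambda>F. \<exists>C. \<forall>x. cmod (F x) \<le> C"])
  show "\<exists>C. \<forall>x. cmod (complex_of_real (\<phi> (x i))) \<le> C" for i
    by (rule test_function_bounded) auto
  fix F G :: "(nat \<Rightarrow> 'a) \<Rightarrow> complex"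
  assume "\<exists>C. \<forall>x. cmod (F x) \<le> C" "\<exists>C. \<forall>x. cmod (G x) \<le> C"
  then obtain C D where CD: "\<And>x. cmod (F x) \<le> C" "\<And>x. cmod (G x) \<le> D" by blast
  show "\<exists>C. \<forall>x. cmod (F x + G x) \<le> C"
    using norm_triangle_mono[OF CD(1) CD(2)] by blast
  have "cmod (F x * G x) \<le> C * D" for x
    using mult_mono[OF CD(1) CD(2), of x x] order.trans[OF norm_ge_zero CD(1)] by (simp add: norm_mult)
  thus "\<exists>C. \<forall>x. cmod (F x * G x) \<le> C" by blast
qed auto

text \<open>
  On every diagonal, a coefficient is bounded, and it vanishes unless all variables lie in the support
  of \<open>\<phi>\<close>, which has finite measure.
\<close>

lemma exp_vector_ext_space:
  assumes f: "fps_nth f 0 = 0"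
  shows "exp_vector f l \<phi> k n \<in> ext_space_n atlas \<sigma> n"
  unfolding ext_space_n_def
proof (intro CollectI conjI ballI allI impI)
  show "exp_vector f l \<phi> k n \<in> borel_measurable (power_measure \<sigma> n)"
    unfolding power_measure_def
    by (rule exp_vector_closed[where r = "\<lambda>x. x"]) (measurable; simp)+
next
  fix \<epsilon> :: real assume "\<epsilon> > 0"
  thus "\<exists>h\<in>sym_test_functions atlas n. ext_norm \<sigma> n (\<lambda>x. exp_vector f l \<phi> k n x - h x) < \<epsilon>"
    using exp_vector_sym_test_functions[OF f] by (intro bexI[of _ "exp_vector f l \<phi> k n"]) (simp_all add: ext_norm_zero)
next
  fix \<alpha> assume \<alpha>: "\<alpha> \<in> loop_collections n"
  let ?m = "card \<alpha>" and ?ms = "loop_sizes \<alpha>"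
  note ls = loop_sizes[OF \<alpha>]
  let ?G = "on_diagonal \<alpha> (exp_vector f l \<phi> k n)"
  have idx: "set (entry_indices ?ms) = {..<?m}" using set_entry_indices[of ?ms] ls by auto
  have nth: "entry_indices ?ms ! i < ?m" if "i < n" for i
    using nth_mem[of i "entry_indices ?ms"] that idx ls by (auto simp: length_entry_indices)
  have meas: "?G \<in> borel_measurable (power_measure \<sigma> ?m)"
    unfolding power_measure_def on_diagonal_def
  proof (rule exp_vector_closed[where r = "repeat_entries ?ms"])
    fix i assume i: "i < n"
    have [measurable]: "entry_indices ?ms ! i \<in> {..<?m}" using nth[OF i] by simp
    have "(\<lambda>x. complex_of_real (\<phi> (x (entry_indices ?ms ! i)))) \<in> borel_measurable (PiM {..<?m} (\<lambda>_. \<sigma>))"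
      by measurable
    thus "(\<lambda>x. complex_of_real (\<phi> (repeat_entries ?ms x i))) \<in> borel_measurable (PiM {..<?m} (\<lambda>_. \<sigma>))"
      using i ls by (simp add: repeat_entries_eq)
  qed auto
  obtain K where K: "compact K" "K \<in> sets \<sigma>" "emeasure \<sigma> K < \<infinity>" "\<And>x. x \<notin> K \<Longrightarrow> \<phi> x = 0" by (rule test_function_support) blast
  obtain C where C: "\<And>x. cmod (exp_vector f l \<phi> k n x) \<le> C" using exp_vector_bounded by blast
  interpret sigma_finite_measure \<sigma> by (rule sigma_finite)
  interpret product_sigma_finite "\<lambda>_::nat. \<sigma>" by standard
  have supp: "?G x = 0" if x: "x \<in> {..<?m} \<rightarrow>\<^sub>E UNIV" "x \<notin> {..<?m} \<rightarrow>\<^sub>E K" for x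
  proof (rule ccontr)
    assume G: "?G x \<noteq> 0"
    from x obtain j where j: "j < ?m" "x j \<notin> K" by (auto simp: PiE_iff)
    from j idx obtain i where i: "i < n" "entry_indices ?ms ! i = j"
      using ls by (metis in_set_conv_nth length_entry_indices lessThan_iff)
    from exp_vector_support[OF f G[unfolded on_diagonal_def] i(1)]
    have "\<phi> (x j) \<noteq> 0" using i ls by (simp add: repeat_entries_eq)
    thus False using K(4) j by blast
  qed
  have "integrable (power_measure \<sigma> ?m) (\<lambda>x. (cmod (?G x))\<^sup>2)"
  proof (rule integrableI_bounded_set[of "{..<?m} \<rightarrow>\<^sub>E K" _ _ "C\<^sup>2"])
    show "{..<?m} \<rightarrow>\<^sub>E K \<in> sets (power_measure \<sigma> ?m)"
      unfolding power_measure_def using K by (intro sets_PiM_I_finite) auto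
    show "emeasure (power_measure \<sigma> ?m) ({..<?m} \<rightarrow>\<^sub>E K) < \<infinity>"
      unfolding power_measure_def using K by (subst emeasure_PiM) (auto simp: power_less_top_ennreal)
    show "AE x in power_measure \<sigma> ?m. x \<in> {..<?m} \<rightarrow>\<^sub>E K \<longrightarrow> norm ((cmod (?G x))\<^sup>2) \<le> C\<^sup>2"
      using C by (auto simp: on_diagonal_def intro!: AE_I2 power_mono)
    show "AE x in power_measure \<sigma> ?m. x \<notin> {..<?m} \<rightarrow>\<^sub>E K \<longrightarrow> (cmod (?G x))\<^sup>2 = 0"
      using supp by (intro AE_I2) (auto simp: power_measure_def space_PiM space_sigma)
    show "(\<lambda>x. (cmod (?G x))\<^sup>2) \<in> borel_measurable (power_measure \<sigma> ?m)"
      using meas by measurable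
  qed
  with meas show "?G \<in> square_integrable (power_measure \<sigma> ?m)"
    by (simp add: square_integrable_def)
qed

lemma exp_vector_ext_fock:
  assumes "fps_nth f 0 = 0"
  shows "exp_vector f l \<phi> k \<in> ext_fock atlas \<sigma>"
  unfolding ext_fock_def
proof (intro CollectI conjI allI exp_vector_ext_space[OF assms])
  show "summable (\<lambda>n. (ext_norm \<sigma> n (exp_vector f l \<phi> k n))\<^sup>2 * fact n)"
    by (rule summable_finite[of "{..k}"]) (auto simp: exp_vector_eq_0[OF assms] ext_norm_zero)
qed

lemma exp_vector_fock_fin:
  assumes "fps_nth f 0 = 0"
  shows "exp_vector f l \<phi> k \<in> fock_fin atlas"
  unfolding fock_fin_def
proof (intro CollectI conjI allI exI[of _ k] impI ballI)
  fix n x assume "k < n"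
  thus "exp_vector f l \<phi> k n x = 0" by (simp add: exp_vector_eq_0[OF assms])
qed (rule exp_vector_sym_test_functions[OF assms])

end
end

section \<open>The distribution of a single pairing\<close>

context noise_setting
begin

context
  fixes \<phi> :: "'a \<Rightarrow> real" and lam :: real and f l :: "complex fps"
    and \<mu> :: "(('a \<Rightarrow> real) \<Rightarrow> real) measure" and I :: "'a fock \<Rightarrow> (('a \<Rightarrow> real) \<Rightarrow> real) \<Rightarrow> complex"
  assumes \<phi>: "\<phi> \<in> test_functions atlas"
    and spectral: "spectral_pair atlas \<sigma> lam \<mu> I"
    and f0: "fps_nth f 0 = 0"
    and f: "fps_deriv f = 1 + fps_const (of_real lam) * f + f\<^sup>2"
    and l0: "fps_nth l 0 = 1"
    and l: "fps_deriv l = l * (Abs_fps (\<lambda>j. fps_nth f j * of_real (LINT y|\<sigma>. \<phi> y ^ Suc j)) +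
              fps_const (of_real (c_coeff lam * (LINT y|\<sigma>. \<phi> y))))"
begin

lemma measurable_evaluation: "(\<lambda>\<omega>. \<omega> \<phi>) \<in> borel_measurable \<mu>"
proof (rule measurableI)
  have space: "space \<mu> = dual_space atlas" and sets: "sets \<mu> = sets (cylinder_algebra atlas)"
    using spectral by (auto simp: spectral_pair_def)
  fix B :: "real set" assume B: "B \<in> sets borel"
  let ?C = "{{\<omega> \<in> dual_space atlas. (\<lambda>i\<in>{..<m::nat}. \<omega> (\<phi> i)) \<in> B} |m \<phi> B.
        (\<forall>i<m. \<phi> i \<in> test_functions atlas) \<and> B \<in> sets (PiM {..<m} (\<lambda>_. borel :: real measure))}"
  have sets_eq: "sets \<mu> = sigma_sets (dual_space atlas) ?C"
    unfolding sets cylinder_algebra_def by (rule sets_measure_of) auto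
  \<comment> \<open>The preimage of \<open>B\<close> is a cylinder set over the single test function \<open>\<phi>\<close>.\<close>
  let ?B = "{h \<in> space (PiM {..<1::nat} (\<lambda>_. borel :: real measure)). h 0 \<in> B}"
  have "?B \<in> sets (PiM {..<1::nat} (\<lambda>_. borel :: real measure))" using B by measurable
  hence "{\<omega> \<in> dual_space atlas. (\<lambda>i\<in>{..<1::nat}. \<omega> \<phi>) \<in> ?B} \<in> ?C"
    using \<phi> by (intro CollectI exI[of _ 1] exI[of _ "\<lambda>_. \<phi>"] exI[of _ ?B]) auto
  moreover have "{\<omega> \<in> dual_space atlas. (\<lambda>i\<in>{..<1::nat}. \<omega> \<phi>) \<in> ?B} = (\<lambda>\<omega>. \<omega> \<phi>) -` B \<inter> space \<mu>"
    by (auto simp: space space_PiM)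
  ultimately have "(\<lambda>\<omega>. \<omega> \<phi>) -` B \<inter> space \<mu> \<in> ?C" by (simp only:)
  thus "(\<lambda>\<omega>. \<omega> \<phi>) -` B \<inter> space \<mu> \<in> sets \<mu>"
    unfolding sets_eq by (rule sigma_sets.Basic)
qed simp

text \<open>
  The recursion \<open>J c\<^sub>k = (k + 1) c\<^bsub>k+1\<^esub>\<close> of the coefficients becomes, under \<open>I\<close>, the recursion satisfied by
  \<open>(\<omega> \<phi>)\<^sup>k / k!\<close>.
\<close>

lemma exp_vector_spectral_image:
  "AE \<omega> in \<mu>. I (exp_vector f l \<phi> k) \<omega> = of_real (\<omega> \<phi> ^ k) / fact k"
proof (induction k)
  case 0
  show ?case using spectral by (simp add: exp_vector_0[OF f0 l0] spectral_pair_def)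
next
  case (Suc k)
  let ?F = "exp_vector f l \<phi>" and ?c = "of_nat (Suc k) :: complex"
  let ?J = "\<lambda>n x. ?c * ?F (Suc k) n x"
  have in_fock: "?F j \<in> ext_fock atlas \<sigma>" for j by (rule exp_vector_ext_fock[OF \<phi> f0])
  \<comment> \<open>A multiple of an exponential vector is one with a rescaled \<open>l\<close>, and so belongs to the Fock space.\<close>
  have "?J = exp_vector f (fps_const ?c * l) \<phi> (Suc k)"
    by (intro ext) (simp add: exp_vector_def mult.assoc)
  hence J_ext: "?J \<in> ext_fock atlas \<sigma>" using exp_vector_ext_fock[OF \<phi> f0] by simp
  have "jacobi_op \<sigma> lam \<phi> (?F k) = ?J"
    by (rule jacobi_op_exp_vector[OF integrable_power_test_function[OF \<phi>] f l])
  hence "(?F k, ?J) \<in> jacobi_closure atlas \<sigma> lam \<phi>"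
    unfolding jacobi_closure_def using in_fock J_ext exp_vector_fock_fin[OF \<phi> f0]
    by (auto intro!: exI[of _ "\<lambda>_. ?F k"] simp: fock_norm_def ext_norm_zero)
  hence "AE \<omega> in \<mu>. I ?J \<omega> = of_real (\<omega> \<phi>) * I (?F k) \<omega>"
    using spectral \<phi> in_fock J_ext unfolding spectral_pair_def by blast
  moreover have "AE \<omega> in \<mu>. I (\<lambda>n x. ?c * ?F (Suc k) n x + 0 * ?F k n x) \<omega> = ?c * I (?F (Suc k)) \<omega> + 0 * I (?F k) \<omega>"
    using spectral in_fock unfolding spectral_pair_def fock_unitary_def by blast
  ultimately show ?case using Suc.IH
  proof eventually_elim
    case (elim \<omega>)
    hence "?c * I (?F (Suc k)) \<omega> = of_real (\<omega> \<phi>) * (of_real (\<omega> \<phi> ^ k) / fact k)" by simp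
    thus ?case by (simp add: field_simps del: of_nat_Suc)
  qed
qed

text \<open>
  Unitarity supplies integrability of even powers, because \<open>(\<omega> \<phi>)\<^sup>k\<close> is square integrable, and reduces the
  moment to the inner product of a coefficient with the vacuum, i.e. to its component of degree \<open>0\<close>.
\<close>

lemma evaluation_moments:
  shows "integrable \<mu> (\<lambda>\<omega>. \<omega> \<phi> ^ (2 * k))"
    and "complex_of_real (LINT \<omega>|\<mu>. \<omega> \<phi> ^ k) = fact k * fps_nth l k"
proof -
  note [measurable] = measurable_evaluation
  have unitary: "fock_unitary atlas \<sigma> \<mu> I" and vac: "AE \<omega> in \<mu>. I vacuum \<omega> = 1"
    using spectral by (auto simp: spectral_pair_def)
  let ?F = "exp_vector f l \<phi>"
  have in_fock: "?F j \<in> ext_fock atlas \<sigma>" for j by (rule exp_vector_ext_fock[OF \<phi> f0])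
  have sq: "I (?F k) \<in> square_integrable \<mu>" using unitary in_fock by (auto simp: fock_unitary_def)
  hence [measurable]: "I (?F k) \<in> borel_measurable \<mu>" by (simp add: square_integrable_def)
  have "integrable \<mu> (\<lambda>\<omega>. (fact k)\<^sup>2 * (cmod (I (?F k) \<omega>))\<^sup>2)"
    using sq by (intro integrable_mult_right) (simp add: square_integrable_def)
  thus "integrable \<mu> (\<lambda>\<omega>. \<omega> \<phi> ^ (2 * k))"
  proof (rule integrable_cong_AE_imp)
    show "AE \<omega> in \<mu>. (fact k)\<^sup>2 * (cmod (I (?F k) \<omega>))\<^sup>2 = \<omega> \<phi> ^ (2 * k)"
      using exp_vector_spectral_image[of k]
      by eventually_elim (simp add: norm_divide norm_power power_divide power_mult[symmetric] mult.commute power_even_abs)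
  qed measurable
  have [measurable]: "I vacuum \<in> borel_measurable \<mu>"
    using unitary in_fock[of 0] by (auto simp: fock_unitary_def square_integrable_def exp_vector_0[OF f0 l0])
  have [measurable]: "(\<lambda>\<omega>. cnj (I vacuum \<omega>)) \<in> borel_measurable \<mu>"
    by (rule measurable_compose[OF _ borel_measurable_continuous_onI]) (auto intro!: continuous_intros)
  have "(LINT \<omega>|\<mu>. cnj (I vacuum \<omega>) * I (?F k) \<omega>) = fock_inner \<sigma> vacuum (?F k)"
    using unitary in_fock[of 0] in_fock[of k] by (auto simp: fock_unitary_def exp_vector_0[OF f0 l0])
  also have "\<dots> = fps_nth l k" by (simp add: fock_inner_vacuum exp_vector_def)
  also have "(LINT \<omega>|\<mu>. cnj (I vacuum \<omega>) * I (?F k) \<omega>) = (LINT \<omega>|\<mu>. of_real (\<omega> \<phi> ^ k) / fact k)"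
  proof (rule integral_cong_AE)
    show "AE \<omega> in \<mu>. cnj (I vacuum \<omega>) * I (?F k) \<omega> = of_real (\<omega> \<phi> ^ k) / fact k"
      using vac exp_vector_spectral_image[of k] by eventually_elim simp
  qed measurable
  also have "\<dots> = complex_of_real (LINT \<omega>|\<mu>. \<omega> \<phi> ^ k) / fact k"
    by (simp only: integral_divide_zero integral_complex_of_real)
  finally show "complex_of_real (LINT \<omega>|\<mu>. \<omega> \<phi> ^ k) = fact k * fps_nth l k"
    by (simp add: field_simps)
qed

text \<open>
  A holomorphic \<open>G\<close> on a strip makes the moments grow slowly enough for an exponential moment of \<open>\<omega> \<phi>\<close>.
  Then the Laplace transform is holomorphic on a strip, too. It is determined by its derivatives at \<open>0\<close>,
  and the strip contains \<open>\<i>\<close>, although the power series at \<open>0\<close> need not converge there.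
\<close>

lemma characteristic_function_eq:
  assumes G: "G holomorphic_on strip \<delta>" "\<delta> > 0" and Gl: "G has_fps_expansion l"
  shows "(LINT \<omega>|\<mu>. exp (\<i> * complex_of_real (\<omega> \<phi>))) = G \<i>"
proof -
  \<comment> \<open>Absolute convergence of the moment series is available only strictly inside the strip.\<close>
  define \<epsilon> where "\<epsilon> = \<delta> / 2"
  have \<epsilon>: "0 < \<epsilon>" "\<epsilon> < \<delta>" using G(2) by (auto simp: \<epsilon>_def)
  note [measurable] = measurable_evaluation
  have "eball 0 (ereal \<delta>) \<subseteq> strip \<delta>"
    by (auto simp: strip_def intro: le_less_trans[OF abs_Re_le_cmod])
  hence "fps_conv_radius l \<ge> ereal \<delta>"
    using Gl G(1) by (intro holomorphic_on_imp_fps_conv_radius_ge) (auto intro: holomorphic_on_subset)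
  hence "summable (\<lambda>n. norm (fps_nth l n * of_real \<epsilon> ^ n))"
    using \<epsilon> unfolding fps_conv_radius_def
    by (intro abs_summable_in_conv_radius) (auto intro: less_le_trans[of _ "ereal \<delta>"])
  hence "summable (\<lambda>n. if even n then \<epsilon> ^ n / fact n * (LINT \<omega>|\<mu>. \<omega> \<phi> ^ n) else 0)"
  proof (rule summable_comparison_test'[where N = 0])
    fix n
    have "complex_of_real (\<epsilon> ^ n / fact n * (LINT \<omega>|\<mu>. \<omega> \<phi> ^ n)) = fps_nth l n * of_real \<epsilon> ^ n"
      using evaluation_moments(2)[of n] by simp
    hence "norm (\<epsilon> ^ n / fact n * (LINT \<omega>|\<mu>. \<omega> \<phi> ^ n)) = norm (fps_nth l n * of_real \<epsilon> ^ n)"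
      by (metis norm_of_real real_norm_def)
    thus "norm (if even n then \<epsilon> ^ n / fact n * (LINT \<omega>|\<mu>. \<omega> \<phi> ^ n) else 0) \<le> norm (fps_nth l n * of_real \<epsilon> ^ n)"
      by auto
  qed
  hence "integrable \<mu> (\<lambda>\<omega>. exp (\<epsilon> * \<bar>\<omega> \<phi>\<bar>))"
    using \<epsilon> evaluation_moments(1) by (intro integrable_exp_abs) (auto elim!: evenE)
  hence exp_int: "integrable \<mu> (\<lambda>\<omega>. 1 * exp (\<epsilon> * \<bar>\<omega> \<phi>\<bar>))" by simp
  define Z where "Z = (\<lambda>z. LINT \<omega>|\<mu>. complex_of_real 1 * exp (z * of_real (\<omega> \<phi>)))"
  have Z: "Z holomorphic_on strip \<epsilon>"
    and Z_deriv: "(deriv ^^ n) Z 0 = complex_of_real (LINT \<omega>|\<mu>. 1 * \<omega> \<phi> ^ n)" for n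
    unfolding Z_def using \<epsilon>
    by (intro laplace_transform_holomorphic[where w = "\<lambda>_. 1" and \<delta> = \<epsilon>] exp_int; simp)+
  have "Z \<i> = G \<i>"
  proof (rule holomorphic_fun_eq_on_connected[OF Z _ open_strip connected_strip])
    show "G holomorphic_on strip \<epsilon>"
      using G(1) by (rule holomorphic_on_subset) (use \<epsilon> in \<open>auto simp: strip_def\<close>)
    show "(deriv ^^ n) Z 0 = (deriv ^^ n) G 0" for n
      using fps_nth_fps_expansion[OF Gl, of n] evaluation_moments(2)[of n] by (simp add: Z_deriv)
  qed (use \<epsilon> in \<open>auto simp: strip_def\<close>)
  thus ?thesis by (simp add: Z_def)
qed

end

text \<open>
  The derivatives at \<open>0\<close> of the Levy exponent \<open>H\<close> are, by Fubini, products of moments of \<open>\<nu>\<close> and integrals of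
  powers of \<open>\<phi>\<close>. As the former are coefficients of the Riccati solution \<open>f\<close>, the Taylor series of \<open>G\<close>
  satisfies the differential equation that characterizes the moment series.
\<close>

lemma levy_khintchine_formula:
  assumes \<phi>: "\<phi> \<in> test_functions atlas"
    and lam: "0 \<le> lam" "lam < 2"
    and spectral: "spectral_pair atlas \<sigma> lam \<mu> I"
  shows "integrable (\<sigma> \<Otimes>\<^sub>M meixner_measure lam) (levy_integrand \<phi>)" (is ?int)
    and "(LINT \<omega>|\<mu>. exp (\<i> * complex_of_real (\<omega> \<phi>))) =
      exp ((LINT z|(\<sigma> \<Otimes>\<^sub>M meixner_measure lam). levy_integrand \<phi> z) +
        \<i> * complex_of_real (c_coeff lam * (LINT x|\<sigma>. \<phi> x)))" (is ?char)
proof -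
  let ?\<nu> = "meixner_measure lam"
  let ?N = "\<sigma> \<Otimes>\<^sub>M ?\<nu>"
  interpret sigma: sigma_finite_measure \<sigma> by (rule sigma_finite)
  interpret nu: sigma_finite_measure ?\<nu> by (rule sigma_finite_meixner[OF lam])
  interpret pair_sigma_finite \<sigma> ?\<nu> ..
  note [measurable] = measurable_test_function[OF \<phi>]
  note [measurable_cong] = sets_meixner_measure[OF lam]
  obtain f :: "complex fps" where f: "fps_nth f 0 = 0" "fps_deriv f = 1 + fps_const (of_real lam) * f + f\<^sup>2"
    and f_nth: "\<And>k. fps_nth f (Suc k) = of_real ((LINT s|?\<nu>. s ^ (k + 2)) / fact (Suc k))"
    by (rule meixner_riccati[OF lam]) blast
  obtain \<delta>0 where \<delta>0: "\<delta>0 > 0" "integrable ?\<nu> (\<lambda>s. s\<^sup>2 * exp (\<delta>0 * \<bar>s\<bar>))"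
    by (rule meixner_exponential_moment[OF lam])
  obtain B where B: "0 \<le> B" "\<And>x. \<bar>\<phi> x\<bar> \<le> B" by (rule test_function_bounded[OF \<phi>]) blast
  \<comment> \<open>Adding \<open>1\<close> avoids division by zero for \<open>\<phi> = 0\<close>.\<close>
  define \<delta> where "\<delta> = \<delta>0 / (B + 1)"
  have \<delta>: "\<delta> > 0" "\<delta> * B \<le> \<delta>0" using \<delta>0(1) B(1) by (auto simp: \<delta>_def field_simps)
  define h where "h = (\<lambda>(x, s). s * \<phi> x)"
  have [measurable]: "h \<in> borel_measurable ?N" unfolding h_def by measurable
  have h_int: "integrable ?N (\<lambda>p. (h p)\<^sup>2 * exp (\<delta> * \<bar>h p\<bar>))"
  proof (rule Bochner_Integration.integrable_bound)
    have "integrable \<sigma> (\<lambda>x. (\<phi> x)\<^sup>2)"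
      using integrable_power_test_function[OF \<phi>, of 1] by (simp add: numeral_2_eq_2)
    from integrable_product(1)[OF this \<delta>0(2)]
    show "integrable ?N (\<lambda>(x, s). (\<phi> x)\<^sup>2 * (s\<^sup>2 * exp (\<delta>0 * \<bar>s\<bar>)))" .
    have "norm ((h p)\<^sup>2 * exp (\<delta> * \<bar>h p\<bar>)) \<le> norm (case p of (x, s) \<Rightarrow> (\<phi> x)\<^sup>2 * (s\<^sup>2 * exp (\<delta>0 * \<bar>s\<bar>)))" for p
    proof (cases p)
      case (Pair x s)
      have "\<delta> * \<bar>\<phi> x\<bar> \<le> \<delta>0"
        using mult_left_mono[OF B(2)[of x], of \<delta>] \<delta> by linarith
      hence "\<delta> * \<bar>\<phi> x\<bar> * \<bar>s\<bar> \<le> \<delta>0 * \<bar>s\<bar>" by (intro mult_right_mono) auto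
      hence "\<delta> * \<bar>h p\<bar> \<le> \<delta>0 * \<bar>s\<bar>" by (simp add: h_def Pair abs_mult mult_ac)
      hence "(h p)\<^sup>2 * exp (\<delta> * \<bar>h p\<bar>) \<le> (h p)\<^sup>2 * exp (\<delta>0 * \<bar>s\<bar>)"
        by (intro mult_left_mono) auto
      thus ?thesis by (simp add: h_def Pair power_mult_distrib mult_ac)
    qed
    thus "AE p in ?N. norm ((h p)\<^sup>2 * exp (\<delta> * \<bar>h p\<bar>)) \<le> norm (case p of (x, s) \<Rightarrow> (\<phi> x)\<^sup>2 * (s\<^sup>2 * exp (\<delta>0 * \<bar>s\<bar>)))"
      by simp
  qed measurable
  have h_moments: "(LINT p|?N. h p ^ (k + 2)) = (LINT x|\<sigma>. \<phi> x ^ (k + 2)) * (LINT s|?\<nu>. s ^ (k + 2))" for k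
  proof -
    have "integrable \<sigma> (\<lambda>x. \<phi> x ^ (k + 2))" using integrable_power_test_function[OF \<phi>, of "k + 1"] by simp
    moreover have "integrable ?\<nu> (\<lambda>s. s ^ (k + 2))"
      by (rule integrable_power_of_exponential_moment[OF _ \<delta>0]) simp
    ultimately have "(LINT p|?N. (case p of (x, s) \<Rightarrow> \<phi> x ^ (k + 2) * s ^ (k + 2))) =
        (LINT x|\<sigma>. \<phi> x ^ (k + 2)) * (LINT s|?\<nu>. s ^ (k + 2))"
      by (rule integrable_product(2))
    also have "(\<lambda>p. case p of (x, s) \<Rightarrow> \<phi> x ^ (k + 2) * s ^ (k + 2)) = (\<lambda>p. h p ^ (k + 2))"
      by (auto simp: h_def power_mult_distrib mult_ac)
    finally show ?thesis .
  qed

  define H where "H = (\<lambda>z::complex. LINT p|?N. exp (z * of_real (h p)) - 1 - z * of_real (h p))"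
  have H_hol: "H holomorphic_on strip \<delta>"
    and H_deriv: "(deriv ^^ n) H 0 = (if n < 2 then 0 else of_real (LINT p|?N. h p ^ n))" for n
    unfolding H_def using \<delta>(1) h_int by (intro compensated_exp_integral_holomorphic; simp)+
  define c where "c = complex_of_real (c_coeff lam * (LINT x|\<sigma>. \<phi> x))"
  define G where "G = (\<lambda>z. exp (H z + c * z))"
  have G_hol: "G holomorphic_on strip \<delta>"
    unfolding G_def by (intro holomorphic_intros H_hol)
  have strip0: "0 \<in> strip \<delta>" "\<i> \<in> strip \<delta>" using \<delta>(1) by (auto simp: strip_def)
  have H_exp: "H has_fps_expansion fps_expansion H 0"
    using analytic_at_imp_has_fps_expansion_0 H_hol open_strip strip0(1) by (auto simp: analytic_at)
  define l where "l = fps_expansion G 0"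
  have G_exp: "G has_fps_expansion l"
    unfolding l_def using analytic_at_imp_has_fps_expansion_0 G_hol open_strip strip0(1) by (auto simp: analytic_at)
  have H0: "H 0 = 0" using H_deriv[of 0] by simp
  have l0: "fps_nth l 0 = 1" using fps_nth_fps_expansion[OF G_exp, of 0] by (simp add: G_def H0)

  have dG: "deriv G z = G z * (deriv H z + c)" if "z \<in> strip \<delta>" for z
    unfolding G_def
    by (rule DERIV_imp_deriv)
      (auto intro!: derivative_eq_intros holomorphic_derivI[OF H_hol open_strip that])
  have "deriv G has_fps_expansion l * (fps_deriv (fps_expansion H 0) + fps_const c)"
  proof -
    have ev: "\<forall>\<^sub>F z in nhds 0. deriv G z = G z * (deriv H z + c)"
      using eventually_nhds_in_open[OF open_strip strip0(1)] by eventually_elim (rule dG)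
    show ?thesis
      unfolding has_fps_expansion_cong[OF ev refl] by (intro fps_expansion_intros G_exp H_exp)
  qed
  moreover have "deriv G has_fps_expansion fps_deriv l" by (rule has_fps_expansion_deriv[OF G_exp])
  ultimately have "fps_deriv l = l * (fps_deriv (fps_expansion H 0) + fps_const c)"
    by (rule fps_expansion_unique_complex[symmetric])
  also have "fps_deriv (fps_expansion H 0) = Abs_fps (\<lambda>j. fps_nth f j * of_real (LINT y|\<sigma>. \<phi> y ^ Suc j))"
  proof (rule fps_ext)
    fix j
    have "fps_nth (fps_deriv (fps_expansion H 0)) j = of_nat (Suc j) * ((deriv ^^ Suc j) H 0 / fact (Suc j))"
      by (simp only: fps_deriv_nth fps_nth_fps_expansion[OF H_exp] Suc_eq_plus1)
    also have "\<dots> = (deriv ^^ Suc j) H 0 / fact j"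
      by (simp del: funpow.simps of_nat_Suc)
    also have "\<dots> = fps_nth f j * of_real (LINT y|\<sigma>. \<phi> y ^ Suc j)"
    proof (cases j)
      case 0
      thus ?thesis using H_deriv[of 1] f(1) by simp
    next
      case (Suc k)
      have "(deriv ^^ Suc j) H 0 = of_real ((LINT x|\<sigma>. \<phi> x ^ (k + 2)) * (LINT s|?\<nu>. s ^ (k + 2)))"
        using H_deriv[of "Suc j"] h_moments[of k] Suc by (simp del: funpow.simps of_real_mult)
      thus ?thesis by (simp add: Suc f_nth del: funpow.simps)
    qed
    finally show "fps_nth (fps_deriv (fps_expansion H 0)) j =
      fps_nth (Abs_fps (\<lambda>j. fps_nth f j * of_real (LINT y|\<sigma>. \<phi> y ^ Suc j))) j" by simp
  qed
  finally have l: "fps_deriv l = l * (Abs_fps (\<lambda>j. fps_nth f j * of_real (LINT y|\<sigma>. \<phi> y ^ Suc j)) +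
      fps_const (of_real (c_coeff lam * (LINT y|\<sigma>. \<phi> y))))" by (simp only: c_def)

  have levy: "levy_integrand \<phi> = (\<lambda>p. exp (\<i> * of_real (h p)) - 1 - \<i> * of_real (h p))"
    by (auto simp: levy_integrand_def h_def)
  show ?int
    unfolding levy by (rule compensated_exp_integral_holomorphic(3)[OF _ \<delta>(1) h_int strip0(2)]) measurable
  have "(LINT \<omega>|\<mu>. exp (\<i> * complex_of_real (\<omega> \<phi>))) = G \<i>"
    by (rule characteristic_function_eq[OF \<phi> spectral f l0 l G_hol \<delta>(1) G_exp])
  thus ?char by (simp add: G_def H_def levy c_def mult.commute)
qed

end

theorem corollary2p4:
  fixes atlas :: "('a::{t2_space, second_countable_topology}, 'n::finite) chart set"
    and g :: "('a, 'n) chart \<Rightarrow> real ^ 'n \<Rightarrow> real ^ 'n ^ 'n"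
    and \<sigma> :: "'a measure"
    and lam :: real
    and \<mu> :: "(('a \<Rightarrow> real) \<Rightarrow> real) measure"
    and I :: "'a fock \<Rightarrow> (('a \<Rightarrow> real) \<Rightarrow> real) \<Rightarrow> complex"
  assumes "noise_setting atlas g \<sigma>"
    and "0 \<le> lam" and "lam < 2"
    and "spectral_pair atlas \<sigma> lam \<mu> I"
  shows "levy_noise_measure atlas \<sigma> \<mu>
    (density lborel (\<lambda>s. ennreal
      (sqrt (4 - lam\<^sup>2) / (2 * pi)
       * (cmod (Gamma (1 + \<i> * complex_of_real ((4 - lam\<^sup>2) powr (- 1 / 2) * s))))\<^sup>2
       * exp (2 * s * (4 - lam\<^sup>2) powr (- 1 / 2) * arctan (lam * (4 - lam\<^sup>2) powr (- 1 / 2)))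
       * (1 / s\<^sup>2))))
    (c_coeff lam)"
proof -
  interpret noise_setting atlas g \<sigma> by fact
  have "prob_space \<mu>" "space \<mu> = dual_space atlas" "sets \<mu> = sets (cylinder_algebra atlas)"
    using assms(4) by (auto simp: spectral_pair_def)
  thus ?thesis
    unfolding levy_noise_measure_def meixner_measure_eq_density[symmetric]
    using levy_measure_meixner[OF assms(2,3)] levy_khintchine_formula[OF _ assms(2-4)] by blast
qed

end
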